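(* Suppose $0<p\le 1$, $0<r<1$, and $f$ is an analytic function in the unit disk $\mathbb{D}$. Then $f$ belongs to the analytic Besov space $B_p$ if and only if it admits a representation $$f(z)=\int_{\mathbb{D}}\frac{z-w}{1-z\overline{w}}\,d\mu(w),\qquad z\in\mathbb{D},$$ where $\mu$ is a complex Borel measure on $\mathbb{D}$ such that the localized function $z\mapsto|\mu|(D(z,r))$ belongs to $L^p(\mathbb{D},d\lambda)$.
   Context: $\mathbb{D}$ is the open unit disk in $\mathbb{C}$, $dA$ is the normalized area measure on $\mathbb{D}$, and $d\lambda(z)=\dfrac{dA(z)}{(1-|z|^2)^2}$ is the Möbius invariant area measure. For $0<p<\infty$, the analytic Besov space $B_p$ consists of all analytic functions $f$ on $\mathbb{D}$ such that $(1-|z|^2)^k f^{(k)}(z)$ belongs to $L^p(\mathbb{D},d\lambda)$, where $k$ is any positive integer with $pk>1$ (the space is independent of the choice of such $k$). $D(z,r)=\left\{w\in\mathbb{D}:\left|\frac{z-w}{1-z\overline{w}}\right|<r\right\}$ is the pseudo-hyperbolic disk at $z$ with radius $r$, and $|\mu|$ denotes the total variation measure of $\mu$. *)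

theory Defs
  imports "HOL-Analysis.Analysis"
begin

abbreviation unit_disk :: "complex set" where
  "unit_disk \<equiv> ball 0 1"

definition pseudohyperbolic_disk :: "complex \<Rightarrow> real \<Rightarrow> complex set" where
  "pseudohyperbolic_disk z r =
    {w \<in> unit_disk. cmod ((z - w) / (1 - z * cnj w)) < r}"

definition disk_area :: "complex measure" where
  "disk_area = scale_measure (ennreal (1 / pi)) (restrict_space lborel unit_disk)"

definition mobius_measure :: "complex measure" where
  "mobius_measure = density disk_area (\<lambda>z. ennreal (1 / (1 - (cmod z)\<^sup>2)\<^sup>2))"

definition Lp_space :: "real \<Rightarrow> 'a measure \<Rightarrow> ('a \<Rightarrow> 'b::real_normed_vector) set" where
  "Lp_space p M = {g \<in> borel_measurable M. integrable M (\<lambda>x. norm (g x) powr p)}"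

text \<open>The analytic Besov space \<open>B\<^sub>p\<close>, described by means of the derivative of order \<open>k\<close>.
  It is meant for \<open>k > 0\<close> and \<open>p * k > 1\<close>; among these \<open>k\<close>, the space does not depend
  on the choice.\<close>

definition besov_space :: "nat \<Rightarrow> real \<Rightarrow> (complex \<Rightarrow> complex) set" where
  "besov_space k p = {f. f analytic_on unit_disk \<and>
    (\<lambda>z. (1 - (cmod z)\<^sup>2) ^ k *\<^sub>R (deriv ^^ k) f z) \<in> Lp_space p mobius_measure}"

text \<open>In the following definitions only the measurable space underlying \<open>M\<close> matters.
  A complex measure is a countably additive complex-valued set function;
  \<open>\<mu> {} = 0\<close> follows by taking all sets to be empty.\<close>

definition complex_measure :: "'a measure \<Rightarrow> ('a set \<Rightarrow> complex) \<Rightarrow> bool" where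
  "complex_measure M \<mu> \<longleftrightarrow>
    (\<forall>A::nat \<Rightarrow> 'a set. range A \<subseteq> sets M \<longrightarrow> disjoint_family A \<longrightarrow>
      (\<lambda>i. \<mu> (A i)) sums \<mu> (\<Union>i. A i))"

text \<open>The supremum runs over countable measurable partitions of \<open>E\<close> and is finite whenever
  \<open>\<mu>\<close> is a complex measure and \<open>E\<close> is measurable, so \<^const>\<open>enn2real\<close> loses nothing there.\<close>

definition total_variation :: "'a measure \<Rightarrow> ('a set \<Rightarrow> complex) \<Rightarrow> 'a set \<Rightarrow> ennreal" where
  "total_variation M \<mu> E =
    (SUP A\<in>{A::nat \<Rightarrow> 'a set. range A \<subseteq> sets M \<and> disjoint_family A \<and> (\<Union>i. A i) = E}.
      \<Sum>i. ennreal (cmod (\<mu> (A i))))"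

text \<open>The positive part \<open>\<nu>\<^sup>+\<close> in the Jordan decomposition \<open>\<nu> = \<nu>\<^sup>+ - \<nu>\<^sup>-\<close> of a finite
  signed measure \<open>\<nu>\<close>. The negative part \<open>\<nu>\<^sup>-\<close> is the positive part of \<open>- \<nu>\<close>.
  For countably additive \<open>\<nu>\<close> the set function below is a finite measure: by the Hahn
  decomposition, it is \<open>\<nu>\<close> restricted to a positive set of \<open>\<nu>\<close>.\<close>

definition jordan_pos :: "'a measure \<Rightarrow> ('a set \<Rightarrow> real) \<Rightarrow> 'a measure" where
  "jordan_pos M \<nu> = measure_of (space M) (sets M)
    (\<lambda>E. SUP B\<in>{B \<in> sets M. B \<subseteq> E}. ennreal (\<nu> B))"

definition signed_integral :: "'a measure \<Rightarrow> ('a set \<Rightarrow> real) \<Rightarrow> ('a \<Rightarrow> complex) \<Rightarrow> complex" where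
  "signed_integral M \<nu> g =
    integral\<^sup>L (jordan_pos M \<nu>) g - integral\<^sup>L (jordan_pos M (\<lambda>E. - \<nu> E)) g"

definition complex_measure_integral ::
    "'a measure \<Rightarrow> ('a set \<Rightarrow> complex) \<Rightarrow> ('a \<Rightarrow> complex) \<Rightarrow> complex" where
  "complex_measure_integral M \<mu> g =
    signed_integral M (\<lambda>E. Re (\<mu> E)) g + \<i> * signed_integral M (\<lambda>E. Im (\<mu> E)) g"

abbreviation disk_borel :: "complex measure" where
  "disk_borel \<equiv> restrict_space borel unit_disk"

end

theory Submission
  imports Defs "HOL-Complex_Analysis.Complex_Analysis"
begin

text \<open>
  If \<open>f\<close> is represented by \<open>\<mu>\<close>, then \<open>(1 - |z|\<^sup>2)\<^sup>k |f\<^sup>(\<^sup>k\<^sup>)(z)|\<close> is at most a constant times the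
  integral of \<open>K(z,w) = (1 - |z|\<^sup>2)\<^sup>k (1 - |w|\<^sup>2) / |1 - z cnj w|\<^bsup>k+1\<^esup>\<close> against \<open>|\<mu>|\<close>. The kernel is
  almost constant on small hyperbolic disks, so for \<open>p \<le> 1\<close> the \<open>p\<close>-th power of this integral is
  at most a constant times \<open>\<integral> K(z,v)\<^sup>p |\<mu>|(D(v,r))\<^sup>p d\<lambda>(v)\<close>; no lattice is needed. Integrating in
  \<open>z\<close>, the Forelli-Rudin estimate bounds \<open>\<integral> K(z,v)\<^sup>p d\<lambda>(z)\<close>.

  Conversely, on the circle \<open>|w|\<^sup>2 = t\<close> one has \<open>cnj w = t / w\<close>, so by Cauchy's formula the mean over
  this circle of \<open>(z - w) / (1 - z cnj w)\<close> times \<open>f\<^sup>(\<^sup>k\<^sup>)(w) / cnj w\<^bsup>k-1\<^esup>\<close> is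
  \<open>(1 - t) z\<^sup>k f\<^sup>(\<^sup>k\<^sup>)(t z)\<close>. With the weight \<open>(1 - t)\<^bsup>k-2\<^esup> / (k - 1)!\<close>, integration over
  \<open>1/2 \<le> t \<le> 1\<close> gives the integral remainder of the Taylor formula from \<open>z/2\<close> to \<open>z\<close>. What is missing
  is the Taylor polynomial at \<open>z/2\<close>, which is analytic in \<open>z\<close> for \<open>|z| < 2\<close> and therefore represented
  by a bounded density on a compact annulus. The localized density lies in \<open>L\<^sup>p\<close> by the sub-mean value
  inequality for \<open>|g|\<^sup>p\<close>, \<open>g\<close> analytic.
\<close>

section \<open>Rotations and circle averages\<close>

text \<open>The density with \<open>cnj w ^ (k - 1)\<close> in the denominator is singular at the
  origin, and this shapes the second half. It is used only for |w|^2 >= 1/2, which produces the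
  Taylor remainder from z/2 instead of 0. The same 1/2 leaves a remaining part that is analytic up
  to radius 2, hence defined at the reflected points 1 / cnj w, whose modulus is at most sqrt 2.
  Both pieces of the final density are dominated by functions (1 - |w|^2)^k |g| with g holomorphic
  (the k-th derivative of f, or the constant 1), so one lemma gives finiteness of the measure and
  the localized bound. In the first half a lattice would turn an integral into a sum, on which the
  p-th power is subadditive for p <= 1. Averaging over a neighbourhood of every point has the same
  effect. The neighbourhoods compare Euclidean distance with the distance to the unit circle: they
  are symmetric, compose with explicit constants and have measure bounded above and below, so
  neither Moebius maps nor the invariance of \<lambda> enter.\<close>

lemma distr_lborel_Complex:
  "distr (lborel \<Otimes>\<^sub>M lborel) borel (\<lambda>(x, y). Complex x y) = (lborel :: complex measure)"
proof (rule lborel_eqI[symmetric])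
  have meas: "(\<lambda>(x, y). Complex x y) \<in> borel_measurable (lborel \<Otimes>\<^sub>M lborel)"
    unfolding Complex_eq by measurable
  show "sets (distr (lborel \<Otimes>\<^sub>M lborel) borel (\<lambda>(x, y). Complex x y)) = sets borel" by simp
  fix l u :: complex
  assume le: "\<And>b. b \<in> Basis \<Longrightarrow> l \<bullet> b \<le> u \<bullet> b"
  have le': "Re l \<le> Re u" "Im l \<le> Im u"
    using le[of 1] le[of \<i>] by (auto simp: Basis_complex_def inner_complex_def)
  have eq: "(\<lambda>(x, y). Complex x y) -` box l u \<inter> space (lborel \<Otimes>\<^sub>M lborel) =
      {Re l<..<Re u} \<times> {Im l<..<Im u}"
    by (auto simp: box_def Basis_complex_def inner_complex_def space_pair_measure)
  have "emeasure (distr (lborel \<Otimes>\<^sub>M lborel) borel (\<lambda>(x, y). Complex x y)) (box l u)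
      = emeasure (lborel \<Otimes>\<^sub>M lborel) ({Re l<..<Re u} \<times> {Im l<..<Im u})"
    using meas by (subst emeasure_distr) (auto simp: eq)
  also have "\<dots> = emeasure lborel {Re l<..<Re u} * emeasure lborel {Im l<..<Im u}"
    by (intro lborel.emeasure_pair_measure_Times) auto
  also have "\<dots> = ennreal (\<Prod>b\<in>Basis. (u - l) \<bullet> b)"
    using le' by (simp add: Basis_complex_def inner_complex_def ennreal_mult)
  finally show "emeasure (distr (lborel \<Otimes>\<^sub>M lborel) borel (\<lambda>(x, y). Complex x y)) (box l u)
      = (\<Prod>b\<in>Basis. (u - l) \<bullet> b)" .
qed

lemma measurable_Complex_pair: "(\<lambda>(x, y). Complex x y) \<in> borel_measurable (lborel \<Otimes>\<^sub>M lborel)"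
  unfolding Complex_eq by measurable

text \<open>Lebesgue measure on the plane is determined by its values on boxes, where it agrees with
  a product of two lines. Both orders of integration are recorded because the shears below move
  different coordinates.\<close>

lemma nn_integral_lborel_complex:
  fixes F :: "complex \<Rightarrow> ennreal"
  assumes [measurable]: "F \<in> borel_measurable borel"
  shows "(\<integral>\<^sup>+z. F z \<partial>lborel) = (\<integral>\<^sup>+x. \<integral>\<^sup>+y. F (Complex x y) \<partial>lborel \<partial>lborel)"
    and "(\<integral>\<^sup>+z. F z \<partial>lborel) = (\<integral>\<^sup>+y. \<integral>\<^sup>+x. F (Complex x y) \<partial>lborel \<partial>lborel)"
proof -
  interpret lborel_pair: pair_sigma_finite lborel lborel ..
  note measurable_Complex_pair[measurable]
  have [measurable]: "(\<lambda>(x, y). F (Complex x y)) \<in> borel_measurable (lborel \<Otimes>\<^sub>M lborel)"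
    using measurable_compose[OF measurable_Complex_pair assms] by (simp add: case_prod_beta')
  have *: "(\<integral>\<^sup>+z. F z \<partial>lborel) = (\<integral>\<^sup>+p. (\<lambda>(x, y). F (Complex x y)) p \<partial>(lborel \<Otimes>\<^sub>M lborel))"
    by (subst distr_lborel_Complex[symmetric], subst nn_integral_distr) (auto simp: case_prod_beta')
  show "(\<integral>\<^sup>+z. F z \<partial>lborel) = (\<integral>\<^sup>+x. \<integral>\<^sup>+y. F (Complex x y) \<partial>lborel \<partial>lborel)"
    unfolding * by (subst lborel.nn_integral_fst[symmetric]) auto
  show "(\<integral>\<^sup>+z. F z \<partial>lborel) = (\<integral>\<^sup>+y. \<integral>\<^sup>+x. F (Complex x y) \<partial>lborel \<partial>lborel)"
    unfolding * by (subst lborel_pair.nn_integral_snd[symmetric]) auto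
qed

text \<open>With the other coordinate fixed, a shear is a translation of the line, so integrating in
  the sheared coordinate first removes it.\<close>

lemma nn_integral_lborel_shear:
  fixes F :: "complex \<Rightarrow> ennreal"
  assumes [measurable]: "F \<in> borel_measurable borel"
  shows "(\<integral>\<^sup>+z. F (z + of_real (t * Im z)) \<partial>lborel) = (\<integral>\<^sup>+z. F z \<partial>lborel)"
    and "(\<integral>\<^sup>+z. F (z + \<i> * of_real (t * Re z)) \<partial>lborel) = (\<integral>\<^sup>+z. F z \<partial>lborel)"
proof -
  have C: "Complex x y = of_real x + \<i> * of_real y" for x y by (simp add: Complex_eq)
  have [measurable]: "(\<lambda>x. F (Complex x y)) \<in> borel_measurable borel"
      "(\<lambda>y. F (Complex x y)) \<in> borel_measurable borel" for x y
    unfolding C by measurable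
  have 1: "Complex x y + of_real (t * y) = Complex (t * y + 1 * x) y" for x y
    by (simp add: complex_eq_iff)
  have 2: "Complex x y + \<i> * of_real (t * x) = Complex x (t * x + 1 * y)" for x y
    by (simp add: complex_eq_iff)
  have tr: "(\<integral>\<^sup>+x. g (a + 1 * x) \<partial>lborel) = (\<integral>\<^sup>+x. g x \<partial>lborel)"
    if "g \<in> borel_measurable borel" for g :: "real \<Rightarrow> ennreal" and a
    using nn_integral_real_affine[OF that, of 1 a] by simp
  show "(\<integral>\<^sup>+z. F (z + of_real (t * Im z)) \<partial>lborel) = (\<integral>\<^sup>+z. F z \<partial>lborel)"
    by (subst (1 2) nn_integral_lborel_complex(2), measurable)
       (simp only: complex.sel 1, subst tr, auto)
  show "(\<integral>\<^sup>+z. F (z + \<i> * of_real (t * Re z)) \<partial>lborel) = (\<integral>\<^sup>+z. F z \<partial>lborel)"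
    by (subst (1 2) nn_integral_lborel_complex(1), measurable)
       (simp only: complex.sel 2, subst tr, auto)
qed

text \<open>A rotation by an angle other than \<open>\<pi>\<close> is a composition of three shears.\<close>

lemma nn_integral_lborel_rotate:
  fixes F :: "complex \<Rightarrow> ennreal"
  assumes [measurable]: "F \<in> borel_measurable borel" and c: "cmod c = 1"
  shows "(\<integral>\<^sup>+z. F (c * z) \<partial>lborel) = (\<integral>\<^sup>+z. F z \<partial>lborel)"
proof -
  have main: "(\<integral>\<^sup>+z. F (c * z) \<partial>lborel) = (\<integral>\<^sup>+z. F z \<partial>lborel)"
    if [measurable]: "F \<in> borel_measurable borel" and c: "cmod c = 1" "Re c \<noteq> -1"
    for c and F :: "complex \<Rightarrow> ennreal"
  proof -
    \<comment> \<open>For \<open>c = cis \<phi>\<close> this is t = - tan (\<phi> / 2). The outer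
      shears have slope t and the middle one slope sin \<phi>; the two identities \<open>bt\<close>
      and \<open>t1\<close> are the half-angle formulas.\<close>
    define a b t where "a = Re c" and "b = Im c" and "t = - b / (1 + a)"
    define S where "S s z = z + complex_of_real (s * Im z)" for s z
    define S' where "S' s z = z + \<i> * complex_of_real (s * Re z)" for s z
    have [measurable]: "S s \<in> borel_measurable borel" "S' s \<in> borel_measurable borel" for s
      unfolding S_def S'_def by measurable
    have ab: "a\<^sup>2 + b\<^sup>2 = 1" using c by (simp add: a_def b_def cmod_def)
    have a1: "1 + a \<noteq> 0" using c(2) by (auto simp: a_def)
    have bt: "b * t = a - 1" and t1: "t * (1 + a) = - b"
      using a1 ab unfolding t_def by (auto simp: field_simps power2_eq_square)
    have "S t (S' b (S t z)) = c * z" for z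
    proof -
      obtain x y where z: "z = Complex x y" by (cases z)
      have "y + b * (x + t * y) = b * x + (b * t + 1) * y" by algebra
      then have 1: "y + b * (x + t * y) = b * x + a * y" by (simp add: bt)
      have "(x + t * y) + t * (b * x + a * y) = (1 + b * t) * x + (t * (1 + a)) * y" by algebra
      then have 2: "(x + t * y) + t * (b * x + a * y) = a * x - b * y" by (simp add: bt t1)
      have "S t z = Complex (x + t * y) y" by (simp add: S_def z complex_eq_iff)
      then have "S' b (S t z) = Complex (x + t * y) (b * x + a * y)"
        by (simp add: S'_def complex_eq_iff 1)
      then have "S t (S' b (S t z)) = Complex (a * x - b * y) (b * x + a * y)"
        by (simp add: S_def complex_eq_iff 2)
      then show ?thesis by (simp add: z complex_eq_iff a_def b_def algebra_simps)
    qed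
    then have "(\<integral>\<^sup>+z. F (c * z) \<partial>lborel) = (\<integral>\<^sup>+z. F (S t (S' b (S t z))) \<partial>lborel)" by simp
    also have "\<dots> = (\<integral>\<^sup>+z. F (S t (S' b z)) \<partial>lborel)"
      using nn_integral_lborel_shear(1)[of "\<lambda>z. F (S t (S' b z))" t, folded S_def]
      by simp
    also have "\<dots> = (\<integral>\<^sup>+z. F (S t z) \<partial>lborel)"
      using nn_integral_lborel_shear(2)[of "\<lambda>z. F (S t z)" b, folded S'_def]
      by simp
    also have "\<dots> = (\<integral>\<^sup>+z. F z \<partial>lborel)"
      using nn_integral_lborel_shear(1)[of F t, folded S_def] by simp
    finally show ?thesis .
  qed
  show ?thesis
  proof (cases "Re c = -1")
    \<comment> \<open>Here \<open>1 + a\<close> vanishes and the half-angle slope does not exist;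
      two quarter turns replace the half turn.\<close>
    case True
    then have "c = -1" using c cmod_eq_Re[of c] norm_complex_def[of c]
      by (auto simp: complex_eq_iff cmod_def)
    then have "c = \<i> * \<i>" by simp
    then have "(\<integral>\<^sup>+z. F (c * z) \<partial>lborel) = (\<integral>\<^sup>+z. F (\<i> * (\<i> * z)) \<partial>lborel)" by simp
    also have "\<dots> = (\<integral>\<^sup>+z. F (\<i> * z) \<partial>lborel)"
      by (rule main[of "\<lambda>z. F (\<i> * z)" \<i>]) auto
    also have "\<dots> = (\<integral>\<^sup>+z. F z \<partial>lborel)" by (rule main[of F \<i>]) auto
    finally show ?thesis .
  next
    case False
    then show ?thesis using main[of F c] c by simp
  qed
qed

section \<open>Normalized area measure on the disk\<close>

lemma space_disk_area [simp]: "space disk_area = unit_disk"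
  by (simp add: disk_area_def space_scale_measure space_restrict_space)

lemma sets_disk_area [measurable_cong]: "sets disk_area = sets disk_borel"
  by (simp add: disk_area_def sets_restrict_space)

lemma borel_measurable_indicator_disk:
  fixes F :: "complex \<Rightarrow> ennreal"
  assumes "F \<in> borel_measurable disk_borel"
  shows "(\<lambda>z. F z * indicator unit_disk z) \<in> borel_measurable borel"
  using assms by (subst (asm) borel_measurable_restrict_space_iff_ennreal) auto

lemma nn_integral_disk_area:
  fixes F :: "complex \<Rightarrow> ennreal"
  assumes "F \<in> borel_measurable disk_borel"
  shows "(\<integral>\<^sup>+z. F z \<partial>disk_area) = ennreal (1 / pi) * (\<integral>\<^sup>+z. F z * indicator unit_disk z \<partial>lborel)"
proof -
  have "F \<in> borel_measurable (restrict_space lborel unit_disk)"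
    using assms by (simp cong: measurable_cong_sets add: sets_restrict_space)
  then show ?thesis
    unfolding disk_area_def
    by (subst nn_integral_scale_measure) (auto simp: nn_integral_restrict_space)
qed

lemma emeasure_disk_area:
  assumes "E \<in> sets disk_borel"
  shows "emeasure disk_area E = ennreal (1 / pi) * emeasure lborel E"
  using assms unfolding disk_area_def
  by (auto simp: emeasure_restrict_space sets_restrict_space)

lemma emeasure_lborel_ball_complex:
  assumes "0 \<le> r" shows "emeasure lborel (ball (a :: complex) r) = ennreal (pi * r\<^sup>2)"
  using emeasure_ball[OF assms, of a] by (simp add: unit_ball_vol_2 power2_eq_square)

lemma sets_disk_borelI: "E \<in> sets borel \<Longrightarrow> E \<subseteq> unit_disk \<Longrightarrow> E \<in> sets disk_borel"
  by (auto simp: sets_restrict_space image_iff intro!: bexI[of _ E])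

lemma emeasure_disk_area_space: "emeasure disk_area unit_disk = 1"
proof -
  have "emeasure disk_area unit_disk = ennreal (1 / pi) * ennreal (pi * 1\<^sup>2)"
    by (subst emeasure_disk_area) (auto intro: sets_disk_borelI simp: emeasure_lborel_ball_complex)
  also have "\<dots> = 1" by (subst ennreal_mult[symmetric]) auto
  finally show ?thesis .
qed

lemma finite_measure_disk_area: "finite_measure disk_area"
  by standard (simp add: emeasure_disk_area_space)

lemma distr_disk_area_rotate:
  assumes c: "cmod c = 1"
  shows "distr disk_area disk_area ((*) c) = disk_area"
proof (rule measure_eqI)
  have m: "(*) c \<in> measurable disk_area disk_area"
  proof -
    have "(*) c \<in> measurable disk_borel disk_borel"
      by (rule measurable_restrict_space3) (auto simp: norm_mult c)
    then show ?thesis by (simp cong: measurable_cong_sets add: sets_disk_area)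
  qed
  fix E assume "E \<in> sets (distr disk_area disk_area ((*) c))"
  then have E: "E \<in> sets disk_borel" by (simp add: sets_disk_area)
  then have E': "E \<in> sets borel" "E \<subseteq> unit_disk" by (auto simp: sets_restrict_space)
  have m1: "(*) c -` E \<inter> unit_disk \<in> sets disk_borel"
    using measurable_sets[OF m, of E] E by (simp add: sets_disk_area)
  have ind: "indicator ((*) c -` E \<inter> unit_disk) z = (indicator E (c * z) :: ennreal)" for z
    using E'(2) by (auto simp: indicator_def norm_mult c subset_eq)
  have "emeasure (distr disk_area disk_area ((*) c)) E
      = emeasure disk_area ((*) c -` E \<inter> unit_disk)"
    using m E by (subst emeasure_distr) (auto simp: sets_disk_area)
  also have "\<dots> = ennreal (1 / pi) * (\<integral>\<^sup>+z. indicator E (c * z) \<partial>lborel)"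
  proof -
    have "(*) c -` E \<inter> unit_disk \<in> sets lborel" using m1 by (auto simp: sets_restrict_space)
    then have "emeasure lborel ((*) c -` E \<inter> unit_disk) = (\<integral>\<^sup>+z. indicator E (c * z) \<partial>lborel)"
      unfolding ind[symmetric] by (rule nn_integral_indicator[symmetric])
    then show ?thesis by (simp add: emeasure_disk_area m1)
  qed
  also have "(\<integral>\<^sup>+z. indicator E (c * z) \<partial>lborel) = emeasure lborel E"
    using E' by (subst nn_integral_lborel_rotate[OF _ c]) auto
  also have "ennreal (1 / pi) * \<dots> = emeasure disk_area E" by (simp add: emeasure_disk_area E)
  finally show "emeasure (distr disk_area disk_area ((*) c)) E = emeasure disk_area E" .
qed simp

section \<open>Means over circles and the distribution of the squared modulus\<close>

abbreviation unit_interval :: "real measure" where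
  "unit_interval \<equiv> restrict_space lborel {0..1}"

lemma emeasure_unit_interval_space: "emeasure unit_interval {0..1} = 1"
  by (simp add: emeasure_restrict_space)

lemma finite_measure_unit_interval: "finite_measure unit_interval"
  by standard (simp add: emeasure_unit_interval_space)

lemma measurable_rotate_disk:
  "(\<lambda>(\<theta>, w). cis (2 * pi * \<theta>) * w) \<in> measurable (unit_interval \<Otimes>\<^sub>M disk_area) disk_area"
proof -
  have i: "(\<lambda>x. x) \<in> borel_measurable unit_interval" "(\<lambda>x. x) \<in> borel_measurable disk_borel"
    by (auto intro: measurable_restrict_space1)
  have s: "snd \<in> borel_measurable (unit_interval \<Otimes>\<^sub>M disk_borel)"
    by (rule measurable_compose[OF measurable_snd i(2)])
  have f: "fst \<in> borel_measurable (unit_interval \<Otimes>\<^sub>M disk_borel)"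
    by (rule measurable_compose[OF measurable_fst i(1)])
  have c: "(\<lambda>t::real. cis (2 * pi * t)) \<in> borel_measurable borel"
    by (intro borel_measurable_continuous_onI continuous_intros)
  have "(\<lambda>x. cis (2 * pi * fst x) * snd x) \<in> borel_measurable (unit_interval \<Otimes>\<^sub>M disk_borel)"
    using measurable_compose[OF f c] s by measurable
  then have "(\<lambda>x. cis (2 * pi * fst x) * snd x) \<in> measurable (unit_interval \<Otimes>\<^sub>M disk_borel) disk_borel"
    by (intro measurable_restrict_space2) (auto simp: norm_mult space_pair_measure)
  then show ?thesis
    by (simp cong: measurable_cong_sets sets_pair_measure_cong add: sets_disk_area case_prod_beta')
qed

lemma measurable_rotate_disk':
  "(*) (cis t) \<in> measurable disk_area disk_area"
proof -
  have "(*) (cis t) \<in> measurable disk_borel disk_borel"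
    by (rule measurable_restrict_space3) (auto simp: norm_mult)
  then show ?thesis by (simp cong: measurable_cong_sets add: sets_disk_area)
qed

text \<open>Rotation invariance and Fubini allow the integrand to be replaced by its mean over the
  circle through \<open>w\<close>. Together with the distribution of |w|^2 below, this does the work
  of polar coordinates.\<close>

lemma nn_integral_disk_area_average:
  fixes F :: "complex \<Rightarrow> ennreal"
  assumes F: "F \<in> borel_measurable disk_borel"
  shows "(\<integral>\<^sup>+w. F w \<partial>disk_area) =
    (\<integral>\<^sup>+w. (\<integral>\<^sup>+\<theta>. F (cis (2 * pi * \<theta>) * w) \<partial>unit_interval) \<partial>disk_area)"
proof -
  have F' [measurable]: "F \<in> borel_measurable disk_area"
    using F by (simp cong: measurable_cong_sets add: sets_disk_area)
  interpret I: finite_measure unit_interval by (rule finite_measure_unit_interval)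
  interpret D: finite_measure disk_area by (rule finite_measure_disk_area)
  interpret pair_sigma_finite unit_interval disk_area ..
  note measurable_rotate_disk[measurable]
  have m: "(\<lambda>(\<theta>, w). F (cis (2 * pi * \<theta>) * w)) \<in> borel_measurable (unit_interval \<Otimes>\<^sub>M disk_area)"
    using measurable_compose[OF measurable_rotate_disk F'] by (simp add: case_prod_beta')
  have inv: "(\<integral>\<^sup>+w. F (cis t * w) \<partial>disk_area) = (\<integral>\<^sup>+w. F w \<partial>disk_area)" for t
    by (subst (2) distr_disk_area_rotate[of "cis t", symmetric], simp,
        subst nn_integral_distr[OF measurable_rotate_disk']) simp_all
  have "(\<integral>\<^sup>+w. (\<integral>\<^sup>+\<theta>. F (cis (2 * pi * \<theta>) * w) \<partial>unit_interval) \<partial>disk_area)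
    = (\<integral>\<^sup>+\<theta>. (\<integral>\<^sup>+w. F (cis (2 * pi * \<theta>) * w) \<partial>disk_area) \<partial>unit_interval)"
    using Fubini'[OF m] by simp
  also have "\<dots> = nn_integral unit_interval (\<lambda>\<theta>. \<integral>\<^sup>+w. F w \<partial>disk_area)"
    by (simp only: inv)
  also have "nn_integral unit_interval (\<lambda>\<theta>. \<integral>\<^sup>+w. F w \<partial>disk_area) = (\<integral>\<^sup>+w. F w \<partial>disk_area)"
    by (simp add: emeasure_unit_interval_space)
  finally show ?thesis by simp
qed

lemma integral_disk_area_average:
  fixes F :: "complex \<Rightarrow> complex"
  assumes F: "integrable disk_area F"
  shows "(\<integral>w. F w \<partial>disk_area) =
    (\<integral>w. (\<integral>\<theta>. F (cis (2 * pi * \<theta>) * w) \<partial>unit_interval) \<partial>disk_area)"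
proof -
  interpret I: finite_measure unit_interval by (rule finite_measure_unit_interval)
  interpret D: finite_measure disk_area by (rule finite_measure_disk_area)
  interpret pair_sigma_finite unit_interval disk_area ..
  have F' [measurable]: "F \<in> borel_measurable disk_area" using F by auto
  have F'' [measurable]: "F \<in> borel_measurable disk_borel"
    using F' by (simp cong: measurable_cong_sets add: sets_disk_area)
  have m: "(\<lambda>(\<theta>, w). F (cis (2 * pi * \<theta>) * w)) \<in> borel_measurable (unit_interval \<Otimes>\<^sub>M disk_area)"
    using measurable_compose[OF measurable_rotate_disk F'] by (simp add: case_prod_beta')
  have inv: "(\<integral>w. F (cis t * w) \<partial>disk_area) = (\<integral>w. F w \<partial>disk_area)" for t
    by (subst (2) distr_disk_area_rotate[of "cis t", symmetric], simp,
        subst integral_distr[OF measurable_rotate_disk']) simp_all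
  have nninv: "(\<integral>\<^sup>+w. ennreal (cmod (F (cis t * w))) \<partial>disk_area) = (\<integral>\<^sup>+w. ennreal (cmod (F w)) \<partial>disk_area)" for t
    by (subst (2) distr_disk_area_rotate[of "cis t", symmetric], simp,
        subst nn_integral_distr[OF measurable_rotate_disk']) simp_all
  have "integrable (unit_interval \<Otimes>\<^sub>M disk_area) (\<lambda>(\<theta>, w). F (cis (2 * pi * \<theta>) * w))"
  proof (rule integrableI_bounded[OF m])
    have "(\<integral>\<^sup>+x. ennreal (cmod (case x of (\<theta>, w) \<Rightarrow> F (cis (2 * pi * \<theta>) * w))) \<partial>(unit_interval \<Otimes>\<^sub>M disk_area))
      = (\<integral>\<^sup>+\<theta>. (\<integral>\<^sup>+w. ennreal (cmod (F (cis (2 * pi * \<theta>) * w))) \<partial>disk_area) \<partial>unit_interval)"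
      using m by (subst D.nn_integral_fst[symmetric]) (auto simp: case_prod_beta')
    also have "\<dots> = (\<integral>\<^sup>+w. ennreal (cmod (F w)) \<partial>disk_area)"
      unfolding nninv by (simp add: emeasure_unit_interval_space)
    also have "\<dots> < \<infinity>" using F by (simp add: integrable_iff_bounded)
    finally show "(\<integral>\<^sup>+x. ennreal (cmod (case x of (\<theta>, w) \<Rightarrow> F (cis (2 * pi * \<theta>) * w))) \<partial>(unit_interval \<Otimes>\<^sub>M disk_area)) < \<infinity>" .
  qed
  from Fubini_integral[OF this]
  have "(\<integral>w. (\<integral>\<theta>. F (cis (2 * pi * \<theta>) * w) \<partial>unit_interval) \<partial>disk_area)
    = (\<integral>\<theta>. (\<integral>w. F (cis (2 * pi * \<theta>) * w) \<partial>disk_area) \<partial>unit_interval)" by simp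
  then show ?thesis unfolding inv by (simp add: measure_def emeasure_unit_interval_space)
qed

lemma measurable_norm_square_disk: "(\<lambda>w. (cmod w)\<^sup>2) \<in> borel_measurable disk_area"
proof -
  have "(\<lambda>w. (cmod w)\<^sup>2) \<in> borel_measurable disk_borel"
    by (rule measurable_restrict_space1) measurable
  then show ?thesis by (simp cong: measurable_cong_sets add: sets_disk_area)
qed

text \<open>A disk of radius s has normalized area s^2, so |w|^2 is uniformly distributed. This is
  why t = |w|^2, and not |w|, is the radial variable throughout.\<close>

lemma distr_disk_area_norm_square:
  "distr disk_area borel (\<lambda>w. (cmod w)\<^sup>2) = distr unit_interval borel (\<lambda>t. t)"
proof (rule measure_eqI_lessThan)
  interpret I: finite_measure unit_interval by (rule finite_measure_unit_interval)
  interpret D: finite_measure disk_area by (rule finite_measure_disk_area)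
  note measurable_norm_square_disk[measurable]
  have [measurable]: "(\<lambda>t. t) \<in> borel_measurable unit_interval"
    by (rule measurable_restrict_space1) auto
  show "sets (distr disk_area borel (\<lambda>w. (cmod w)\<^sup>2)) = sets borel"
    "sets (distr unit_interval borel (\<lambda>t. t)) = sets borel" by auto
  fix x :: real
  show "emeasure (distr disk_area borel (\<lambda>w. (cmod w)\<^sup>2)) {x<..} < \<infinity>"
    by (subst emeasure_distr) (auto simp: less_top[symmetric])
  define y where "y = (if x < 0 then 1 else if x \<ge> 1 then 0 else 1 - x)"
  have R: "emeasure (distr unit_interval borel (\<lambda>t. t)) {x<..} = ennreal y"
  proof -
    have "(\<lambda>t. t) -` {x<..} \<inter> space unit_interval = (if x < 0 then {0..1} else {x<..1})"
      by auto
    then have "emeasure (distr unit_interval borel (\<lambda>t. t)) {x<..} =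
        emeasure unit_interval (if x < 0 then {0..1} else {x<..1})"
      by (subst emeasure_distr) simp_all
    also have "\<dots> = emeasure lborel (if x < 0 then {0..1} else {x<..1})"
      by (rule emeasure_restrict_space) auto
    also have "\<dots> = ennreal y" by (simp add: y_def)
    finally show ?thesis .
  qed
  have L: "emeasure (distr disk_area borel (\<lambda>w. (cmod w)\<^sup>2)) {x<..} = ennreal y"
  proof -
    define s where "s = (if x < 0 then 0 else if x \<ge> 1 then 1 else sqrt x)"
    \<comment> \<open>\<open>E\<close> is the complement of the event within the disk. For x >= 1 it
      has to be the open ball, since \<open>cball 0 1\<close> leaves the disk.\<close>
    define E where "E = (if x < 0 then {} else if x \<ge> 1 then ball 0 1 else cball (0::complex) s)"
    have E: "E \<in> sets disk_borel"
      unfolding E_def s_def by (intro sets_disk_borelI) (auto simp: subset_eq intro: le_less_trans[of _ "sqrt x"])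
    have s: "0 \<le> s" "s \<le> 1" by (auto simp: s_def)
    have "emeasure lborel E = ennreal (pi * (1 - y))"
      unfolding E_def y_def using s
      by (auto simp: emeasure_lborel_ball_complex emeasure_cball unit_ball_vol_2 s_def)
    then have "emeasure disk_area E = ennreal (1 / pi) * ennreal (pi * (1 - y))"
      using E by (simp add: emeasure_disk_area)
    also have "\<dots> = ennreal (1 - y)"
      by (subst ennreal_mult'[symmetric]) auto
    finally have "measure disk_area E = 1 - y" by (simp add: measure_def y_def)
    moreover have eq: "(\<lambda>w. (cmod w)\<^sup>2) -` {x<..} \<inter> space disk_area = space disk_area - E"
    proof -
      have "x < (cmod w)\<^sup>2 \<longleftrightarrow> w \<notin> E" if "cmod w < 1" for w
      proof -
        have "(cmod w)\<^sup>2 < 1" using that by (simp add: abs_square_less_1)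
        moreover have "0 \<le> x \<Longrightarrow> sqrt x < cmod w \<longleftrightarrow> x < (cmod w)\<^sup>2"
          using real_sqrt_less_iff[of x "(cmod w)\<^sup>2"] by simp
        moreover have "x < 0 \<Longrightarrow> x < (cmod w)\<^sup>2" by (meson less_le_trans zero_le_power2)
        ultimately show ?thesis using that unfolding E_def s_def by auto
      qed
      then show ?thesis by auto
    qed
    ultimately have "measure disk_area ((\<lambda>w. (cmod w)\<^sup>2) -` {x<..} \<inter> space disk_area) = y"
      using E D.finite_measure_compl[of E] by (simp add: sets_disk_area measure_def emeasure_disk_area_space)
    then show ?thesis
      by (subst emeasure_distr) (auto simp: D.emeasure_eq_measure)
  qed
  show "emeasure (distr disk_area borel (\<lambda>w. (cmod w)\<^sup>2)) {x<..} =
         emeasure (distr unit_interval borel (\<lambda>t. t)) {x<..}"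
    unfolding L R ..
qed

lemma nn_integral_disk_area_radial:
  fixes F :: "real \<Rightarrow> ennreal"
  assumes F: "F \<in> borel_measurable borel"
  shows "(\<integral>\<^sup>+w. F ((cmod w)\<^sup>2) \<partial>disk_area) = (\<integral>\<^sup>+t. F t \<partial>unit_interval)"
proof -
  have "(\<lambda>t. t) \<in> borel_measurable unit_interval" by (rule measurable_restrict_space1) auto
  then show ?thesis
    using arg_cong[OF distr_disk_area_norm_square, of "\<lambda>M. nn_integral M F"] F
      measurable_norm_square_disk by (simp add: nn_integral_distr)
qed

lemma integral_disk_area_radial:
  fixes F :: "real \<Rightarrow> complex"
  assumes F: "F \<in> borel_measurable borel"
  shows "(\<integral>w. F ((cmod w)\<^sup>2) \<partial>disk_area) = (\<integral>t. F t \<partial>unit_interval)"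
proof -
  have "(\<lambda>t. t) \<in> borel_measurable unit_interval" by (rule measurable_restrict_space1) auto
  then show ?thesis
    using arg_cong[OF distr_disk_area_norm_square, of "\<lambda>M. integral\<^sup>L M F"] F
      measurable_norm_square_disk by (simp add: integral_distr)
qed

section \<open>The invariant measure and Euclidean neighbourhoods\<close>

lemma space_mobius_measure [simp]: "space mobius_measure = unit_disk"
  by (simp add: mobius_measure_def)

lemma sets_mobius_measure [measurable_cong]: "sets mobius_measure = sets disk_borel"
  by (simp add: mobius_measure_def sets_disk_area)

lemma measurable_mobius_eq:
  "measurable mobius_measure N = measurable disk_borel N"
  "measurable disk_area N = measurable disk_borel N"
  by (auto cong: measurable_cong_sets simp: sets_mobius_measure sets_disk_area)

lemma measurable_ident_disk [measurable]: "(\<lambda>x. x) \<in> borel_measurable disk_borel"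
  by (rule measurable_restrict_space1) auto

lemma one_minus_norm_square_pos: "z \<in> unit_disk \<Longrightarrow> 0 < 1 - (cmod z)\<^sup>2"
  by (simp add: abs_square_less_1)

lemma one_minus_norm_square_bounds:
  assumes "z \<in> unit_disk"
  shows "1 - cmod z \<le> 1 - (cmod z)\<^sup>2" "1 - (cmod z)\<^sup>2 \<le> 2 * (1 - cmod z)"
proof -
  have "(cmod z)\<^sup>2 \<le> cmod z"
    using assms by (simp add: power2_eq_square mult_left_le)
  then show "1 - cmod z \<le> 1 - (cmod z)\<^sup>2" by simp
  have "0 \<le> (1 - cmod z)\<^sup>2" by simp
  then show "1 - (cmod z)\<^sup>2 \<le> 2 * (1 - cmod z)" by (simp add: power2_eq_square algebra_simps)
qed

lemma measurable_mobius_density [measurable]: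
  "(\<lambda>z. ennreal (1 / (1 - (cmod z)\<^sup>2)\<^sup>2)) \<in> borel_measurable disk_borel"
  by (rule measurable_restrict_space1) measurable

lemma nn_integral_mobius:
  fixes F :: "complex \<Rightarrow> ennreal"
  assumes "F \<in> borel_measurable disk_borel"
  shows "(\<integral>\<^sup>+z. F z \<partial>mobius_measure) = (\<integral>\<^sup>+z. ennreal (1 / (1 - (cmod z)\<^sup>2)\<^sup>2) * F z \<partial>disk_area)"
  unfolding mobius_measure_def using assms
  by (intro nn_integral_density) (simp_all add: measurable_mobius_eq)

lemma sigma_finite_mobius: "sigma_finite_measure mobius_measure"
proof -
  interpret finite_measure disk_area by (rule finite_measure_disk_area)
  show ?thesis unfolding mobius_measure_def
    by (subst sigma_finite_iff_density_finite) (auto simp: measurable_mobius_eq)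
qed

text \<open>A symmetric Euclidean substitute for the hyperbolic disks.\<close>

definition nbhd :: "real \<Rightarrow> complex \<Rightarrow> complex set" where
  "nbhd C u = {v \<in> unit_disk. dist u v < C * (1 - cmod u) \<and> dist u v < C * (1 - cmod v)}"

lemma nbhd_sym: "u \<in> unit_disk \<Longrightarrow> v \<in> unit_disk \<Longrightarrow> v \<in> nbhd C u \<longleftrightarrow> u \<in> nbhd C v"
  by (auto simp: nbhd_def dist_commute)

lemma norm_diff_le_dist: "cmod v \<le> cmod u + dist u v" "cmod u \<le> cmod v + dist u v"
  using norm_triangle_ineq2[of v u] norm_triangle_ineq2[of u v]
  by (auto simp: dist_norm norm_minus_commute)

lemma nbhd_comparable:
  assumes "v \<in> nbhd C u"
  shows "1 - cmod v \<le> (1 + C) * (1 - cmod u)" "1 - cmod u \<le> (1 + C) * (1 - cmod v)"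
  using assms norm_diff_le_dist[of v u] norm_diff_le_dist[of u v]
  by (auto simp: nbhd_def algebra_simps)

text \<open>Measuring the second step at \<open>u\<close> instead of \<open>v\<close> costs the
  factor 1 + C, and at \<open>w\<close> the first step costs 1 + D. Either way the constants combine
  to (1 + C)(1 + D) - 1.\<close>

lemma nbhd_trans:
  assumes v: "v \<in> nbhd C u" and w: "w \<in> nbhd D v" and C: "0 \<le> C" and D: "0 \<le> D" "C \<le> E" "D \<le> E"
    and E: "C + D + C * D \<le> E"
  shows "w \<in> nbhd E u"
proof -
  have d: "dist u w \<le> dist u v + dist v w" by (rule dist_triangle)
  have 1: "dist u v < C * (1 - cmod u)" "dist u v < C * (1 - cmod v)"
    "dist v w < D * (1 - cmod v)" "dist v w < D * (1 - cmod w)" "cmod u < 1 \<or> cmod u \<ge> 1"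
    using v w by (auto simp: nbhd_def)
  have u: "1 - cmod v \<le> (1 + C) * (1 - cmod u)" by (rule nbhd_comparable[OF v])
  have w': "1 - cmod v \<le> (1 + D) * (1 - cmod w)" by (rule nbhd_comparable[OF w])
  have pos: "0 < 1 - cmod w" "0 < 1 - cmod v" using v w by (auto simp: nbhd_def)
  \<comment> \<open>Nothing places \<open>u\<close> in the disk; the strict bound on
    \<open>dist u v\<close> rules out |u| > 1.\<close>
  have pu: "0 \<le> 1 - cmod u"
  proof (rule ccontr)
    assume "\<not> 0 \<le> 1 - cmod u"
    then have "C * (1 - cmod u) \<le> 0" using C by (simp add: mult_nonneg_nonpos)
    then show False using 1(1) zero_le_dist[of u v] by linarith
  qed
  have "D * (1 - cmod v) \<le> D * ((1 + C) * (1 - cmod u))" using u D by (intro mult_left_mono) auto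
  then have "dist u w < (C + D + C * D) * (1 - cmod u)" using d 1 by (auto simp: algebra_simps)
  moreover have "C * (1 - cmod v) \<le> C * ((1 + D) * (1 - cmod w))" using w' C by (intro mult_left_mono) auto
  then have "dist u w < (C + D + C * D) * (1 - cmod w)" using d 1 by (auto simp: algebra_simps)
  moreover have "(C + D + C * D) * (1 - cmod w) \<le> E * (1 - cmod w)"
    using E pos by (intro mult_right_mono) auto
  moreover have "(C + D + C * D) * (1 - cmod u) \<le> E * (1 - cmod u)"
    using E pu by (intro mult_right_mono) auto
  ultimately have "dist u w < E * (1 - cmod u)" "dist u w < E * (1 - cmod w)" by linarith+
  then show ?thesis using w by (simp add: nbhd_def)
qed

lemma measurable_nbhd_pair:
  "{x \<in> space (disk_borel \<Otimes>\<^sub>M disk_borel). snd x \<in> nbhd C (fst x)} \<in> sets (disk_borel \<Otimes>\<^sub>M disk_borel)"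
proof -
  have [measurable]: "snd \<in> borel_measurable (disk_borel \<Otimes>\<^sub>M disk_borel)"
      "fst \<in> borel_measurable (disk_borel \<Otimes>\<^sub>M disk_borel)"
    by (rule measurable_compose[OF measurable_snd measurable_ident_disk]
         measurable_compose[OF measurable_fst measurable_ident_disk])+
  have eq: "{x \<in> space (disk_borel \<Otimes>\<^sub>M disk_borel). snd x \<in> nbhd C (fst x)} =
     {x \<in> space (disk_borel \<Otimes>\<^sub>M disk_borel). dist (fst x) (snd x) < C * (1 - cmod (fst x))
        \<and> dist (fst x) (snd x) < C * (1 - cmod (snd x))}"
    by (auto simp: nbhd_def space_pair_measure)
  show ?thesis unfolding eq dist_norm by measurable
qed

lemma measurable_indicator_nbhd_pair [measurable]:
  "(\<lambda>x. indicator (nbhd C (fst x)) (snd x) :: ennreal) \<in> borel_measurable (disk_borel \<Otimes>\<^sub>M disk_borel)"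
proof -
  have "(\<lambda>x. indicator {x \<in> space (disk_borel \<Otimes>\<^sub>M disk_borel). snd x \<in> nbhd C (fst x)} x :: ennreal)
      \<in> borel_measurable (disk_borel \<Otimes>\<^sub>M disk_borel)"
    using measurable_nbhd_pair by (rule borel_measurable_indicator)
  then show ?thesis
    by (rule measurable_cong[THEN iffD1, rotated]) (auto simp: indicator_def)
qed

lemma sets_nbhd [measurable]: "nbhd C u \<in> sets disk_borel"
proof (rule sets_disk_borelI)
  have "nbhd C u = ball u (C * (1 - cmod u)) \<inter> {v. dist u v < C * (1 - cmod v)} \<inter> unit_disk"
    by (auto simp: nbhd_def)
  moreover have "open {v. dist u v < C * (1 - cmod v)}"
    by (intro open_Collect_less continuous_intros)
  ultimately show "nbhd C u \<in> sets borel" by auto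
qed (auto simp: nbhd_def)

text \<open>With d = 1 - |u|, the set \<open>nbhd C u\<close> lies in a ball of normalized area (C
  d)^2, and the density of \<lambda> on it is at most ((1 + C) / d)^2; this gives the upper
  constant. The lower one comes from an inscribed ball of radius c d, c = C / (1 + C), where the
  density is at least 1 / (2 (1 + c) d)^2: note c / (2 (1 + c)) = C / (2 (1 + 2 C)).\<close>

definition nbhd_upper :: "real \<Rightarrow> real" where "nbhd_upper C = C\<^sup>2 * (1 + C)\<^sup>2"
definition nbhd_lower :: "real \<Rightarrow> real" where "nbhd_lower C = C\<^sup>2 / (4 * (1 + 2 * C)\<^sup>2)"

lemma nbhd_lower_pos: "0 < C \<Longrightarrow> 0 < nbhd_lower C" by (simp add: nbhd_lower_def)

text \<open>The factor c = C / (1 + C) solves \<open>C * (1 - c) = c\<close>. In the ball, 1 - |v|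
  still exceeds (1 - c)(1 - |u|), so the condition of \<open>nbhd\<close> at \<open>v\<close> holds
  along with the one at \<open>u\<close>.\<close>

lemma ball_subset_nbhd:
  assumes u: "u \<in> unit_disk" and C: "0 < C"
  shows "ball u (C / (1 + C) * (1 - cmod u)) \<subseteq> nbhd C u"
proof
  define c where "c = C / (1 + C)"
  have c: "0 < c" "c < 1" "c \<le> C" "C * (1 - c) = c" using C by (auto simp: c_def field_simps)
  have d: "0 < 1 - cmod u" using u by simp
  fix v assume "v \<in> ball u (C / (1 + C) * (1 - cmod u))"
  then have v: "dist u v < c * (1 - cmod u)" by (simp add: c_def)
  have "cmod v \<le> cmod u + dist u v" by (rule norm_diff_le_dist)
  then have v1: "(1 - c) * (1 - cmod u) < 1 - cmod v" using v by (simp add: algebra_simps)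
  moreover have "0 < (1 - c) * (1 - cmod u)" using c d by simp
  ultimately have "cmod v < 1" by linarith
  moreover have "c * (1 - cmod u) \<le> C * (1 - cmod u)" using c d by (intro mult_right_mono) auto
  moreover have "C * ((1 - c) * (1 - cmod u)) < C * (1 - cmod v)"
    using v1 C by (rule mult_strict_left_mono)
  then have "c * (1 - cmod u) < C * (1 - cmod v)" using c(4) by (metis mult.assoc)
  ultimately show "v \<in> nbhd C u" using v by (auto simp: nbhd_def)
qed

lemma emeasure_mobius:
  assumes "E \<in> sets disk_borel"
  shows "emeasure mobius_measure E =
    ennreal (1 / pi) * (\<integral>\<^sup>+z. ennreal (1 / (1 - (cmod z)\<^sup>2)\<^sup>2) * indicator E z \<partial>lborel)"
proof -
  have E: "E \<subseteq> unit_disk" using assms by (auto simp: sets_restrict_space)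
  have "emeasure mobius_measure E = (\<integral>\<^sup>+z. indicator E z \<partial>mobius_measure)"
    using assms by (subst nn_integral_indicator) (auto simp: sets_mobius_measure)
  also have "\<dots> = (\<integral>\<^sup>+z. ennreal (1 / (1 - (cmod z)\<^sup>2)\<^sup>2) * indicator E z \<partial>disk_area)"
    using assms by (intro nn_integral_mobius) simp
  also have "\<dots> = ennreal (1 / pi) *
     (\<integral>\<^sup>+z. ennreal (1 / (1 - (cmod z)\<^sup>2)\<^sup>2) * indicator E z * indicator unit_disk z \<partial>lborel)"
    using assms by (intro nn_integral_disk_area borel_measurable_times measurable_mobius_density) simp
  also have "(\<lambda>z. ennreal (1 / (1 - (cmod z)\<^sup>2)\<^sup>2) * indicator E z * indicator unit_disk z) =
      (\<lambda>z. ennreal (1 / (1 - (cmod z)\<^sup>2)\<^sup>2) * indicator E z)"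
    using E by (auto simp: indicator_def subset_eq)
  finally show ?thesis .
qed

lemma emeasure_mobius_nbhd_le:
  assumes u: "u \<in> unit_disk" and C: "0 < C"
  shows "emeasure mobius_measure (nbhd C u) \<le> ennreal (nbhd_upper C)"
proof -
  define d where "d = 1 - cmod u"
  have d: "0 < d" using u by (simp add: d_def)
  have "emeasure mobius_measure (nbhd C u) \<le>
      ennreal (1 / pi) * (\<integral>\<^sup>+z. ennreal ((1 + C)\<^sup>2 / d\<^sup>2) * indicator (ball u (C * d)) z \<partial>lborel)"
    unfolding emeasure_mobius[OF sets_nbhd]
  proof (intro mult_left_mono nn_integral_mono)
    fix z
    show "ennreal (1 / (1 - (cmod z)\<^sup>2)\<^sup>2) * indicator (nbhd C u) z
      \<le> ennreal ((1 + C)\<^sup>2 / d\<^sup>2) * indicator (ball u (C * d)) z"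
    proof (cases "z \<in> nbhd C u")
      case True
      then have z: "z \<in> unit_disk" "z \<in> ball u (C * d)" by (auto simp: nbhd_def d_def)
      have "d \<le> (1 + C) * (1 - (cmod z)\<^sup>2)"
      proof -
        have "(1 + C) * (1 - cmod z) \<le> (1 + C) * (1 - (cmod z)\<^sup>2)"
          using one_minus_norm_square_bounds(1)[OF z(1)] C by (intro mult_left_mono) auto
        then show ?thesis using nbhd_comparable(2)[OF True] by (simp add: d_def)
      qed
      then have "d\<^sup>2 \<le> ((1 + C) * (1 - (cmod z)\<^sup>2))\<^sup>2" using d by (intro power_mono) auto
      then have "1 / (1 - (cmod z)\<^sup>2)\<^sup>2 \<le> (1 + C)\<^sup>2 / d\<^sup>2"
        using d one_minus_norm_square_pos[OF z(1)]
        unfolding power_mult_distrib by (simp add: divide_simps)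
      then show ?thesis using z True by (simp add: ennreal_leI)
    qed simp
  qed simp
  also have "\<dots> = ennreal (1 / pi) * (ennreal ((1 + C)\<^sup>2 / d\<^sup>2) * ennreal (pi * (C * d)\<^sup>2))"
    using C d by (subst nn_integral_cmult_indicator) (auto simp: emeasure_lborel_ball_complex)
  also have "\<dots> = ennreal (1 / pi * ((1 + C)\<^sup>2 / d\<^sup>2 * (pi * (C * d)\<^sup>2)))"
    by (subst ennreal_mult, simp, simp, subst (2) ennreal_mult, simp, simp, rule refl)
  also have "1 / pi * ((1 + C)\<^sup>2 / d\<^sup>2 * (pi * (C * d)\<^sup>2)) = nbhd_upper C"
    using d by (simp add: nbhd_upper_def power_mult_distrib)
  finally show ?thesis .
qed

lemma emeasure_mobius_nbhd_ge:
  assumes u: "u \<in> unit_disk" and C: "0 < C"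
  shows "ennreal (nbhd_lower C) \<le> emeasure mobius_measure (nbhd C u)"
proof -
  define c where "c = C / (1 + C)"
  define d where "d = 1 - cmod u"
  have d: "0 < d" using u by (simp add: d_def)
  have c: "0 < c" "c < 1" using C by (auto simp: c_def field_simps)
  have sub: "ball u (c * d) \<subseteq> nbhd C u" unfolding c_def d_def by (rule ball_subset_nbhd[OF u C])
  have cC: "c / (2 * (1 + c)) = C / (2 * (1 + 2 * C))"
  proof -
    have "1 + c = (1 + 2 * C) / (1 + C)" using C by (simp add: c_def field_simps)
    then show ?thesis using C by (simp add: c_def)
  qed
  have "nbhd_lower C = (C / (2 * (1 + 2 * C)))\<^sup>2"
    unfolding power_divide power_mult_distrib by (simp add: nbhd_lower_def)
  also have "\<dots> = (c / (2 * (1 + c)))\<^sup>2" by (simp only: cC)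
  also have "\<dots> = 1 / pi * (1 / (4 * (1 + c)\<^sup>2 * d\<^sup>2) * (pi * (c * d)\<^sup>2))"
    using d c unfolding power_divide power_mult_distrib by simp
  finally have "ennreal (nbhd_lower C) = ennreal (1 / pi) * (ennreal (1 / (4 * (1 + c)\<^sup>2 * d\<^sup>2)) * ennreal (pi * (c * d)\<^sup>2))"
    by (subst ennreal_mult[symmetric], simp, simp, subst ennreal_mult[symmetric], simp, simp, simp)
  also have "\<dots> = ennreal (1 / pi) * (\<integral>\<^sup>+z. ennreal (1 / (4 * (1 + c)\<^sup>2 * d\<^sup>2)) * indicator (ball u (c * d)) z \<partial>lborel)"
    using c d by (subst nn_integral_cmult_indicator) (auto simp: emeasure_lborel_ball_complex)
  also have "\<dots> \<le> emeasure mobius_measure (nbhd C u)"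
    unfolding emeasure_mobius[OF sets_nbhd]
  proof (intro mult_left_mono nn_integral_mono)
    fix z
    show "ennreal (1 / (4 * (1 + c)\<^sup>2 * d\<^sup>2)) * indicator (ball u (c * d)) z \<le>
       ennreal (1 / (1 - (cmod z)\<^sup>2)\<^sup>2) * indicator (nbhd C u) z"
    proof (cases "z \<in> ball u (c * d)")
      case True
      then have zn: "z \<in> nbhd C u" using sub by auto
      then have z: "z \<in> unit_disk" by (auto simp: nbhd_def)
      have zd: "1 - cmod z \<le> (1 + c) * d"
        using True norm_diff_le_dist(2)[of u z] by (simp add: d_def algebra_simps)
      have "1 - (cmod z)\<^sup>2 \<le> 2 * ((1 + c) * d)"
        by (rule order_trans[OF one_minus_norm_square_bounds(2)[OF z] mult_left_mono[OF zd]]) simp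
      then have "(1 - (cmod z)\<^sup>2)\<^sup>2 \<le> (2 * ((1 + c) * d))\<^sup>2"
        using one_minus_norm_square_pos[OF z] by (intro power_mono) auto
      also have "\<dots> = 4 * (1 + c)\<^sup>2 * d\<^sup>2" by (simp add: power_mult_distrib)
      finally have "1 / (4 * (1 + c)\<^sup>2 * d\<^sup>2) \<le> 1 / (1 - (cmod z)\<^sup>2)\<^sup>2"
        using d c one_minus_norm_square_pos[OF z] by (intro divide_left_mono) auto
      then show ?thesis using True zn by (simp add: ennreal_leI)
    qed simp
  qed simp
  finally show ?thesis .
qed

text \<open>Local averaging is bounded on L^1(\<lambda>): Fubini and the symmetry of the
  neighbourhoods reduce it to their uniformly bounded measure.\<close>

lemma nn_integral_nbhd_swap_le:
  fixes \<theta> :: "complex \<Rightarrow> ennreal"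
  assumes [measurable]: "\<theta> \<in> borel_measurable disk_borel" and C: "0 < C"
  shows "(\<integral>\<^sup>+u. (\<integral>\<^sup>+v. \<theta> v * indicator (nbhd C u) v \<partial>mobius_measure) \<partial>mobius_measure)
    \<le> ennreal (nbhd_upper C) * (\<integral>\<^sup>+v. \<theta> v \<partial>mobius_measure)"
proof -
  interpret sigma_finite_measure mobius_measure by (rule sigma_finite_mobius)
  interpret pair_sigma_finite mobius_measure mobius_measure ..
  have [measurable]: "(\<lambda>(u, v). \<theta> v * indicator (nbhd C u) v) \<in> borel_measurable (mobius_measure \<Otimes>\<^sub>M mobius_measure)"
    unfolding case_prod_beta' by measurable
  have "(\<integral>\<^sup>+u. (\<integral>\<^sup>+v. \<theta> v * indicator (nbhd C u) v \<partial>mobius_measure) \<partial>mobius_measure)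
     = (\<integral>\<^sup>+v. (\<integral>\<^sup>+u. \<theta> v * indicator (nbhd C u) v \<partial>mobius_measure) \<partial>mobius_measure)"
    by (rule Fubini') measurable
  also have "\<dots> = (\<integral>\<^sup>+v. (\<integral>\<^sup>+u. \<theta> v * indicator (nbhd C v) u \<partial>mobius_measure) \<partial>mobius_measure)"
    by (intro nn_integral_cong) (auto simp: indicator_def nbhd_sym)
  also have "\<dots> = (\<integral>\<^sup>+v. \<theta> v * emeasure mobius_measure (nbhd C v) \<partial>mobius_measure)"
    by (intro nn_integral_cong nn_integral_cmult_indicator) (auto simp: sets_mobius_measure)
  also have "\<dots> \<le> (\<integral>\<^sup>+v. \<theta> v * ennreal (nbhd_upper C) \<partial>mobius_measure)"
    by (intro nn_integral_mono mult_left_mono emeasure_mobius_nbhd_le C) auto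
  also have "\<dots> = ennreal (nbhd_upper C) * (\<integral>\<^sup>+v. \<theta> v \<partial>mobius_measure)"
    by (subst nn_integral_multc) (auto simp: mult.commute measurable_mobius_eq)
  finally show ?thesis .
qed

text \<open>For \<open>p \<le> 1\<close>, a function whose \<open>p\<close>-th power is controlled by local averages of \<open>\<theta>\<close> can be
  integrated by writing \<open>\<Phi> = \<Phi>\<^sup>p (\<Phi>\<^sup>p)\<^bsup>1/p - 1\<^esup>\<close>, where the second factor is at most
  the corresponding power of the total integral of \<open>\<theta>\<close>.\<close>

lemma nn_integral_le_powr_of_local:
  fixes \<theta> :: "complex \<Rightarrow> ennreal" and \<Phi> :: "complex \<Rightarrow> real"
  assumes th [measurable]: "\<theta> \<in> borel_measurable disk_borel" and C: "0 < C" and p: "0 < p" "p \<le> 1"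
    and c: "0 \<le> c" and t: "0 \<le> t" and T: "(\<integral>\<^sup>+v. \<theta> v \<partial>mobius_measure) \<le> ennreal t"
    and pos: "\<And>u. u \<in> unit_disk \<Longrightarrow> 0 \<le> \<Phi> u"
    and loc: "\<And>u. u \<in> unit_disk \<Longrightarrow> ennreal (\<Phi> u powr p) \<le>
       ennreal c * (\<integral>\<^sup>+v. \<theta> v * indicator (nbhd C u) v \<partial>mobius_measure)"
  shows "(\<integral>\<^sup>+u. ennreal (\<Phi> u) \<partial>mobius_measure) \<le> ennreal (nbhd_upper C * (c * t) powr (1 / p))"
proof -
  interpret sigma_finite_measure mobius_measure by (rule sigma_finite_mobius)
  have m: "(\<lambda>u. \<integral>\<^sup>+v. \<theta> v * indicator (nbhd C u) v \<partial>mobius_measure) \<in> borel_measurable mobius_measure"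
    by (rule borel_measurable_nn_integral) (unfold case_prod_beta', measurable)
  define \<tau> where "\<tau> u = (\<integral>\<^sup>+v. \<theta> v * indicator (nbhd C u) v \<partial>mobius_measure)" for u
  have \<tau>le: "\<tau> u \<le> ennreal t" for u
    unfolding \<tau>_def by (rule order_trans[OF nn_integral_mono T]) (auto simp: indicator_def)
  have bd: "ennreal (\<Phi> u) \<le> ennreal (c * (c * t) powr (1 / p - 1)) * \<tau> u" if u: "u \<in> unit_disk" for u
  proof (cases "\<Phi> u = 0")
    case False
    then have P: "0 < \<Phi> u" using pos[OF u] by simp
    obtain s where s: "\<tau> u = ennreal s" "0 \<le> s" "s \<le> t"
      using \<tau>le[of u] t by (cases "\<tau> u") (auto simp: top_unique ennreal_le_iff2)
    have 1: "\<Phi> u powr p \<le> c * s"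
      using loc[OF u] s c by (simp add: \<tau>_def[symmetric] ennreal_mult[symmetric])
    have 2: "c * s \<le> c * t" using s c by (simp add: mult_left_mono)
    have e: "0 \<le> 1 / p - 1" using p by (simp add: field_simps)
    have "\<Phi> u = (\<Phi> u powr p) powr (1 / p)" using P p by (simp add: powr_powr)
    also have "\<dots> = (\<Phi> u powr p) * (\<Phi> u powr p) powr (1 / p - 1)"
    proof -
      have "(\<Phi> u powr p) * (\<Phi> u powr p) powr (1 / p - 1) = (\<Phi> u powr p) powr (1 + (1 / p - 1))"
        using P by (subst powr_add) auto
      then show ?thesis by simp
    qed
    also have "\<dots> \<le> (c * s) * (c * t) powr (1 / p - 1)"
      using 1 2 P e c s by (intro mult_mono powr_mono2) auto
    finally have "ennreal (\<Phi> u) \<le> ennreal ((c * (c * t) powr (1 / p - 1)) * s)"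
      by (intro ennreal_leI) (simp add: mult_ac)
    then show ?thesis using s c by (simp add: ennreal_mult)
  qed simp
  have "(\<integral>\<^sup>+u. ennreal (\<Phi> u) \<partial>mobius_measure)
      \<le> (\<integral>\<^sup>+u. ennreal (c * (c * t) powr (1 / p - 1)) * \<tau> u \<partial>mobius_measure)"
    by (intro nn_integral_mono) (simp add: bd)
  also have "\<dots> = ennreal (c * (c * t) powr (1 / p - 1)) * (\<integral>\<^sup>+u. \<tau> u \<partial>mobius_measure)"
    unfolding \<tau>_def by (rule nn_integral_cmult) (rule m)
  also have "\<dots> \<le> ennreal (c * (c * t) powr (1 / p - 1)) * (ennreal (nbhd_upper C) * ennreal t)"
    unfolding \<tau>_def
    by (intro mult_left_mono order_trans[OF nn_integral_nbhd_swap_le[OF th C]] T) auto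
  also have "\<dots> = ennreal (nbhd_upper C * ((c * t) * (c * t) powr (1 / p - 1)))"
    using c t by (simp add: ennreal_mult[symmetric] nbhd_upper_def mult_ac)
  also have "(c * t) * (c * t) powr (1 / p - 1) = (c * t) powr (1 / p)"
  proof (cases "c * t = 0")
    case False
    then have "0 < c * t" using c t by (simp add: less_le)
    then have "(c * t) * (c * t) powr (1 / p - 1) = (c * t) powr (1 + (1 / p - 1))"
      by (subst powr_add) auto
    then show ?thesis by simp
  qed auto
  finally show ?thesis .
qed

section \<open>Pseudo-hyperbolic disks against Euclidean neighbourhoods\<close>

lemma norm_one_minus_mult_cnj_pos:
  assumes "z \<in> unit_disk" "w \<in> unit_disk"
  shows "1 - cmod z \<le> cmod (1 - z * cnj w)" "0 < cmod (1 - z * cnj w)"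
proof -
  have "cmod z * cmod w \<le> cmod z" using assms by (simp add: mult_left_le)
  then show "1 - cmod z \<le> cmod (1 - z * cnj w)"
    using norm_triangle_ineq2[of 1 "z * cnj w"] by (simp add: norm_mult)
  moreover have "0 < 1 - cmod z" using assms by simp
  ultimately show "0 < cmod (1 - z * cnj w)" by linarith
qed

lemma in_pseudohyperbolic_diskI:
  assumes "z \<in> unit_disk" "w \<in> unit_disk" "dist z w < r * (1 - cmod z)" "0 \<le> r"
  shows "w \<in> pseudohyperbolic_disk z r"
proof -
  have "r * (1 - cmod z) \<le> r * cmod (1 - z * cnj w)"
    using assms norm_one_minus_mult_cnj_pos by (intro mult_left_mono) auto
  then have "cmod (z - w) < r * cmod (1 - z * cnj w)"
    using assms(3) by (simp add: dist_norm)
  then show ?thesis using assms norm_one_minus_mult_cnj_pos[OF assms(1,2)]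
    by (simp add: pseudohyperbolic_disk_def norm_divide divide_less_eq)
qed

text \<open>From 1 - z cnj w = (1 - |z|^2) + z cnj (z - w) one gets |1 - z cnj w| <= 2 (1 - |z|) +
  |z - w|, and likewise with 1 - |w|. Absorbing r |z - w| into the left-hand side leaves the
  constant 2 r / (1 - r).\<close>

lemma pseudohyperbolic_disk_subset_nbhd:
  assumes z: "z \<in> unit_disk" and r: "0 < r" "r < 1"
  shows "pseudohyperbolic_disk z r \<subseteq> nbhd (2 * r / (1 - r)) z"
proof
  fix w assume "w \<in> pseudohyperbolic_disk z r"
  then have w: "w \<in> unit_disk" and "cmod (z - w) < r * cmod (1 - z * cnj w)"
    using norm_one_minus_mult_cnj_pos[OF z, of w]
    by (auto simp: pseudohyperbolic_disk_def norm_divide divide_less_eq)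
  then have d: "dist z w < r * cmod (1 - z * cnj w)" by (simp add: dist_norm)
  have a: "r * cmod (1 - z * cnj w) \<le> r * (2 * (1 - cmod z) + dist z w)"
  proof -
    have "of_real (1 - (cmod z)\<^sup>2) = 1 - z * cnj z"
      by (simp only: of_real_diff complex_norm_square of_real_1)
    then have "1 - z * cnj w = of_real (1 - (cmod z)\<^sup>2) + z * cnj (z - w)"
      by (simp add: algebra_simps)
    then have "cmod (1 - z * cnj w) \<le> cmod (of_real (1 - (cmod z)\<^sup>2)) + cmod (z * cnj (z - w))"
      by (metis norm_triangle_ineq)
    also have "cmod (of_real (1 - (cmod z)\<^sup>2)) = 1 - (cmod z)\<^sup>2"
      using one_minus_norm_square_pos[OF z] by (simp only: norm_of_real abs_of_pos)
    also have "cmod (z * cnj (z - w)) \<le> dist z w"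
      using z by (simp add: norm_mult dist_norm mult_left_le_one_le del: complex_cnj_diff)
    finally show ?thesis using r one_minus_norm_square_bounds(2)[OF z] by (intro mult_left_mono) auto
  qed
  have b: "r * cmod (1 - z * cnj w) \<le> r * (2 * (1 - cmod w) + dist z w)"
  proof -
    have "of_real (1 - (cmod w)\<^sup>2) = 1 - w * cnj w"
      by (simp only: of_real_diff complex_norm_square of_real_1)
    then have "1 - z * cnj w = of_real (1 - (cmod w)\<^sup>2) + cnj w * (w - z)"
      by (simp add: algebra_simps)
    then have "cmod (1 - z * cnj w) \<le> cmod (of_real (1 - (cmod w)\<^sup>2)) + cmod (cnj w * (w - z))"
      by (metis norm_triangle_ineq)
    also have "cmod (of_real (1 - (cmod w)\<^sup>2)) = 1 - (cmod w)\<^sup>2"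
      using one_minus_norm_square_pos[OF w] by (simp only: norm_of_real abs_of_pos)
    also have "cmod (cnj w * (w - z)) \<le> dist z w"
      using w by (simp add: norm_mult dist_norm mult_left_le_one_le norm_minus_commute)
    finally show ?thesis using r one_minus_norm_square_bounds(2)[OF w] by (intro mult_left_mono) auto
  qed
  have "(1 - r) * dist z w < 2 * r * (1 - cmod z)" "(1 - r) * dist z w < 2 * r * (1 - cmod w)"
    using d a b by (auto simp: algebra_simps)
  then show "w \<in> nbhd (2 * r / (1 - r)) z"
    using w r by (simp add: nbhd_def field_simps)
qed

section \<open>Jordan parts and total variation\<close>

definition signed_additive :: "'a measure \<Rightarrow> ('a set \<Rightarrow> real) \<Rightarrow> bool" where
  "signed_additive M \<nu> \<longleftrightarrow>
    (\<forall>A::nat \<Rightarrow> 'a set. range A \<subseteq> sets M \<longrightarrow> disjoint_family A \<longrightarrow>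
      (\<lambda>i. \<nu> (A i)) sums \<nu> (\<Union>i. A i))"

lemma signed_additiveD:
  fixes A :: "nat \<Rightarrow> 'a set"
  assumes "signed_additive M \<nu>" "range A \<subseteq> sets M" "disjoint_family A"
  shows "(\<lambda>i. \<nu> (A i)) sums \<nu> (\<Union>i. A i)"
  by (rule assms(1)[unfolded signed_additive_def, rule_format, OF assms(2,3)])

lemma signed_additive_uminus: "signed_additive M \<nu> \<Longrightarrow> signed_additive M (\<lambda>E. - \<nu> E)"
  unfolding signed_additive_def by (intro allI impI sums_minus) simp

lemma signed_additive_empty:
  assumes "signed_additive M \<nu>" shows "\<nu> {} = 0"
proof -
  have "(\<lambda>i::nat. \<nu> {}) sums \<nu> (\<Union>i::nat. {})"
    by (rule signed_additiveD[OF assms]) (auto simp: disjoint_family_on_def)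
  then show ?thesis by (auto dest: sums_summable simp: summable_const_iff)
qed

lemma signed_additive_Un:
  assumes \<nu>: "signed_additive M \<nu>" and A: "A \<in> sets M" and B: "B \<in> sets M" and disj: "A \<inter> B = {}"
  shows "\<nu> (A \<union> B) = \<nu> A + \<nu> B"
proof -
  have "(\<lambda>i. \<nu> (binaryset A B i)) sums \<nu> (\<Union>i. binaryset A B i)"
    using A B disj by (intro signed_additiveD[OF \<nu>])
      (auto simp: binaryset_def disjoint_family_on_def)
  moreover have "(\<lambda>i. \<nu> (binaryset A B i)) sums (\<nu> A + \<nu> B)"
    by (rule binaryset_sums) (rule signed_additive_empty[OF \<nu>])
  ultimately show ?thesis by (simp add: UN_binaryset_eq sums_unique2)
qed

lemma signed_additive_Diff:
  assumes \<nu>: "signed_additive M \<nu>" and A: "A \<in> sets M" and B: "B \<in> sets M" and sub: "B \<subseteq> A"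
  shows "\<nu> (A - B) = \<nu> A - \<nu> B"
proof -
  have "\<nu> (B \<union> (A - B)) = \<nu> B + \<nu> (A - B)"
    using A B by (intro signed_additive_Un[OF \<nu>]) auto
  moreover have "B \<union> (A - B) = A" using sub by auto
  ultimately show ?thesis by simp
qed

text \<open>If \<open>\<nu>\<close> is unbounded on the measurable subsets of \<open>E\<close>, then \<open>E\<close> splits into a part of large
  measure and a part on which \<open>\<nu>\<close> is again unbounded; iterating gives a divergent series.\<close>

lemma signed_additive_bounded:
  assumes \<nu>: "signed_additive M \<nu>"
  shows "\<exists>b. \<forall>B\<in>sets M. \<bar>\<nu> B\<bar> \<le> b"
proof (rule ccontr)
  define U where "U E \<longleftrightarrow> E \<in> sets M \<and> (\<forall>b. \<exists>B\<in>sets M. B \<subseteq> E \<and> \<bar>\<nu> B\<bar> > b)" for E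
  have step: "\<exists>E'. U E' \<and> E' \<subseteq> E \<and> \<bar>\<nu> (E - E')\<bar> > 1" if E: "U E" for E
  proof -
    have Em: "E \<in> sets M" using E by (simp add: U_def)
    \<comment> \<open>The excess over |\<nu> E| makes both \<open>B\<close> and \<open>E - B\<close>
      larger than 1 in absolute value. Whichever of them is kept as the next unbounded set, the
      discarded part is large.\<close>
    obtain B where B: "B \<in> sets M" "B \<subseteq> E" "\<bar>\<nu> B\<bar> > 1 + \<bar>\<nu> E\<bar>"
      using E unfolding U_def by blast
    have D: "\<nu> (E - B) = \<nu> E - \<nu> B" using signed_additive_Diff[OF \<nu> Em B(1,2)] .
    have 1: "\<bar>\<nu> B\<bar> > 1" "\<bar>\<nu> (E - B)\<bar> > 1" using B(3) D by auto
    have "U B \<or> U (E - B)"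
    proof (rule ccontr)
      assume "\<not> (U B \<or> U (E - B))"
      then obtain b1 b2 where b: "\<And>C. C \<in> sets M \<Longrightarrow> C \<subseteq> B \<Longrightarrow> \<bar>\<nu> C\<bar> \<le> b1"
        "\<And>C. C \<in> sets M \<Longrightarrow> C \<subseteq> E - B \<Longrightarrow> \<bar>\<nu> C\<bar> \<le> b2"
        using B Em unfolding U_def by (metis linorder_not_less sets.Diff)
      obtain C where C: "C \<in> sets M" "C \<subseteq> E" "\<bar>\<nu> C\<bar> > b1 + b2"
        using E unfolding U_def by blast
      have "C = (C \<inter> B) \<union> (C - B)" by auto
      then have "\<nu> C = \<nu> (C \<inter> B) + \<nu> (C - B)"
        using signed_additive_Un[OF \<nu>, of "C \<inter> B" "C - B"] B C by auto
      moreover have "\<bar>\<nu> (C \<inter> B)\<bar> \<le> b1" "\<bar>\<nu> (C - B)\<bar> \<le> b2"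
        using B C by (auto intro!: b(1)[of "C \<inter> B"] b(2)[of "C - B"])
      ultimately show False using C(3) by linarith
    qed
    then show ?thesis
    proof
      assume "U B" then show ?thesis using B 1 by blast
    next
      assume "U (E - B)"
      moreover have "E - (E - B) = B" using B by auto
      ultimately show ?thesis using 1 by (intro exI[of _ "E - B"]) auto
    qed
  qed
  assume "\<nexists>b. \<forall>B\<in>sets M. \<bar>\<nu> B\<bar> \<le> b"
  then have "U (space M)"
    unfolding U_def by (metis not_le sets.sets_into_space sets.top)
  then have "\<exists>S. \<forall>n. U (S n) \<and> S (Suc n) \<subseteq> S n \<and> \<bar>\<nu> (S n - S (Suc n))\<bar> > 1"
    by (intro dependent_nat_choice[of "\<lambda>_. U" "\<lambda>_ E E'. E' \<subseteq> E \<and> \<bar>\<nu> (E - E')\<bar> > 1"])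
      (auto dest: step)
  then obtain S where S: "\<And>n. U (S n)" "\<And>n. S (Suc n) \<subseteq> S n \<and> \<bar>\<nu> (S n - S (Suc n))\<bar> > 1"
    by blast
  define A where "A n = S n - S (Suc n)" for n
  have anti: "S n \<subseteq> S m" if "m \<le> n" for m n
    using that S(2) by (induction rule: dec_induct) auto
  have "range A \<subseteq> sets M" using S(1) unfolding A_def U_def by auto
  moreover have "disjoint_family A"
    unfolding disjoint_family_on_def
  proof (intro ballI impI)
    fix m n :: nat assume "m \<noteq> n"
    then consider "Suc m \<le> n" | "Suc n \<le> m" by linarith
    then show "A m \<inter> A n = {}"
      using anti[of "Suc m" n] anti[of "Suc n" m] by cases (auto simp: A_def)
  qed
  ultimately have "(\<lambda>i. \<nu> (A i)) \<longlonglongrightarrow> 0"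
    using signed_additiveD[OF \<nu>] summable_LIMSEQ_zero sums_summable by blast
  then have "\<forall>\<^sub>F n in sequentially. \<bar>\<nu> (A n)\<bar> < 1"
    by (auto simp: tendsto_iff dist_real_def)
  then obtain n where "\<bar>\<nu> (A n)\<bar> < 1" by (auto simp: eventually_sequentially)
  moreover have "\<bar>\<nu> (A n)\<bar> > 1" using S(2)[of n] by (simp add: A_def)
  ultimately show False by simp
qed

lemma sets_jordan_pos [simp, measurable_cong]: "sets (jordan_pos M \<nu>) = sets M"
  unfolding jordan_pos_def by (subst sets_measure_of[OF sets.space_closed]) (rule sets.sigma_sets_eq)

lemma space_jordan_pos [simp]: "space (jordan_pos M \<nu>) = space M"
  by (simp add: jordan_pos_def sets.space_closed space_measure_of)

text \<open>\<open>measure_of\<close> returns the given set function only once it is known to be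
  countably additive. That is proved from the supremum itself, without a Hahn decomposition: subsets
  of disjoint sets can be united, which gives superadditivity, and a subset of a union splits into
  its traces on the pieces, which gives the converse.\<close>

lemma emeasure_jordan_pos:
  assumes \<nu>: "signed_additive M \<nu>" and E: "E \<in> sets M"
  shows "emeasure (jordan_pos M \<nu>) E = (SUP B\<in>{B \<in> sets M. B \<subseteq> E}. ennreal (\<nu> B))"
proof -
  define m where "m E = (SUP B\<in>{B \<in> sets M. B \<subseteq> E}. ennreal (\<nu> B))" for E
  note \<nu>0 = signed_additive_empty[OF \<nu>]
  have ub: "ennreal (\<nu> B) \<le> m E" if "B \<in> sets M" "B \<subseteq> E" for B E
    unfolding m_def using that by (intro SUP_upper) auto
  have finite_superadd: "(\<Sum>i<n. m (A i)) \<le> m (\<Union>i<n. A i)"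
    if A: "range A \<subseteq> sets M" "disjoint_family A" for A :: "nat \<Rightarrow> 'a set" and n
  proof (induction n)
    case 0
    show ?case by simp
  next
    case (Suc n)
    have add: "m X + m Y \<le> m (X \<union> Y)" if XY: "X \<in> sets M" "Y \<in> sets M" "X \<inter> Y = {}" for X Y
    proof -
      have *: "ennreal (\<nu> B) + ennreal (\<nu> C) \<le> m (X \<union> Y)"
        if B: "B \<in> sets M" "B \<subseteq> X" and C: "C \<in> sets M" "C \<subseteq> Y" for B C
      proof -
        \<comment> \<open>\<open>ennreal\<close> sends negative values to 0. If one of the two
          values is not positive, the other set alone is a competitor; only nonnegative values may
          be added under \<open>ennreal\<close>.\<close>
        consider "\<nu> B \<le> 0" | "\<nu> C \<le> 0" | "0 \<le> \<nu> B" "0 \<le> \<nu> C" by linarith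
        then show ?thesis
        proof cases
          case 1
          then show ?thesis using ub[of C "X \<union> Y"] C by (auto simp: ennreal_neg)
        next
          case 2
          then show ?thesis using ub[of B "X \<union> Y"] B by (auto simp: ennreal_neg)
        next
          case 3
          then have "ennreal (\<nu> B) + ennreal (\<nu> C) = ennreal (\<nu> (B \<union> C))"
            using signed_additive_Un[OF \<nu>, of B C] B C XY by (subst signed_additive_Un[OF \<nu>]) auto
          also have "\<dots> \<le> m (X \<union> Y)" using B C by (intro ub) auto
          finally show ?thesis .
        qed
      qed
      have ne: "{B \<in> sets M. B \<subseteq> Z} \<noteq> {}" for Z by auto
      have "m X + m Y = (SUP B\<in>{B \<in> sets M. B \<subseteq> X}. ennreal (\<nu> B) + m Y)"
        unfolding m_def[of X] by (rule ennreal_SUP_add_left[symmetric, OF ne])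
      also have "\<dots> \<le> m (X \<union> Y)"
      proof (rule SUP_least)
        fix B assume B: "B \<in> {B \<in> sets M. B \<subseteq> X}"
        have "ennreal (\<nu> B) + m Y = (SUP C\<in>{B \<in> sets M. B \<subseteq> Y}. ennreal (\<nu> B) + ennreal (\<nu> C))"
          unfolding m_def[of Y] by (rule ennreal_SUP_add_right[OF ne])
        also have "\<dots> \<le> m (X \<union> Y)" by (rule SUP_least) (use B * in auto)
        finally show "ennreal (\<nu> B) + m Y \<le> m (X \<union> Y)" .
      qed
      finally show ?thesis .
    qed
    have "A i \<inter> A n = {}" if "i < n" for i
      using A(2) that unfolding disjoint_family_on_def by (metis UNIV_I less_irrefl)
    then have "(\<Union>i<n. A i) \<inter> A n = {}" by auto
    then have "m (\<Union>i<n. A i) + m (A n) \<le> m ((\<Union>i<n. A i) \<union> A n)"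
      using A(1) by (intro add) auto
    moreover have "(\<Union>i<n. A i) \<union> A n = (\<Union>i<Suc n. A i)" by (auto simp: lessThan_Suc)
    moreover have "(\<Sum>i<Suc n. m (A i)) \<le> m (\<Union>i<n. A i) + m (A n)"
      unfolding sum.lessThan_Suc by (rule add_right_mono[OF Suc])
    ultimately show ?case by (metis order_trans)
  qed
  have eq: "jordan_pos M \<nu> = measure_of (space M) (sets M) m"
    unfolding jordan_pos_def m_def by (rule refl)
  have "emeasure (jordan_pos M \<nu>) E = m E"
  proof (rule emeasure_measure_of[OF eq])
    show "sets M \<subseteq> Pow (space M)" by (rule sets.space_closed)
    show "E \<in> sets (jordan_pos M \<nu>)" using E by simp
    show "positive (sets (jordan_pos M \<nu>)) m"
    proof -
      have "{B \<in> sets M. B \<subseteq> {}} = {{}}" by auto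
      then show ?thesis unfolding positive_def m_def by (simp add: \<nu>0)
    qed
    show "countably_additive (sets (jordan_pos M \<nu>)) m"
    proof (rule countably_additiveI)
      fix A :: "nat \<Rightarrow> 'a set"
      assume A: "range A \<subseteq> sets (jordan_pos M \<nu>)" "disjoint_family A"
      then have A': "range A \<subseteq> sets M" by simp
      show "(\<Sum>i. m (A i)) = m (\<Union>i. A i)"
      proof (rule antisym)
        show "(\<Sum>i. m (A i)) \<le> m (\<Union>i. A i)"
          unfolding suminf_eq_SUP
        proof (rule SUP_least)
          fix n
          have "(\<Sum>i<n. m (A i)) \<le> m (\<Union>i<n. A i)" by (rule finite_superadd[OF A' A(2)])
          also have "\<dots> \<le> m (\<Union>i. A i)" unfolding m_def by (rule SUP_subset_mono) auto
          finally show "(\<Sum>i<n. m (A i)) \<le> m (\<Union>i. A i)" .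
        qed
        show "m (\<Union>i. A i) \<le> (\<Sum>i. m (A i))"
          unfolding m_def[of "\<Union>i. A i"]
        proof (rule SUP_least)
          fix B assume "B \<in> {B \<in> sets M. B \<subseteq> (\<Union>i. A i)}"
          then have B: "B \<in> sets M" "B \<subseteq> (\<Union>i. A i)" by auto
          have "(\<lambda>i. \<nu> (B \<inter> A i)) sums \<nu> (\<Union>i. B \<inter> A i)"
            using A' A(2) B by (intro signed_additiveD[OF \<nu>]) (auto simp: disjoint_family_on_def)
          moreover have "(\<Union>i. B \<inter> A i) = B" using B by auto
          ultimately have s: "(\<lambda>i. \<nu> (B \<inter> A i)) sums \<nu> B" by simp
          have "(\<lambda>n. ennreal (\<Sum>i<n. \<nu> (B \<inter> A i))) \<longlonglongrightarrow> ennreal (\<nu> B)"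
            using s unfolding sums_def by (rule tendsto_ennrealI)
          moreover have "ennreal (\<Sum>i<n. \<nu> (B \<inter> A i)) \<le> (\<Sum>i. m (A i))" for n
          proof -
            \<comment> \<open>The terms may have either sign, and \<open>ennreal\<close> commutes
              with sums of nonnegative terms only, hence the passage to positive parts.\<close>
            have "ennreal (\<Sum>i<n. \<nu> (B \<inter> A i)) \<le> ennreal (\<Sum>i<n. max 0 (\<nu> (B \<inter> A i)))"
              by (intro ennreal_leI sum_mono) auto
            also have "\<dots> = (\<Sum>i<n. ennreal (max 0 (\<nu> (B \<inter> A i))))" by (simp add: sum_ennreal)
            also have "\<dots> = (\<Sum>i<n. ennreal (\<nu> (B \<inter> A i)))" 
              by (intro sum.cong refl) (auto simp: max_def ennreal_neg)
            also have "\<dots> \<le> (\<Sum>i<n. m (A i))"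
              using A' B by (intro sum_mono ub) auto
            also have "\<dots> \<le> (\<Sum>i. m (A i))" by (intro sum_le_suminf summableI) auto
            finally show ?thesis .
          qed
          ultimately show "ennreal (\<nu> B) \<le> (\<Sum>i. m (A i))"
            using LIMSEQ_le_const2 by blast
        qed
      qed
    qed
  qed
  then show ?thesis by (simp add: m_def)
qed

lemma finite_measure_jordan_pos:
  assumes \<nu>: "signed_additive M \<nu>"
  shows "finite_measure (jordan_pos M \<nu>)"
proof
  obtain b where b: "\<And>B. B \<in> sets M \<Longrightarrow> \<bar>\<nu> B\<bar> \<le> b" using signed_additive_bounded[OF \<nu>] by blast
  have "emeasure (jordan_pos M \<nu>) (space M) \<le> ennreal b"
    unfolding emeasure_jordan_pos[OF \<nu> sets.top]
    by (rule SUP_least) (auto intro!: ennreal_leI dest!: b)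
  then show "emeasure (jordan_pos M \<nu>) (space (jordan_pos M \<nu>)) \<noteq> \<infinity>"
    by (auto simp: top_unique)
qed

lemma signed_additive_le_jordan_pos:
  assumes "signed_additive M \<nu>" "E \<in> sets M"
  shows "\<nu> E \<le> measure (jordan_pos M \<nu>) E"
proof -
  interpret finite_measure "jordan_pos M \<nu>" by (rule finite_measure_jordan_pos) fact
  have "ennreal (\<nu> E) \<le> emeasure (jordan_pos M \<nu>) E"
    unfolding emeasure_jordan_pos[OF assms] using assms by (intro SUP_upper) auto
  then show ?thesis by (simp add: emeasure_eq_measure)
qed

section \<open>Total variation compared with the Jordan parts\<close>

lemma complex_measure_parts:
  assumes "complex_measure M \<mu>"
  shows "signed_additive M (\<lambda>E. Re (\<mu> E))" "signed_additive M (\<lambda>E. Im (\<mu> E))"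
  using assms unfolding complex_measure_def signed_additive_def by (auto intro!: sums_Re sums_Im)

text \<open>The partition of \<open>E\<close> into \<open>B\<close>, \<open>E - B\<close> and empty
  sets is one competitor in the supremum; the padding is harmless because
  \<open>\<mu> {} = 0\<close>.\<close>

lemma total_variation_ge:
  assumes \<mu>: "complex_measure M \<mu>" and E: "E \<in> sets M" and B: "B \<in> sets M" "B \<subseteq> E"
  shows "ennreal (cmod (\<mu> B)) \<le> total_variation M \<mu> E"
proof -
  have "\<mu> {} = 0"
    using complex_measure_parts[OF \<mu>, THEN signed_additive_empty] by (simp add: complex_eq_iff)
  then have s: "(\<lambda>i. cmod (\<mu> (binaryset B (E - B) i))) sums (cmod (\<mu> B) + cmod (\<mu> (E - B)))"
    by (intro binaryset_sums) simp
  have "ennreal (cmod (\<mu> B)) \<le> ennreal (cmod (\<mu> B) + cmod (\<mu> (E - B)))" by (intro ennreal_leI) auto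
  also have "\<dots> = (\<Sum>i. ennreal (cmod (\<mu> (binaryset B (E - B) i))))"
    using s by (subst suminf_ennreal2) (auto simp: sums_iff)
  also have "\<dots> \<le> total_variation M \<mu> E"
    unfolding total_variation_def using E B
    by (intro SUP_upper) (auto simp: binaryset_def disjoint_family_on_def UN_binaryset_eq split: if_splits)
  finally show ?thesis .
qed

text \<open>Meant for \<nu> = Re \<mu>, - Re \<mu>, Im \<mu>, - Im \<mu>: it hands a hypothesis on
  the total variation to each of the four positive measures from which the integral against \<mu> is
  built.\<close>

lemma emeasure_jordan_pos_le_total_variation:
  assumes \<mu>: "complex_measure M \<mu>" and \<nu>: "signed_additive M \<nu>"
    and le: "\<And>B. \<nu> B \<le> cmod (\<mu> B)" and E: "E \<in> sets M"
  shows "emeasure (jordan_pos M \<nu>) E \<le> total_variation M \<mu> E"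
  unfolding emeasure_jordan_pos[OF \<nu> E]
proof (rule SUP_least)
  fix B assume "B \<in> {B \<in> sets M. B \<subseteq> E}"
  then have "ennreal (cmod (\<mu> B)) \<le> total_variation M \<mu> E" by (intro total_variation_ge[OF \<mu> E]) auto
  then show "ennreal (\<nu> B) \<le> total_variation M \<mu> E"
    using le[of B] by (meson ennreal_leI order_trans)
qed

lemma total_variation_le_measure:
  assumes "finite_measure N" and sets: "sets N = sets M"
    and le: "\<And>B. B \<in> sets M \<Longrightarrow> cmod (\<mu> B) \<le> measure N B"
  shows "total_variation M \<mu> E \<le> emeasure N E"
  unfolding total_variation_def
proof (rule SUP_least)
  interpret finite_measure N by fact
  fix A :: "nat \<Rightarrow> 'a set"
  assume "A \<in> {A. range A \<subseteq> sets M \<and> disjoint_family A \<and> \<Union> (range A) = E}"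
  then have A: "range A \<subseteq> sets M" "disjoint_family A" "(\<Union>i. A i) = E" by auto
  have "(\<Sum>i. ennreal (cmod (\<mu> (A i)))) \<le> (\<Sum>i. emeasure N (A i))"
    using A by (intro suminf_le) (auto simp: emeasure_eq_measure intro!: ennreal_leI le)
  also have "\<dots> = emeasure N E" using A sets by (subst suminf_emeasure) auto
  finally show "(\<Sum>i. ennreal (cmod (\<mu> (A i)))) \<le> emeasure N E" .
qed

text \<open>The sum of the four Jordan parts dominates |\<mu> B| for every measurable
  \<open>B\<close>, is finite and is countably additive, so no partition can exceed its total
  mass.\<close>

lemma total_variation_finite:
  assumes \<mu>: "complex_measure M \<mu>" and E: "E \<in> sets M"
  shows "total_variation M \<mu> E < \<infinity>"
proof -
  note R = complex_measure_parts(1)[OF \<mu>] and I = complex_measure_parts(2)[OF \<mu>]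
  define J where "J \<nu> = jordan_pos M \<nu>" for \<nu>
  define b where "b = (\<lambda>E. measure (J (\<lambda>E. Re (\<mu> E))) E + measure (J (\<lambda>E. - Re (\<mu> E))) E
     + measure (J (\<lambda>E. Im (\<mu> E))) E + measure (J (\<lambda>E. - Im (\<mu> E))) E)"
  have le: "cmod (\<mu> B) \<le> b B" if "B \<in> sets M" for B
  proof -
    have "cmod (\<mu> B) \<le> \<bar>Re (\<mu> B)\<bar> + \<bar>Im (\<mu> B)\<bar>" by (rule cmod_le)
    moreover have "Re (\<mu> B) \<le> measure (J (\<lambda>E. Re (\<mu> E))) B"
        "- Re (\<mu> B) \<le> measure (J (\<lambda>E. - Re (\<mu> E))) B"
        "Im (\<mu> B) \<le> measure (J (\<lambda>E. Im (\<mu> E))) B"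
        "- Im (\<mu> B) \<le> measure (J (\<lambda>E. - Im (\<mu> E))) B"
      unfolding J_def using that R I
      by (auto intro!: signed_additive_le_jordan_pos[where \<nu> = "\<lambda>E. Re (\<mu> E)"]
         signed_additive_le_jordan_pos[where \<nu> = "\<lambda>E. Im (\<mu> E)"]
         signed_additive_le_jordan_pos[where \<nu> = "\<lambda>E. - Re (\<mu> E)"]
         signed_additive_le_jordan_pos[where \<nu> = "\<lambda>E. - Im (\<mu> E)"] signed_additive_uminus)
    moreover have "0 \<le> measure (J \<nu>) B" for \<nu> by simp
    ultimately show ?thesis unfolding b_def by (smt (verit))
  qed
  have fin: "finite_measure (J \<nu>)" if "signed_additive M \<nu>" for \<nu>
    unfolding J_def by (rule finite_measure_jordan_pos[OF that])
  have "total_variation M \<mu> E \<le> ennreal (b (space M))"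
    unfolding total_variation_def
  proof (rule SUP_least)
    fix A :: "nat \<Rightarrow> 'a set"
    assume "A \<in> {A. range A \<subseteq> sets M \<and> disjoint_family A \<and> \<Union> (range A) = E}"
    then have A: "range A \<subseteq> sets M" "disjoint_family A" by auto
    have s: "(\<lambda>i. measure (J \<nu>) (A i)) sums measure (J \<nu>) (\<Union>i. A i)"
      and m: "measure (J \<nu>) (\<Union>i. A i) \<le> measure (J \<nu>) (space M)" if "signed_additive M \<nu>" for \<nu>
    proof -
      interpret finite_measure "J \<nu>" by (rule fin[OF that])
      show "(\<lambda>i. measure (J \<nu>) (A i)) sums measure (J \<nu>) (\<Union>i. A i)"
        using A by (intro finite_measure_UNION) (auto simp: J_def)
      show "measure (J \<nu>) (\<Union>i. A i) \<le> measure (J \<nu>) (space M)"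
        using bounded_measure[of "\<Union>i. A i"] by (simp add: J_def)
    qed
    have s': "(\<lambda>i. b (A i)) sums b (\<Union>i. A i)"
      unfolding b_def by (intro sums_add s R I signed_additive_uminus)
    have "(\<Sum>i. ennreal (cmod (\<mu> (A i)))) \<le> (\<Sum>i. ennreal (b (A i)))"
      using A by (intro suminf_le ennreal_leI le) auto
    also have "\<dots> = ennreal (b (\<Union>i. A i))"
      using s' by (subst suminf_ennreal2) (auto simp: sums_iff b_def)
    also have "\<dots> \<le> ennreal (b (space M))"
      unfolding b_def by (intro ennreal_leI add_mono m R I signed_additive_uminus)
    finally show "(\<Sum>i. ennreal (cmod (\<mu> (A i)))) \<le> ennreal (b (space M))" .
  qed
  then show ?thesis by (auto simp: top_unique less_top[symmetric])
qed

section \<open>Measures with a density\<close>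

text \<open>Banach-valued, so that the same facts serve a complex density and its real and imaginary
  parts.\<close>

definition integral_measure :: "'a measure \<Rightarrow> ('a \<Rightarrow> 'b) \<Rightarrow> 'a set \<Rightarrow> 'b::{banach, second_countable_topology}" where
  "integral_measure M h E = (\<integral>x. indicat_real E x *\<^sub>R h x \<partial>M)"

lemma integral_measure_sums:
  fixes A :: "nat \<Rightarrow> 'a set"
  assumes h: "integrable M h" and A: "range A \<subseteq> sets M" and disj: "disjoint_family A"
  shows "(\<lambda>i. integral_measure M h (A i)) sums integral_measure M h (\<Union>i. A i)"
proof -
  have [measurable]: "A i \<in> sets M" for i using A by auto
  have hm [measurable]: "h \<in> borel_measurable M" using h by auto
  have int: "integrable M (\<lambda>x. indicat_real E x *\<^sub>R h x)" if "E \<in> sets M" for E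
    using that h by (rule integrable_mult_indicator)
  have ind: "(\<Sum>i<n. indicat_real (A i) x *\<^sub>R h x) = indicat_real (\<Union>i<n. A i) x *\<^sub>R h x" for n x
  proof -
    have d: "disjoint_family_on A {..<n}" by (rule disjoint_family_on_mono[OF _ disj]) auto
    show ?thesis by (simp add: indicator_UN_disjoint[OF _ d] scaleR_sum_left)
  qed
  have "(\<lambda>n. \<integral>x. indicat_real (\<Union>i<n. A i) x *\<^sub>R h x \<partial>M) \<longlonglongrightarrow> (\<integral>x. indicat_real (\<Union>i. A i) x *\<^sub>R h x \<partial>M)"
  proof (rule integral_dominated_convergence[where w="\<lambda>x. norm (h x)"])
    show "AE x in M. (\<lambda>n. indicat_real (\<Union>i<n. A i) x *\<^sub>R h x) \<longlonglongrightarrow> indicat_real (\<Union>i. A i) x *\<^sub>R h x"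
    proof (rule AE_I2)
      fix x
      have "(\<lambda>n. indicat_real (\<Union>i<n. A i) x) \<longlonglongrightarrow> indicat_real (\<Union>i. A i) x"
        by (rule LIMSEQ_indicator_UN)
      then show "(\<lambda>n. indicat_real (\<Union>i<n. A i) x *\<^sub>R h x) \<longlonglongrightarrow> indicat_real (\<Union>i. A i) x *\<^sub>R h x"
        by (intro tendsto_intros)
    qed
    show "AE x in M. norm (indicat_real (\<Union>i<n. A i) x *\<^sub>R h x) \<le> norm (h x)" for n
      by (rule AE_I2) (auto simp: indicator_def)
  qed (use h in auto)
  moreover have "(\<integral>x. indicat_real (\<Union>i<n. A i) x *\<^sub>R h x \<partial>M) = (\<Sum>i<n. integral_measure M h (A i))" for n
    unfolding integral_measure_def ind[symmetric] by (intro Bochner_Integration.integral_sum int) auto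
  ultimately show ?thesis by (simp add: sums_def integral_measure_def)
qed

lemma complex_measure_integral_measure:
  "integrable M h \<Longrightarrow> complex_measure M (integral_measure M h)"
  unfolding complex_measure_def using integral_measure_sums by blast

lemma signed_additive_integral_measure:
  "integrable M u \<Longrightarrow> signed_additive M (integral_measure M u)"
  unfolding signed_additive_def using integral_measure_sums by blast

lemma jordan_pos_cong:
  assumes "\<And>E. E \<in> sets M \<Longrightarrow> \<nu> E = \<nu>' E"
  shows "jordan_pos M \<nu> = jordan_pos M \<nu>'"
proof -
  have "(\<lambda>E. SUP B\<in>{B \<in> sets M. B \<subseteq> E}. ennreal (\<nu> B)) = (\<lambda>E. SUP B\<in>{B \<in> sets M. B \<subseteq> E}. ennreal (\<nu>' B))"
    using assms by (intro ext SUP_cong) auto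
  then show ?thesis by (simp add: jordan_pos_def)
qed

text \<open>\<open>ennreal (u x)\<close> is the positive part of u, and the part of \<open>E\<close>
  where u >= 0 attains the supremum: for a density the Hahn decomposition is explicit.\<close>

lemma jordan_pos_integral_measure:
  fixes u :: "'a \<Rightarrow> real"
  assumes u: "integrable M u"
  shows "jordan_pos M (integral_measure M u) = density M (\<lambda>x. ennreal (u x))"
proof (rule measure_eqI)
  have [measurable]: "u \<in> borel_measurable M" using u by auto
  have int: "integrable M (\<lambda>x. indicat_real B x * u x)" if "B \<in> sets M" for B
    using integrable_mult_indicator[OF that u] by simp
  fix E assume "E \<in> sets (jordan_pos M (integral_measure M u))"
  then have E [measurable]: "E \<in> sets M" by simp
  have "emeasure (jordan_pos M (integral_measure M u)) E
      = (SUP B\<in>{B \<in> sets M. B \<subseteq> E}. ennreal (integral_measure M u B))"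
    by (rule emeasure_jordan_pos[OF signed_additive_integral_measure[OF u] E])
  also have "\<dots> = (\<integral>\<^sup>+x. ennreal (u x) * indicator E x \<partial>M)"
  proof (rule antisym)
    show "(SUP B\<in>{B \<in> sets M. B \<subseteq> E}. ennreal (integral_measure M u B)) \<le> (\<integral>\<^sup>+x. ennreal (u x) * indicator E x \<partial>M)"
    proof (rule SUP_least)
      fix B assume "B \<in> {B \<in> sets M. B \<subseteq> E}"
      then have B [measurable]: "B \<in> sets M" and sub: "B \<subseteq> E" by auto
      have i: "integrable M (\<lambda>x. max 0 (indicat_real B x * u x))" using int[OF B] by auto
      have "integral_measure M u B \<le> (\<integral>x. max 0 (indicat_real B x * u x) \<partial>M)"
        unfolding integral_measure_def using int[OF B] i by (auto intro!: integral_mono)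
      then have "ennreal (integral_measure M u B) \<le> ennreal (\<integral>x. max 0 (indicat_real B x * u x) \<partial>M)"
        by (rule ennreal_leI)
      also have "\<dots> = (\<integral>\<^sup>+x. ennreal (max 0 (indicat_real B x * u x)) \<partial>M)"
        by (rule nn_integral_eq_integral[symmetric, OF i]) auto
      also have "\<dots> \<le> (\<integral>\<^sup>+x. ennreal (u x) * indicator E x \<partial>M)"
        using sub by (intro nn_integral_mono) (auto simp: indicator_def max_def ennreal_neg)
      finally show "ennreal (integral_measure M u B) \<le> (\<integral>\<^sup>+x. ennreal (u x) * indicator E x \<partial>M)" .
    qed
    define B where "B = {x \<in> space M. x \<in> E \<and> 0 \<le> u x}"
    have B [measurable]: "B \<in> sets M" unfolding B_def by measurable
    have "(\<integral>\<^sup>+x. ennreal (u x) * indicator E x \<partial>M) = (\<integral>\<^sup>+x. ennreal (indicat_real B x * u x) \<partial>M)"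
      by (intro nn_integral_cong) (auto simp: B_def indicator_def ennreal_neg)
    also have "\<dots> = ennreal (integral_measure M u B)"
      unfolding integral_measure_def using int[OF B]
      by (subst nn_integral_eq_integral) (auto simp: B_def indicator_def)
    also have "\<dots> \<le> (SUP B\<in>{B \<in> sets M. B \<subseteq> E}. ennreal (integral_measure M u B))"
      by (rule SUP_upper) (use B in \<open>auto simp: B_def\<close>)
    finally show "(\<integral>\<^sup>+x. ennreal (u x) * indicator E x \<partial>M) \<le> (SUP B\<in>{B \<in> sets M. B \<subseteq> E}. ennreal (integral_measure M u B))" .
  qed
  also have "\<dots> = emeasure (density M (\<lambda>x. ennreal (u x))) E"
    by (subst emeasure_density) auto
  finally show "emeasure (jordan_pos M (integral_measure M u)) E = emeasure (density M (\<lambda>x. ennreal (u x))) E" .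
qed simp

text \<open>The Jordan parts have the positive and negative parts of u as densities. \<nu> is
  compared with the integral on measurable sets only, which is where taking real or imaginary parts
  commutes with integration of the complex density.\<close>

lemma signed_integral_integral_measure:
  fixes u :: "'a \<Rightarrow> real" and g :: "'a \<Rightarrow> complex"
  assumes u: "integrable M u" and g [measurable]: "g \<in> borel_measurable M"
    and ug: "integrable M (\<lambda>x. of_real (u x) * g x)"
    and \<nu>: "\<And>E. E \<in> sets M \<Longrightarrow> \<nu> E = integral_measure M u E"
  shows "signed_integral M \<nu> g = (\<integral>x. of_real (u x) * g x \<partial>M)"
proof -
  have um [measurable]: "u \<in> borel_measurable M" using u by auto
  have 1: "integral\<^sup>L (jordan_pos M \<nu>) g = (\<integral>x. of_real (max 0 (u x)) * g x \<partial>M)"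
    if u: "integrable M u" and \<nu>: "\<And>E. E \<in> sets M \<Longrightarrow> \<nu> E = integral_measure M u E" for u \<nu>
  proof -
    have [measurable]: "u \<in> borel_measurable M" using u by auto
    have "jordan_pos M \<nu> = density M (\<lambda>x. ennreal (u x))"
      using jordan_pos_cong[of M \<nu>, OF \<nu>] jordan_pos_integral_measure[OF u] by simp
    also have "\<dots> = density M (\<lambda>x. ennreal (max 0 (u x)))"
      by (intro density_cong) (auto simp: max_def ennreal_neg)
    finally have "integral\<^sup>L (jordan_pos M \<nu>) g = integral\<^sup>L (density M (\<lambda>x. ennreal (max 0 (u x)))) g" by simp
    also have "\<dots> = (\<integral>x. max 0 (u x) *\<^sub>R g x \<partial>M)" by (rule integral_density) auto
    finally show ?thesis by (simp add: scaleR_conv_of_real)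
  qed
  have neg: "- \<nu> E = integral_measure M (\<lambda>x. - u x) E" if "E \<in> sets M" for E
    using \<nu>[OF that] by (simp add: integral_measure_def)
  have i: "integrable M (\<lambda>x. of_real (max 0 (u x)) * g x)" "integrable M (\<lambda>x. of_real (max 0 (- u x)) * g x)"
    by (rule Bochner_Integration.integrable_bound[OF ug];
        auto simp: norm_mult intro!: mult_right_mono)+
  have "signed_integral M \<nu> g = (\<integral>x. of_real (max 0 (u x)) * g x \<partial>M) - (\<integral>x. of_real (max 0 (- u x)) * g x \<partial>M)"
    unfolding signed_integral_def using 1[OF u \<nu>] 1[of "\<lambda>x. - u x" "\<lambda>E. - \<nu> E"] u neg by simp
  also have "\<dots> = (\<integral>x. of_real (max 0 (u x)) * g x - of_real (max 0 (- u x)) * g x \<partial>M)"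
    using i by (rule Bochner_Integration.integral_diff[symmetric])
  also have "\<dots> = (\<integral>x. of_real (u x) * g x \<partial>M)"
    by (intro Bochner_Integration.integral_cong) (auto simp: max_def)
  finally show ?thesis .
qed

lemma complex_measure_integral_integral_measure:
  fixes h g :: "'a \<Rightarrow> complex"
  assumes h: "integrable M h" and g [measurable]: "g \<in> borel_measurable M"
    and hg: "integrable M (\<lambda>x. h x * g x)"
  shows "complex_measure_integral M (integral_measure M h) g = (\<integral>x. h x * g x \<partial>M)"
proof -
  have [measurable]: "h \<in> borel_measurable M" using h by auto
  have i: "integrable M (\<lambda>x. of_real (Re (h x)) * g x)" "integrable M (\<lambda>x. of_real (Im (h x)) * g x)"
    by (rule Bochner_Integration.integrable_bound[OF hg];
        auto simp: norm_mult abs_Re_le_cmod abs_Im_le_cmod intro!: mult_right_mono)+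
  have ri: "integrable M (\<lambda>x. Re (h x))" "integrable M (\<lambda>x. Im (h x))" using h by auto
  have p: "Re (integral_measure M h E) = integral_measure M (\<lambda>x. Re (h x)) E"
    "Im (integral_measure M h E) = integral_measure M (\<lambda>x. Im (h x)) E" if "E \<in> sets M" for E
  proof -
    have "integrable M (\<lambda>x. indicat_real E x *\<^sub>R h x)" using that h by (rule integrable_mult_indicator)
    then show "Re (integral_measure M h E) = integral_measure M (\<lambda>x. Re (h x)) E"
      "Im (integral_measure M h E) = integral_measure M (\<lambda>x. Im (h x)) E"
      unfolding integral_measure_def by (simp_all flip: integral_Re integral_Im)
  qed
  have "complex_measure_integral M (integral_measure M h) g
     = (\<integral>x. of_real (Re (h x)) * g x \<partial>M) + \<i> * (\<integral>x. of_real (Im (h x)) * g x \<partial>M)"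
    unfolding complex_measure_integral_def
    using signed_integral_integral_measure[OF ri(1) g i(1) p(1)]
      signed_integral_integral_measure[OF ri(2) g i(2) p(2)] by simp
  also have "\<dots> = (\<integral>x. of_real (Re (h x)) * g x + \<i> * (of_real (Im (h x)) * g x) \<partial>M)"
    using i by (subst Bochner_Integration.integral_add) auto
  also have "\<dots> = (\<integral>x. h x * g x \<partial>M)"
  proof (rule Bochner_Integration.integral_cong[OF refl])
    fix x
    show "of_real (Re (h x)) * g x + \<i> * (of_real (Im (h x)) * g x) = h x * g x"
      by (subst (3) complex_eq[of "h x"]) (simp add: algebra_simps)
  qed
  finally show ?thesis .
qed

text \<open>Splitting \<open>E\<close> according to the direction of \<open>h\<close>, chosen from the countable set of
  rational angles, one loses at most a factor \<open>1 - e\<close>.\<close>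

lemma total_variation_integral_measure:
  fixes h :: "'a \<Rightarrow> complex"
  assumes h: "integrable M h" and E [measurable]: "E \<in> sets M"
  shows "total_variation M (integral_measure M h) E = (\<integral>\<^sup>+x. ennreal (cmod (h x)) * indicator E x \<partial>M)"
proof (rule antisym)
  have hm [measurable]: "h \<in> borel_measurable M" using h by auto
  have nint: "integrable M (\<lambda>x. indicat_real B x * cmod (h x))" if "B \<in> sets M" for B
    using integrable_mult_indicator[OF that integrable_norm[OF h]] by simp
  have int: "integrable M (\<lambda>x. indicat_real B x *\<^sub>R h x)" if "B \<in> sets M" for B
    using that h by (rule integrable_mult_indicator)
  have nnB: "(\<integral>\<^sup>+x. ennreal (cmod (h x)) * indicator B x \<partial>M) = ennreal (\<integral>x. indicat_real B x * cmod (h x) \<partial>M)"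
    if "B \<in> sets M" for B
  proof -
    have "(\<integral>\<^sup>+x. ennreal (cmod (h x)) * indicator B x \<partial>M) = (\<integral>\<^sup>+x. ennreal (indicat_real B x * cmod (h x)) \<partial>M)"
      by (intro nn_integral_cong) (auto simp: indicator_def)
    also have "\<dots> = ennreal (\<integral>x. indicat_real B x * cmod (h x) \<partial>M)"
      by (rule nn_integral_eq_integral[OF nint[OF that]]) auto
    finally show ?thesis .
  qed
  let ?D = "density M (\<lambda>x. ennreal (cmod (h x)))"
  have D: "emeasure ?D B = (\<integral>\<^sup>+x. ennreal (cmod (h x)) * indicator B x \<partial>M)" if "B \<in> sets M" for B
    using that by (subst emeasure_density) auto
  have fin: "finite_measure ?D"
  proof
    have "emeasure ?D (space M) = ennreal (\<integral>x. indicat_real (space M) x * cmod (h x) \<partial>M)"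
      using D[OF sets.top] nnB[OF sets.top] by simp
    then show "emeasure ?D (space ?D) \<noteq> \<infinity>" by simp
  qed
  interpret D: finite_measure ?D by (rule fin)
  have "cmod (integral_measure M h B) \<le> measure ?D B" if B: "B \<in> sets M" for B
  proof -
    have "cmod (integral_measure M h B) \<le> (\<integral>x. cmod (indicat_real B x *\<^sub>R h x) \<partial>M)"
      unfolding integral_measure_def by (rule integral_norm_bound)
    also have "\<dots> = (\<integral>x. indicat_real B x * cmod (h x) \<partial>M)" by simp
    also have "\<dots> = measure ?D B"
      using D[OF B] nnB[OF B] by (simp add: measure_def Bochner_Integration.integral_nonneg)
    finally show ?thesis .
  qed
  then have "total_variation M (integral_measure M h) E \<le> emeasure ?D E"
    by (intro total_variation_le_measure fin) auto
  then show "total_variation M (integral_measure M h) E \<le> (\<integral>\<^sup>+x. ennreal (cmod (h x)) * indicator E x \<partial>M)"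
    by (simp add: D)
  have lower: "ennreal (1 - e) * emeasure ?D E \<le> total_variation M (integral_measure M h) E"
    if e: "0 < e" "e < 1" for e
  proof -
    define q :: "nat \<Rightarrow> real" where "q = from_nat_into \<rat>"
    have q: "range q = \<rat>" unfolding q_def by (intro range_from_nat_into countable_rat) auto
    define A where "A i = {x \<in> space M. x \<in> E \<and> Re (cis (- q i) * h x) \<ge> (1 - e) * cmod (h x)}" for i
    have A [measurable]: "A i \<in> sets M" for i unfolding A_def by measurable
    have cover: "\<exists>i. Re (cis (- q i) * y) \<ge> (1 - e) * cmod y" for y :: complex
    proof (cases "y = 0")
      case False
      define g where "g t = Re (cis (- t) * y)" for t
      have "g = (\<lambda>t. cos t * Re y + sin t * Im y)" by (simp add: g_def fun_eq_iff)
      then have "isCont g (Arg y)" by (auto intro!: continuous_intros)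
      moreover have "cis (- Arg y) * y = cmod y"
      proof -
        have "y = of_real (cmod y) * cis (Arg y)" using rcis_cmod_Arg[of y] by (simp add: rcis_def)
        then have "cis (- Arg y) * y = of_real (cmod y) * (cis (- Arg y) * cis (Arg y))"
          by (metis mult.left_commute)
        then show ?thesis by (simp add: cis_mult)
      qed
      then have g0: "g (Arg y) = cmod y" by (simp add: g_def)
      have "g (Arg y) > (1 - e) * cmod y" using e False by (simp add: g0)
      ultimately have "\<forall>\<^sub>F t in at (Arg y). g t > (1 - e) * cmod y"
        unfolding isCont_def by (rule order_tendstoD(1))
      then obtain d where d: "d > 0" "\<And>t. t \<noteq> Arg y \<Longrightarrow> dist t (Arg y) < d \<Longrightarrow> g t > (1 - e) * cmod y"
        by (auto simp: eventually_at)
      \<comment> \<open>The limit at \<open>Arg y\<close> says nothing about the point itself, so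
        the rational angle is taken strictly larger.\<close>
      obtain t where t: "t \<in> \<rat>" "Arg y < t" "t < Arg y + d"
        using Rats_dense_in_real[of "Arg y" "Arg y + d"] d by auto
      obtain i where "q i = t" using q t(1) by (metis rangeE)
      then show ?thesis using d(2)[of t] t by (intro exI[of _ i]) (auto simp: g_def dist_real_def)
    qed auto
    have un: "(\<Union>i. A i) = E"
      using cover sets.sets_into_space[OF E] by (auto simp: A_def)
    define B where "B = disjointed A"
    have B: "B i \<in> sets M" "B i \<subseteq> A i" for i
    proof -
      have "range A \<subseteq> sets M" using A by auto
      then have "range B \<subseteq> sets M" unfolding B_def by (rule sets.range_disjointed_sets)
      then show "B i \<in> sets M" by auto
      show "B i \<subseteq> A i" unfolding B_def by (rule disjointed_subset)
    qed
    have dB: "disjoint_family B" "(\<Union>i. B i) = E"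
      using un by (auto simp: B_def disjoint_family_disjointed UN_disjointed_eq)
    have part: "ennreal (1 - e) * emeasure ?D (B i) \<le> ennreal (cmod (integral_measure M h (B i)))" for i
    proof -
      have 1: "integrable M (\<lambda>x. cis (- q i) * (indicat_real (B i) x *\<^sub>R h x))"
        using int[OF B(1)] by (rule integrable_mult_right)
      have "(1 - e) * (\<integral>x. indicat_real (B i) x * cmod (h x) \<partial>M)
          = (\<integral>x. (1 - e) * (indicat_real (B i) x * cmod (h x)) \<partial>M)" by simp
      also have "\<dots> \<le> (\<integral>x. Re (cis (- q i) * (indicat_real (B i) x *\<^sub>R h x)) \<partial>M)"
      proof (rule integral_mono)
        show "integrable M (\<lambda>x. (1 - e) * (indicat_real (B i) x * cmod (h x)))"
          using nint[OF B(1)] by (rule integrable_mult_right)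
        show "integrable M (\<lambda>x. Re (cis (- q i) * (indicat_real (B i) x *\<^sub>R h x)))"
          using 1 by (rule integrable_Re)
        fix x
        show "(1 - e) * (indicat_real (B i) x * cmod (h x)) \<le> Re (cis (- q i) * (indicat_real (B i) x *\<^sub>R h x))"
          using B(2)[of i] by (cases "x \<in> B i") (auto simp: A_def)
      qed
      also have "\<dots> = Re (cis (- q i) * integral_measure M h (B i))"
        unfolding integral_measure_def integral_mult_right_zero[symmetric] by (rule integral_Re[OF 1])
      also have "\<dots> \<le> cmod (cis (- q i) * integral_measure M h (B i))" by (rule complex_Re_le_cmod)
      also have "\<dots> = cmod (integral_measure M h (B i))" by (simp add: norm_mult)
      finally have "ennreal ((1 - e) * (\<integral>x. indicat_real (B i) x * cmod (h x) \<partial>M)) \<le> ennreal (cmod (integral_measure M h (B i)))"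
        by (rule ennreal_leI)
      then show ?thesis using e by (simp add: D[OF B(1)] nnB[OF B(1)] ennreal_mult' )
    qed
    have "ennreal (1 - e) * emeasure ?D E = ennreal (1 - e) * (\<Sum>i. emeasure ?D (B i))"
      using B dB by (subst suminf_emeasure) auto
    also have "\<dots> = (\<Sum>i. ennreal (1 - e) * emeasure ?D (B i))" by simp
    also have "\<dots> \<le> (\<Sum>i. ennreal (cmod (integral_measure M h (B i))))"
      by (intro suminf_le part) auto
    also have "\<dots> \<le> total_variation M (integral_measure M h) E"
      unfolding total_variation_def using B dB by (intro SUP_upper) auto
    finally show ?thesis .
  qed
  have "ennreal (measure ?D E) \<le> total_variation M (integral_measure M h) E"
  proof (rule LIMSEQ_le_const2)
    \<comment> \<open>The shift by two keeps e = 1 / (n + 2) strictly between 0 and 1, as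
      \<open>lower\<close> requires.\<close>
    have "(\<lambda>n. (1 - 1 / real (Suc (Suc n))) * measure ?D E) \<longlonglongrightarrow> (1 - 0) * measure ?D E"
      by (intro tendsto_intros) (rule LIMSEQ_Suc[OF lim_1_over_n[THEN LIMSEQ_Suc]])
    then show "(\<lambda>n. ennreal ((1 - 1 / real (Suc (Suc n))) * measure ?D E)) \<longlonglongrightarrow> ennreal (measure ?D E)"
      by (intro tendsto_ennrealI) simp
    show "\<exists>N. \<forall>n\<ge>N. ennreal ((1 - 1 / real (Suc (Suc n))) * measure ?D E) \<le> total_variation M (integral_measure M h) E"
    proof (intro exI allI impI)
      fix n :: nat
      have "ennreal ((1 - 1 / real (Suc (Suc n))) * measure ?D E) = ennreal (1 - 1 / real (Suc (Suc n))) * emeasure ?D E"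
        by (subst ennreal_mult) (auto simp: D.emeasure_eq_measure)
      then show "ennreal ((1 - 1 / real (Suc (Suc n))) * measure ?D E) \<le> total_variation M (integral_measure M h) E"
        using lower[of "1 / real (Suc (Suc n))"] by simp
    qed
  qed
  then show "(\<integral>\<^sup>+x. ennreal (cmod (h x)) * indicator E x \<partial>M) \<le> total_variation M (integral_measure M h) E"
    by (simp add: D[symmetric] D.emeasure_eq_measure)
qed

lemma total_variation_cong_sets: "sets M = sets N \<Longrightarrow> total_variation M \<mu> E = total_variation N \<mu> E"
  by (simp add: total_variation_def)

lemma complex_measure_cong_sets: "sets M = sets N \<Longrightarrow> complex_measure M \<mu> = complex_measure N \<mu>"
  by (simp add: complex_measure_def)

lemma complex_measure_integral_cong_sets:
  assumes "sets M = sets N"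
  shows "complex_measure_integral M \<mu> g = complex_measure_integral N \<mu> g"
proof -
  have "jordan_pos M = jordan_pos N"
    using assms sets_eq_imp_space_eq[OF assms] by (auto simp: jordan_pos_def fun_eq_iff)
  then show ?thesis by (simp add: complex_measure_integral_def signed_integral_def)
qed

section \<open>Sub-mean value inequality for powers\<close>

lemma integral_unit_interval_continuous:
  fixes f :: "real \<Rightarrow> complex"
  assumes "continuous_on {0..1} f"
  shows "integrable unit_interval f" "integral\<^sup>L unit_interval f = integral {0..1} f"
proof -
  have s: "set_integrable lborel {0..1} f" by (rule borel_integrable_atLeastAtMost'[OF assms])
  then show "integrable unit_interval f"
    by (simp add: integrable_restrict_space set_integrable_def)
  have "integral\<^sup>L unit_interval f = (LINT x:{0..1}|lborel. f x)"
    by (simp add: integral_restrict_space set_lebesgue_integral_def)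
  also have "\<dots> = integral {0..1} f" by (rule set_borel_integral_eq_integral(2)[OF s])
  finally show "integral\<^sup>L unit_interval f = integral {0..1} f" .
qed

text \<open>Cauchy's formula on the circle through \<open>w\<close>, with the parameter starting at
  \<open>w\<close>. Writing w = c \<rho> with |c| = 1 and replacing f by u |-> f (c u) turns it into
  a \<open>circlepath\<close> with pole v / c. The normalized arc length is d\<zeta> / (2 pi i
  \<zeta>), which explains the extra factor \<zeta> in the numerator.\<close>

lemma circle_average_cauchy:
  assumes f: "f holomorphic_on ball 0 R" and w: "cmod w < R" and v: "cmod v < cmod w"
  shows "integrable unit_interval
      (\<lambda>\<theta>. f (cis (2 * pi * \<theta>) * w) * (cis (2 * pi * \<theta>) * w) / (cis (2 * pi * \<theta>) * w - v))"
    and "(\<integral>\<theta>. f (cis (2 * pi * \<theta>) * w) * (cis (2 * pi * \<theta>) * w) / (cis (2 * pi * \<theta>) * w - v)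
      \<partial>unit_interval) = f v"
proof -
  define \<rho> where "\<rho> = cmod w"
  define c where "c = w / of_real \<rho>"
  have \<rho>: "0 < \<rho>" using v unfolding \<rho>_def by (meson le_less_trans norm_ge_zero)
  have c: "cmod c = 1" "c * of_real \<rho> = w" "c \<noteq> 0" using \<rho> by (auto simp: c_def \<rho>_def norm_divide)
  define g where "g u = f (c * u)" for u
  have hol: "g holomorphic_on ball 0 R"
    unfolding g_def using c
    by (intro holomorphic_on_compose_gen[of "\<lambda>u. c * u", OF _ f, unfolded o_def] holomorphic_intros)
       (auto simp: norm_mult)
  then have cont: "continuous_on (cball 0 \<rho>) g" "g holomorphic_on ball 0 \<rho>"
    using w by (auto intro!: holomorphic_on_imp_continuous_on elim!: holomorphic_on_subset simp: \<rho>_def)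
  have "((\<lambda>u. g u / (u - v / c)) has_contour_integral (2 * of_real pi * \<i> * g (v / c))) (circlepath 0 \<rho>)"
    using cont v c \<rho> by (intro Cauchy_integral_circlepath) (auto simp: norm_divide \<rho>_def)
  then have "((\<lambda>x. g (circlepath 0 \<rho> x) / (circlepath 0 \<rho> x - v / c)
      * vector_derivative (circlepath 0 \<rho>) (at x within {0..1}))
    has_integral (2 * of_real pi * \<i> * g (v / c))) {0..1}"
    unfolding has_contour_integral_def .
  then have "((\<lambda>x. 2 * of_real pi * \<i> * (f (cis (2 * pi * x) * w) * (cis (2 * pi * x) * w) / (cis (2 * pi * x) * w - v)))
    has_integral (2 * of_real pi * \<i> * g (v / c))) {0..1}"
  proof (rule has_integral_cong[THEN iffD1, rotated])
    fix x :: real assume x: "x \<in> {0..1}"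
    have e: "circlepath 0 \<rho> x = of_real \<rho> * cis (2 * pi * x)"
      by (simp add: circlepath cis_conv_exp mult_ac)
    have vd: "vector_derivative (circlepath 0 \<rho>) (at x within {0..1}) =
        2 * of_real pi * \<i> * (of_real \<rho> * cis (2 * pi * x))"
      using x by (simp add: vector_derivative_circlepath01 cis_conv_exp mult_ac)
    have ne: "cis (2 * pi * x) * w - v \<noteq> 0"
    proof
      assume "cis (2 * pi * x) * w - v = 0"
      then have "cmod (cis (2 * pi * x) * w) = cmod v" by simp
      then show False using v by (simp add: norm_mult)
    qed
    have cw: "c * (of_real \<rho> * cis (2 * pi * x)) = cis (2 * pi * x) * w"
      using c(2) by (metis mult.assoc mult.commute)
    define X where "X = cis (2 * pi * x) * w"
    have X: "of_real \<rho> * cis (2 * pi * x) = X / c" unfolding X_def cw[symmetric] using c(3) by simp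
    have ne': "X - v \<noteq> 0" using ne by (simp add: X_def)
    have "X / c - v / c = (X - v) / c" by (simp add: diff_divide_distrib)
    then have "f X / (X / c - v / c) * (2 * of_real pi * \<i> * (X / c)) = 2 * of_real pi * \<i> * (f X * X / (X - v))"
      using c(3) ne' by simp
    then show "g (circlepath 0 \<rho> x) / (circlepath 0 \<rho> x - v / c)
      * vector_derivative (circlepath 0 \<rho>) (at x within {0..1}) =
      2 * of_real pi * \<i> * (f (cis (2 * pi * x) * w) * (cis (2 * pi * x) * w) / (cis (2 * pi * x) * w - v))"
      unfolding e vd g_def X_def[symmetric] X using c(3) by simp
  qed
  from has_integral_mult_right[OF this, of "1 / (2 * of_real pi * \<i>)"]
  have hi: "((\<lambda>x. f (cis (2 * pi * x) * w) * (cis (2 * pi * x) * w) / (cis (2 * pi * x) * w - v))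
    has_integral f v) {0..1}"
    using c(3) by (simp add: g_def)
  have cont: "continuous_on {0..1} (\<lambda>x. f (cis (2 * pi * x) * w) * (cis (2 * pi * x) * w) / (cis (2 * pi * x) * w - v))"
  proof (intro continuous_intros)
    show "continuous_on {0..1} (\<lambda>x. f (cis (2 * pi * x) * w))"
      using w by (intro continuous_on_compose2[OF holomorphic_on_imp_continuous_on[OF f]] continuous_intros)
         (auto simp: norm_mult)
    show "\<forall>x\<in>{0..1}. cis (2 * pi * x) * w - v \<noteq> 0"
      using v by (metis norm_cis norm_mult mult_1 right_minus_eq less_irrefl)
  qed
  note R = integral_unit_interval_continuous[OF cont]
  show "integrable unit_interval
      (\<lambda>\<theta>. f (cis (2 * pi * \<theta>) * w) * (cis (2 * pi * \<theta>) * w) / (cis (2 * pi * \<theta>) * w - v))"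
    by (rule R)
  show "(\<integral>\<theta>. f (cis (2 * pi * \<theta>) * w) * (cis (2 * pi * \<theta>) * w) / (cis (2 * pi * \<theta>) * w - v)
      \<partial>unit_interval) = f v"
    unfolding R(2) using hi by (rule integral_unique)
qed

lemma circle_mean_norm_le:
  assumes f: "f holomorphic_on ball 0 R" and w: "cmod w < R"
  shows "ennreal (cmod (f 0)) \<le> (\<integral>\<^sup>+\<theta>. ennreal (cmod (f (cis (2 * pi * \<theta>) * w))) \<partial>unit_interval)"
proof (cases "w = 0")
  case True
  then show ?thesis by (simp add: emeasure_unit_interval_space)
next
  case False
  then have v: "cmod 0 < cmod w" by simp
  have eq: "f (cis (2 * pi * \<theta>) * w) * (cis (2 * pi * \<theta>) * w) / (cis (2 * pi * \<theta>) * w - 0) = f (cis (2 * pi * \<theta>) * w)"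
    for \<theta> using False by simp
  note C = circle_average_cauchy[OF f w v, unfolded eq]
  have "ennreal (cmod (f 0)) = ennreal (cmod (\<integral>\<theta>. f (cis (2 * pi * \<theta>) * w) \<partial>unit_interval))"
    by (simp only: C(2))
  also have "\<dots> \<le> ennreal (\<integral>\<theta>. cmod (f (cis (2 * pi * \<theta>) * w)) \<partial>unit_interval)"
    by (intro ennreal_leI integral_norm_bound)
  also have "\<dots> = (\<integral>\<^sup>+\<theta>. ennreal (cmod (f (cis (2 * pi * \<theta>) * w))) \<partial>unit_interval)"
    using C(1) by (intro nn_integral_eq_integral[symmetric]) auto
  finally show ?thesis .
qed

lemma nn_integral_lborel_ball_rescale:
  fixes F :: "complex \<Rightarrow> ennreal"
  assumes F: "(\<lambda>z. F z * indicator (ball a \<rho>) z) \<in> borel_measurable borel" and \<rho>: "0 < \<rho>"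
  shows "(\<integral>\<^sup>+z. F z * indicator (ball a \<rho>) z \<partial>lborel) =
    ennreal (\<rho>\<^sup>2) * (\<integral>\<^sup>+z. F (a + \<rho> *\<^sub>R z) * indicator unit_disk z \<partial>lborel)"
proof -
  note [measurable] = F
  have m: "(\<lambda>z. F (a + \<rho> *\<^sub>R z) * indicator (ball a \<rho>) (a + \<rho> *\<^sub>R z)) \<in> borel_measurable borel"
    by (rule measurable_compose[OF _ F]) measurable
  have "(\<integral>\<^sup>+z. F z * indicator (ball a \<rho>) z \<partial>lborel) =
     (\<integral>\<^sup>+z. F z * indicator (ball a \<rho>) z \<partial>density (distr lborel borel (\<lambda>x. a + \<rho> *\<^sub>R x)) (\<lambda>_. ennreal (\<bar>\<rho>\<bar> ^ DIM(complex))))"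
    using lborel_affine[of \<rho> a] \<rho> by simp
  also have "\<dots> = (\<integral>\<^sup>+z. ennreal (\<bar>\<rho>\<bar> ^ DIM(complex)) * (F (a + \<rho> *\<^sub>R z) * indicator (ball a \<rho>) (a + \<rho> *\<^sub>R z)) \<partial>lborel)"
    using m by (simp add: nn_integral_density nn_integral_distr)
  also have "\<dots> = (\<integral>\<^sup>+z. ennreal (\<rho>\<^sup>2) * (F (a + \<rho> *\<^sub>R z) * indicator (ball a \<rho>) (a + \<rho> *\<^sub>R z)) \<partial>lborel)"
    by simp
  also have "\<dots> = ennreal (\<rho>\<^sup>2) * (\<integral>\<^sup>+z. F (a + \<rho> *\<^sub>R z) * indicator (ball a \<rho>) (a + \<rho> *\<^sub>R z) \<partial>lborel)"
    using m by (intro nn_integral_cmult) simp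
  also have "(\<lambda>z. F (a + \<rho> *\<^sub>R z) * indicator (ball a \<rho>) (a + \<rho> *\<^sub>R z)) = (\<lambda>z. F (a + \<rho> *\<^sub>R z) * indicator unit_disk z)"
    using \<rho> by (auto simp: indicator_def dist_norm)
  finally show ?thesis .
qed

lemma borel_measurable_indicator_continuous:
  fixes F :: "complex \<Rightarrow> real"
  assumes "continuous_on S F" "open S"
  shows "(\<lambda>z. ennreal (F z) * indicator S z) \<in> borel_measurable borel"
proof -
  have "(\<lambda>z. indicator S z *\<^sub>R F z) \<in> borel_measurable borel"
    using assms by (intro borel_measurable_continuous_on_indicator) auto
  then have "(\<lambda>z. ennreal (indicator S z *\<^sub>R F z)) \<in> borel_measurable borel" by measurable
  also have "(\<lambda>z. ennreal (indicator S z *\<^sub>R F z)) = (\<lambda>z. ennreal (F z) * indicator S z)"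
    by (auto simp: indicator_def)
  finally show ?thesis .
qed

lemma area_mean_norm_le:
  assumes g: "g holomorphic_on ball a \<rho>" and \<rho>: "0 < \<rho>"
  shows "ennreal (pi * \<rho>\<^sup>2 * cmod (g a)) \<le> (\<integral>\<^sup>+z. ennreal (cmod (g z)) * indicator (ball a \<rho>) z \<partial>lborel)"
proof -
  define G where "G w = g (a + \<rho> *\<^sub>R w)" for w
  have G: "G holomorphic_on ball 0 1"
    unfolding G_def scaleR_conv_of_real using \<rho>
    by (intro holomorphic_on_compose_gen[of "\<lambda>w. a + of_real \<rho> * w", OF _ g, unfolded o_def] holomorphic_intros)
       (auto simp: dist_norm norm_mult)
  have cG: "continuous_on unit_disk (\<lambda>w. cmod (G w))"
    using G by (intro continuous_intros holomorphic_on_imp_continuous_on)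
  have m: "(\<lambda>w. ennreal (cmod (G w))) \<in> borel_measurable disk_borel"
    using borel_measurable_indicator_continuous[OF cG]
    by (subst borel_measurable_restrict_space_iff_ennreal) auto
  have "ennreal (cmod (G 0)) = (\<integral>\<^sup>+w. ennreal (cmod (G 0)) \<partial>disk_area)"
    by (simp add: emeasure_disk_area_space)
  also have "\<dots> \<le> (\<integral>\<^sup>+w. (\<integral>\<^sup>+\<theta>. ennreal (cmod (G (cis (2 * pi * \<theta>) * w))) \<partial>unit_interval) \<partial>disk_area)"
    by (intro nn_integral_mono circle_mean_norm_le[OF G]) auto
  also have "\<dots> = (\<integral>\<^sup>+w. ennreal (cmod (G w)) \<partial>disk_area)"
    by (rule nn_integral_disk_area_average[OF m, symmetric])
  also have "\<dots> = ennreal (1 / pi) * (\<integral>\<^sup>+z. ennreal (cmod (G z)) * indicator unit_disk z \<partial>lborel)"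
    by (rule nn_integral_disk_area[OF m])
  finally have "ennreal (pi * \<rho>\<^sup>2) * ennreal (cmod (G 0)) \<le>
      ennreal (pi * \<rho>\<^sup>2) * (ennreal (1 / pi) * (\<integral>\<^sup>+z. ennreal (cmod (G z)) * indicator unit_disk z \<partial>lborel))"
    by (intro mult_left_mono) auto
  also have "\<dots> = ennreal (\<rho>\<^sup>2) * (\<integral>\<^sup>+z. ennreal (cmod (G z)) * indicator unit_disk z \<partial>lborel)"
    unfolding mult.assoc[symmetric] by (subst ennreal_mult[symmetric]) auto
  also have "\<dots> = (\<integral>\<^sup>+z. ennreal (cmod (g z)) * indicator (ball a \<rho>) z \<partial>lborel)"
    unfolding G_def using g \<rho>
    by (intro nn_integral_lborel_ball_rescale[symmetric] borel_measurable_indicator_continuous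
        continuous_intros holomorphic_on_imp_continuous_on) auto
  finally show ?thesis by (simp add: ennreal_mult[symmetric] G_def)
qed

text \<open>One factor 4 comes from halving the radius of the ball, another from the ball of half
  the available radius around the maximum point, and 1/pi from the area mean.
  \<open>2 powr (2 / p)\<close> bounds |g| on that ball relative to its value at the centre; it
  enters with the power 1 - p.\<close>

definition submean_const :: "real \<Rightarrow> real" where
  "submean_const p = 16 / pi * (2 powr (2 / p)) powr (1 - p)"

text \<open>For \<open>p < 1\<close> the inequality is reduced to the case \<open>p = 1\<close> by moving to the point \<open>z\<close> where
  \<open>(\<rho>/2 - |z - a|)\<^bsup>2/p\<^esup> |g z|\<close> is maximal: near it \<open>|g|\<close> is at most a constant
  times \<open>|g z|\<close>.\<close>

lemma powr_norm_submean:
  assumes g: "g holomorphic_on ball a \<rho>" and \<rho>: "0 < \<rho>" and p: "0 < p" "p \<le> 1"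
  shows "ennreal (\<rho>\<^sup>2 * cmod (g a) powr p) \<le>
    ennreal (submean_const p) * (\<integral>\<^sup>+z. ennreal (cmod (g z) powr p) * indicator (ball a \<rho>) z \<partial>lborel)"
proof (cases "g a = 0")
  case False
  define \<sigma> where "\<sigma> = \<rho> / 2"
  have \<sigma>: "0 < \<sigma>" "\<sigma> < \<rho>" using \<rho> by (auto simp: \<sigma>_def)
  \<comment> \<open>The exponent 2/p makes S^p equal to (\<sigma> - |z - a|)^2 |g|^p, which scales
    like the left-hand side of the claim. The closed ball of radius \<sigma> = \<rho>/2 is compact
    and g is continuous on it, so the maximum exists; S vanishes on its boundary, so the maximum is
    interior.\<close>
  define S where "S z = (\<sigma> - dist a z) powr (2 / p) * cmod (g z)" for z
  have cg: "continuous_on (ball a \<rho>) g" using g by (rule holomorphic_on_imp_continuous_on)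
  have cS: "continuous_on (cball a \<sigma>) S"
    unfolding S_def using \<sigma> p
    by (intro continuous_intros continuous_on_powr' continuous_on_subset[OF cg]) auto
  obtain z where z: "z \<in> cball a \<sigma>" and max: "\<And>y. y \<in> cball a \<sigma> \<Longrightarrow> S y \<le> S z"
    using continuous_attains_sup[OF _ _ cS] \<sigma> by auto
  have Sa: "0 < S a" using False \<sigma> by (simp add: S_def)
  have Sz: "S a \<le> S z" using \<sigma> by (intro max) auto
  define d where "d = \<sigma> - dist a z"
  have d0: "0 \<le> d" using z by (simp add: d_def)
  have d: "0 < d"
  proof (rule ccontr)
    assume "\<not> 0 < d"
    then have "d = 0" using d0 by simp
    then have "S z = 0" by (simp add: S_def d_def[symmetric])
    then show False using Sa Sz by simp
  qed
  have gz: "0 < cmod (g z)"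
  proof (rule ccontr)
    assume "\<not> 0 < cmod (g z)"
    then have "S z = 0" by (simp add: S_def)
    then show False using Sa Sz by simp
  qed
  have sub: "ball z (d / 2) \<subseteq> ball a \<rho>"
  proof
    fix w assume "w \<in> ball z (d / 2)"
    then have "dist a w < dist a z + d" using dist_triangle[of a w z] d by simp
    then show "w \<in> ball a \<rho>" using \<sigma> by (simp add: d_def)
  qed
  define K where "K = 2 powr (2 / p)"
  have K: "0 < K" by (simp add: K_def)
  have bound: "cmod (g w) \<le> K * cmod (g z)" if w: "w \<in> ball z (d / 2)" for w
  proof -
    have "dist a w \<le> dist a z + dist z w" by (rule dist_triangle)
    then have dw: "d / 2 \<le> \<sigma> - dist a w" using w by (simp add: d_def field_simps)
    then have "S w \<le> S z" using d by (intro max) auto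
    moreover have "(d / 2) powr (2 / p) * cmod (g w) \<le> S w"
      unfolding S_def using dw d p by (intro mult_right_mono powr_mono2) auto
    ultimately have "(d / 2) powr (2 / p) * cmod (g w) \<le> d powr (2 / p) * cmod (g z)"
      by (simp add: S_def d_def)
    moreover have "d powr (2 / p) = (d / 2) powr (2 / p) * K"
      using d by (simp add: K_def powr_divide)
    ultimately have "(d / 2) powr (2 / p) * cmod (g w) \<le> (d / 2) powr (2 / p) * (K * cmod (g z))"
      by (simp add: mult.assoc)
    then show ?thesis using d by (subst (asm) mult_le_cancel_left_pos) auto
  qed
  define I where "I = (\<integral>\<^sup>+w. ennreal (cmod (g w) powr p) * indicator (ball a \<rho>) w \<partial>lborel)"
  \<comment> \<open>One writes |g| = |g|^(1-p) |g|^p and bounds only the first factor, using 1 - p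
    >= 0.\<close>
  have pw: "cmod (g w) \<le> (K * cmod (g z)) powr (1 - p) * cmod (g w) powr p" if w: "w \<in> ball z (d / 2)" for w
  proof (cases "g w = 0")
    case False
    then have "cmod (g w) = cmod (g w) powr (1 - p) * cmod (g w) powr p"
      by (simp add: powr_add[symmetric])
    also have "\<dots> \<le> (K * cmod (g z)) powr (1 - p) * cmod (g w) powr p"
      using bound[OF w] p by (intro mult_right_mono powr_mono2) auto
    finally show ?thesis .
  qed auto
  have mI: "(\<lambda>w. ennreal (cmod (g w) powr p) * indicator (ball a \<rho>) w) \<in> borel_measurable borel"
    using p by (intro borel_measurable_indicator_continuous continuous_on_powr' continuous_intros cg) auto
  have "ennreal (pi * (d / 2)\<^sup>2 * cmod (g z)) \<le> (\<integral>\<^sup>+w. ennreal (cmod (g w)) * indicator (ball z (d / 2)) w \<partial>lborel)"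
    using d by (intro area_mean_norm_le holomorphic_on_subset[OF g sub]) auto
  also have "\<dots> \<le> (\<integral>\<^sup>+w. ennreal ((K * cmod (g z)) powr (1 - p)) *
        (ennreal (cmod (g w) powr p) * indicator (ball a \<rho>) w) \<partial>lborel)"
  proof (rule nn_integral_mono)
    fix w
    show "ennreal (cmod (g w)) * indicator (ball z (d / 2)) w \<le> ennreal ((K * cmod (g z)) powr (1 - p)) *
        (ennreal (cmod (g w) powr p) * indicator (ball a \<rho>) w)"
    proof (cases "w \<in> ball z (d / 2)")
      case True
      then show ?thesis using pw[OF True] subsetD[OF sub True]
        by (simp add: ennreal_mult[symmetric] ennreal_leI)
    qed simp
  qed
  also have "\<dots> = ennreal ((K * cmod (g z)) powr (1 - p)) * I"
    unfolding I_def using mI by (intro nn_integral_cmult) simp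
  finally have 1: "ennreal (pi * (d / 2)\<^sup>2 * cmod (g z)) \<le> ennreal ((K * cmod (g z)) powr (1 - p)) * I" .
  define B where "B = cmod (g z)"
  have B: "0 < B" using gz by (simp add: B_def)
  \<comment> \<open>\<open>B powr (1 - p)\<close> is isolated on both sides in order to cancel it,
    which leaves the p-th power of |g z| alone.\<close>
  have split: "pi * (d / 2)\<^sup>2 * B = B powr (1 - p) * (pi * (d / 2)\<^sup>2 * B powr p)"
  proof -
    have "B powr (1 - p) * B powr p = B" using B by (simp add: powr_add[symmetric])
    then show ?thesis by (metis mult.left_commute mult.commute)
  qed
  have "ennreal (B powr (1 - p)) * ennreal (pi * (d / 2)\<^sup>2 * B powr p) \<le>
      ennreal (B powr (1 - p)) * (ennreal (K powr (1 - p)) * I)"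
  proof -
    have "ennreal (pi * (d / 2)\<^sup>2 * B) = ennreal (B powr (1 - p)) * ennreal (pi * (d / 2)\<^sup>2 * B powr p)"
      by (subst split, rule ennreal_mult) auto
    moreover have "ennreal ((K * B) powr (1 - p)) = ennreal (B powr (1 - p)) * ennreal (K powr (1 - p))"
      using B K by (simp add: powr_mult ennreal_mult mult.commute)
    ultimately show ?thesis using 1 by (simp only: B_def[symmetric] mult.assoc)
  qed
  then have 2: "ennreal (pi * (d / 2)\<^sup>2 * B powr p) \<le> ennreal (K powr (1 - p)) * I"
    using B by (subst (asm) ennreal_mult_le_mult_iff) auto
  have "\<rho>\<^sup>2 * cmod (g a) powr p = 4 * (\<sigma>\<^sup>2 * cmod (g a) powr p)" by (simp add: \<sigma>_def power_divide)
  also have "\<sigma>\<^sup>2 * cmod (g a) powr p = S a powr p"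
    using \<sigma> p by (simp add: S_def powr_mult powr_powr powr_numeral)
  also have "S a powr p \<le> S z powr p" using Sa Sz p by (intro powr_mono2) auto
  also have "S z powr p = d\<^sup>2 * B powr p"
    using d p by (simp add: S_def B_def d_def[symmetric] powr_mult powr_powr powr_numeral)
  also have "4 * (d\<^sup>2 * B powr p) = 16 / pi * (pi * (d / 2)\<^sup>2 * B powr p)"
    by (simp add: power_divide)
  finally have "ennreal (\<rho>\<^sup>2 * cmod (g a) powr p) \<le> ennreal (16 / pi) * ennreal (pi * (d / 2)\<^sup>2 * B powr p)"
    by (subst ennreal_mult[symmetric]) (auto intro: ennreal_leI)
  also have "\<dots> \<le> ennreal (16 / pi) * (ennreal (K powr (1 - p)) * I)"
    by (intro mult_left_mono 2) auto
  also have "\<dots> = ennreal (submean_const p) * I"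
    unfolding mult.assoc[symmetric] by (subst ennreal_mult[symmetric]) (auto simp: submean_const_def K_def)
  finally show ?thesis by (simp add: I_def)
qed simp

section \<open>Local estimates for weighted holomorphic functions\<close>

lemma measurable_disk_continuous:
  fixes F :: "complex \<Rightarrow> 'a::real_normed_vector"
  assumes "continuous_on unit_disk F"
  shows "F \<in> borel_measurable disk_borel"
  using assms by (rule borel_measurable_continuous_on_restrict)

text \<open>The weight is not holomorphic, but on the ball of radius d/3 around \<open>w\<close>, d
  = 1 - |w|, its value at \<open>w\<close> is at most 3^k times its value at any point. Freezing it
  at the centre keeps the function holomorphic, and the sub-mean value inequality applies.\<close>

lemma weighted_holomorphic_local:
  fixes g :: "complex \<Rightarrow> complex" and k :: nat
  assumes g: "g holomorphic_on unit_disk" and p: "0 < p" "p \<le> 1"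
  defines "G \<equiv> \<lambda>w. (1 - (cmod w)\<^sup>2) ^ k * cmod (g w)"
  shows "\<exists>c\<ge>0. \<forall>w\<in>unit_disk. ennreal (G w powr p) \<le>
    ennreal c * (\<integral>\<^sup>+v. ennreal (G v powr p) * indicator (nbhd (1/2) w) v \<partial>mobius_measure)"
proof (intro exI conjI ballI)
  \<comment> \<open>Here 3^k is the loss from freezing the weight, pi undoes the normalization of
    the area, and 64 = 8^2 comes from 1 - |v|^2 <= 2 (d + \<rho>) = 8 \<rho> in the density of
    \<lambda>.\<close>
  define c where "c = 64 * pi * submean_const p * (3 ^ k) powr p"
  show c0: "0 \<le> c" by (simp add: c_def submean_const_def)
  have cG: "continuous_on unit_disk G"
    unfolding G_def using holomorphic_on_imp_continuous_on[OF g] by (intro continuous_intros)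
  have Gm [measurable]: "G \<in> borel_measurable disk_borel" by (rule measurable_disk_continuous[OF cG])
  fix w assume w: "w \<in> unit_disk"
  define d where "d = 1 - cmod w"
  have d: "0 < d" using w by (simp add: d_def)
  define \<rho> where "\<rho> = (1/2) / (1 + 1/2) * d"
  have \<rho>: "0 < \<rho>" "\<rho> = d / 3" using d by (auto simp: \<rho>_def)
  have sub: "ball w \<rho> \<subseteq> nbhd (1/2) w"
    unfolding \<rho>_def d_def by (rule ball_subset_nbhd[OF w]) simp
  have subd: "nbhd (1/2) w \<subseteq> unit_disk" by (auto simp: nbhd_def)
  define m where "m = (1 - (cmod w)\<^sup>2) ^ k"
  have m: "0 \<le> m" using one_minus_norm_square_pos[OF w] by (simp add: m_def)
  have mg: "(\<lambda>v. of_real m * g v) holomorphic_on ball w \<rho>"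
    by (intro holomorphic_intros holomorphic_on_subset[OF g]) (use sub subd in auto)
  have nm: "cmod (of_real m * g v) = m * cmod (g v)" for v using m by (simp add: norm_mult)
  have cmp: "m * cmod (g v) \<le> 3 ^ k * G v" if v: "v \<in> ball w \<rho>" for v
  proof -
    have vd: "v \<in> unit_disk" using v sub subd by blast
    have "d \<le> 1 - cmod v + \<rho>" using v norm_diff_le_dist(1)[of v w] by (simp add: d_def)
    then have "2 * d \<le> 3 * (1 - cmod v)" by (simp add: \<rho>(2))
    then have "1 - (cmod w)\<^sup>2 \<le> 3 * (1 - (cmod v)\<^sup>2)"
      using one_minus_norm_square_bounds(2)[OF w] one_minus_norm_square_bounds(1)[OF vd] by (simp add: d_def)
    then have "m \<le> (3 * (1 - (cmod v)\<^sup>2)) ^ k"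
      unfolding m_def using one_minus_norm_square_pos[OF w] by (intro power_mono) auto
    then have "m * cmod (g v) \<le> (3 * (1 - (cmod v)\<^sup>2)) ^ k * cmod (g v)" by (rule mult_right_mono) simp
    then show ?thesis unfolding G_def power_mult_distrib by (simp only: mult.assoc)
  qed
  have dens: "1 / (64 * \<rho>\<^sup>2) \<le> 1 / (1 - (cmod v)\<^sup>2)\<^sup>2" if v: "v \<in> ball w \<rho>" for v
  proof -
    have vd: "v \<in> unit_disk" using v sub subd by blast
    have "1 - cmod v \<le> d + \<rho>" using v norm_diff_le_dist(2)[of w v] by (simp add: d_def)
    then have "1 - (cmod v)\<^sup>2 \<le> 8 * \<rho>"
      using one_minus_norm_square_bounds(2)[OF vd] by (simp add: \<rho>(2))
    then have "(1 - (cmod v)\<^sup>2)\<^sup>2 \<le> (8 * \<rho>)\<^sup>2"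
      using one_minus_norm_square_pos[OF vd] by (intro power_mono) auto
    then have "(1 - (cmod v)\<^sup>2)\<^sup>2 \<le> 64 * \<rho>\<^sup>2" by (simp add: power_mult_distrib)
    then show ?thesis using one_minus_norm_square_pos[OF vd] by (simp add: frac_le)
  qed
  let ?L = "\<integral>\<^sup>+v. ennreal (cmod (of_real m * g v) powr p) * indicator (ball w \<rho>) v \<partial>lborel"
  let ?R = "\<integral>\<^sup>+v. ennreal (G v powr p) * indicator (nbhd (1/2) w) v \<partial>mobius_measure"
  have LR: "?L \<le> ennreal (64 * \<rho>\<^sup>2 * pi * (3 ^ k) powr p) * ?R"
  proof -
    define F where "F v = ennreal (1 / (1 - (cmod v)\<^sup>2)\<^sup>2) * (ennreal (G v powr p) * indicator (nbhd (1/2) w) v)" for v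
    have Fm: "F \<in> borel_measurable disk_borel" unfolding F_def by measurable
    have RF: "?R = ennreal (1 / pi) * (\<integral>\<^sup>+v. F v * indicator unit_disk v \<partial>lborel)"
      by (subst nn_integral_mobius, measurable) (simp add: F_def[symmetric] nn_integral_disk_area[OF Fm])
    have "?L \<le> (\<integral>\<^sup>+v. ennreal (64 * \<rho>\<^sup>2 * (3 ^ k) powr p) * (F v * indicator unit_disk v) \<partial>lborel)"
    proof (rule nn_integral_mono)
      fix v
      show "ennreal (cmod (of_real m * g v) powr p) * indicator (ball w \<rho>) v \<le>
          ennreal (64 * \<rho>\<^sup>2 * (3 ^ k) powr p) * (F v * indicator unit_disk v)"
      proof (cases "v \<in> ball w \<rho>")
        case True
        then have vn: "v \<in> nbhd (1/2) w" "v \<in> unit_disk" using sub subd by blast+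
        have G0: "0 \<le> G v" using one_minus_norm_square_pos[OF vn(2)] by (simp add: G_def)
        have "cmod (of_real m * g v) powr p \<le> (3 ^ k * G v) powr p"
          unfolding nm using cmp[OF True] m p by (intro powr_mono2) auto
        also have "\<dots> = (3 ^ k) powr p * G v powr p" using G0 by (simp add: powr_mult)
        also have "\<dots> = 64 * \<rho>\<^sup>2 * (1 / (64 * \<rho>\<^sup>2)) * ((3 ^ k) powr p * G v powr p)"
          using \<rho> by simp
        also have "\<dots> \<le> 64 * \<rho>\<^sup>2 * (1 / (1 - (cmod v)\<^sup>2)\<^sup>2) * ((3 ^ k) powr p * G v powr p)"
          using dens[OF True] by (intro mult_right_mono mult_left_mono) auto
        finally have "ennreal (cmod (of_real m * g v) powr p) \<le>
           ennreal (64 * \<rho>\<^sup>2 * (1 / (1 - (cmod v)\<^sup>2)\<^sup>2) * ((3 ^ k) powr p * G v powr p))"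
          by (rule ennreal_leI)
        also have "\<dots> = ennreal ((64 * \<rho>\<^sup>2 * (3 ^ k) powr p) * ((1 / (1 - (cmod v)\<^sup>2)\<^sup>2) * G v powr p))"
          by (simp add: mult_ac)
        also have "\<dots> = ennreal (64 * \<rho>\<^sup>2 * (3 ^ k) powr p) * (ennreal (1 / (1 - (cmod v)\<^sup>2)\<^sup>2) * ennreal (G v powr p))"
          by (subst ennreal_mult, simp, simp, subst (2) ennreal_mult, simp, simp, rule refl)
        also have "\<dots> = ennreal (64 * \<rho>\<^sup>2 * (3 ^ k) powr p) * (F v * indicator unit_disk v)"
          using vn by (simp add: F_def del: ennreal_mult)
        finally show ?thesis using True by simp
      qed simp
    qed
    also have "\<dots> = ennreal (64 * \<rho>\<^sup>2 * (3 ^ k) powr p) * (\<integral>\<^sup>+v. F v * indicator unit_disk v \<partial>lborel)"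
      using borel_measurable_indicator_disk[OF Fm] by (intro nn_integral_cmult) simp
    also have "\<dots> = ennreal (64 * \<rho>\<^sup>2 * pi * (3 ^ k) powr p) * ?R"
    proof -
      have "ennreal (64 * \<rho>\<^sup>2 * pi * (3 ^ k) powr p) * ennreal (1 / pi) = ennreal (64 * \<rho>\<^sup>2 * (3 ^ k) powr p)"
        by (subst ennreal_mult[symmetric]) auto
      then show ?thesis unfolding RF mult.assoc[symmetric] by simp
    qed
    finally show ?thesis .
  qed
  have "ennreal (\<rho>\<^sup>2) * ennreal (G w powr p) = ennreal (\<rho>\<^sup>2 * cmod (of_real m * g w) powr p)"
    unfolding nm by (simp add: ennreal_mult G_def m_def)
  also have "\<dots> \<le> ennreal (submean_const p) * ?L"
    by (rule powr_norm_submean[OF mg \<rho>(1) p])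
  also have "\<dots> \<le> ennreal (submean_const p) * (ennreal (64 * \<rho>\<^sup>2 * pi * (3 ^ k) powr p) * ?R)"
    by (intro mult_left_mono LR) auto
  also have "\<dots> = ennreal (submean_const p * (64 * \<rho>\<^sup>2 * pi * (3 ^ k) powr p)) * ?R"
  proof -
    have "0 \<le> submean_const p" "0 \<le> 64 * \<rho>\<^sup>2 * pi * (3 ^ k) powr p" by (auto simp: submean_const_def)
    then show ?thesis by (simp only: ennreal_mult mult.assoc)
  qed
  also have "submean_const p * (64 * \<rho>\<^sup>2 * pi * (3 ^ k) powr p) = \<rho>\<^sup>2 * c"
    by (simp add: c_def)
  also have "ennreal (\<rho>\<^sup>2 * c) * ?R = ennreal (\<rho>\<^sup>2) * (ennreal c * ?R)"
    using c0 by (simp add: ennreal_mult mult.assoc)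
  finally show "ennreal (G w powr p) \<le> ennreal c * ?R"
    using \<rho>(1) by (subst (asm) ennreal_mult_le_mult_iff) auto
qed

lemma sets_pseudohyperbolic_disk [measurable]:
  assumes z: "z \<in> unit_disk" shows "pseudohyperbolic_disk z r \<in> sets disk_borel"
proof (rule sets_disk_borelI)
  have "pseudohyperbolic_disk z r = {w \<in> unit_disk. cmod (z - w) < r * cmod (1 - z * cnj w)}"
    using norm_one_minus_mult_cnj_pos(2)[OF z]
    by (auto simp: pseudohyperbolic_disk_def norm_divide divide_less_eq)
  moreover have "open (unit_disk \<inter> {w. cmod (z - w) < r * cmod (1 - z * cnj w)})"
    by (intro open_Int open_Collect_less continuous_intros) auto
  moreover have "{w \<in> unit_disk. cmod (z - w) < r * cmod (1 - z * cnj w)} =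
      unit_disk \<inter> {w. cmod (z - w) < r * cmod (1 - z * cnj w)}" by auto
  ultimately show "pseudohyperbolic_disk z r \<in> sets borel" by auto
qed (auto simp: pseudohyperbolic_disk_def)

lemma measurable_indicator_pseudohyperbolic_pair:
  "(\<lambda>x. indicator (pseudohyperbolic_disk (fst x) r) (snd x) :: ennreal)
    \<in> borel_measurable (disk_borel \<Otimes>\<^sub>M disk_borel)"
proof -
  have [measurable]: "snd \<in> borel_measurable (disk_borel \<Otimes>\<^sub>M disk_borel)"
      "fst \<in> borel_measurable (disk_borel \<Otimes>\<^sub>M disk_borel)"
    by (rule measurable_compose[OF measurable_snd measurable_ident_disk]
         measurable_compose[OF measurable_fst measurable_ident_disk])+
  have c: "cnj \<in> borel_measurable borel" by (intro borel_measurable_continuous_onI continuous_intros)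
  have [measurable]: "(\<lambda>x. cnj (snd x)) \<in> borel_measurable (disk_borel \<Otimes>\<^sub>M disk_borel)"
    by (rule measurable_compose[OF _ c]) measurable
  have "(\<lambda>x. indicator {x \<in> space (disk_borel \<Otimes>\<^sub>M disk_borel).
      cmod ((fst x - snd x) / (1 - fst x * cnj (snd x))) < r} x :: ennreal)
      \<in> borel_measurable (disk_borel \<Otimes>\<^sub>M disk_borel)"
    by measurable
  then show ?thesis
    by (rule measurable_cong[THEN iffD1, rotated])
       (auto simp: indicator_def pseudohyperbolic_disk_def space_pair_measure)
qed

text \<open>On \<open>nbhd C z\<close> the local estimate bounds every value of G by the 1/p-th
  power of one average of G^p over a larger neighbourhood of \<open>z\<close>. The localized
  integral is then at most a constant times this power, its p-th power at most a constant times the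
  average, and averages integrate by Fubini.\<close>

lemma nn_integral_nbhd_powr_le:
  fixes G :: "complex \<Rightarrow> real"
  assumes Gm [measurable]: "G \<in> borel_measurable disk_borel" and p: "0 < p" "p \<le> 1"
    and G0: "\<And>w. w \<in> unit_disk \<Longrightarrow> 0 \<le> G w" and c: "0 \<le> c"
    and loc: "\<And>w. w \<in> unit_disk \<Longrightarrow> ennreal (G w powr p) \<le>
      ennreal c * (\<integral>\<^sup>+v. ennreal (G v powr p) * indicator (nbhd (1/2) w) v \<partial>mobius_measure)"
    and fin: "(\<integral>\<^sup>+v. ennreal (G v powr p) \<partial>mobius_measure) < \<infinity>"
    and C: "0 < C"
  shows "(\<integral>\<^sup>+z. ennreal (enn2real (\<integral>\<^sup>+w. ennreal (G w) * indicator (nbhd C z) w \<partial>mobius_measure) powr p)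
    \<partial>mobius_measure) < \<infinity>"
proof -
  \<comment> \<open>A neighbourhood of size 1/2 of a point of \<open>nbhd C z\<close> must fit;
    \<open>nbhd_trans\<close> asks for C + 1/2 + C/2, which is at most 2 C + 1.\<close>
  define C' where "C' = C + 1 + C"
  have C': "0 < C'" using C by (simp add: C'_def)
  define I where "I = (\<integral>\<^sup>+v. ennreal (G v powr p) \<partial>mobius_measure)"
  define T where "T z = (\<integral>\<^sup>+v. ennreal (G v powr p) * indicator (nbhd C' z) v \<partial>mobius_measure)" for z
  define H where "H z = (\<integral>\<^sup>+w. ennreal (G w) * indicator (nbhd C z) w \<partial>mobius_measure)" for z
  have up: "0 \<le> nbhd_upper C" by (simp add: nbhd_upper_def)
  have TI: "T z \<le> I" for z unfolding T_def I_def by (intro nn_integral_mono) (auto simp: indicator_def)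
  have HT: "ennreal (enn2real (H z) powr p) \<le> ennreal (nbhd_upper C powr p * c) * T z" if z: "z \<in> unit_disk" for z
  proof -
    obtain t where t: "T z = ennreal t" "0 \<le> t"
      using TI[of z] fin unfolding I_def[symmetric] by (cases "T z") (auto simp: top_unique)
    have Gb: "G w \<le> (c * t) powr (1 / p)" if w: "w \<in> nbhd C z" for w
    proof -
      have wd: "w \<in> unit_disk" using w by (simp add: nbhd_def)
      have "ennreal (G w powr p) \<le> ennreal c * (\<integral>\<^sup>+v. ennreal (G v powr p) * indicator (nbhd (1/2) w) v \<partial>mobius_measure)"
        by (rule loc[OF wd])
      also have "\<dots> \<le> ennreal c * T z"
        unfolding T_def
      proof (rule mult_left_mono[OF nn_integral_mono])
        fix v
        have "v \<in> nbhd C' z" if "v \<in> nbhd (1/2) w"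
          by (rule nbhd_trans[OF w that]) (use C in \<open>auto simp: C'_def\<close>)
        then show "ennreal (G v powr p) * indicator (nbhd (1/2) w) v \<le> ennreal (G v powr p) * indicator (nbhd C' z) v"
          by (auto simp: indicator_def)
      qed simp
      also have "\<dots> = ennreal (c * t)" using c t by (simp add: ennreal_mult)
      finally have "G w powr p \<le> c * t" using c t by simp
      then have "(G w powr p) powr (1 / p) \<le> (c * t) powr (1 / p)" using p by (intro powr_mono2) auto
      then show ?thesis using G0[OF wd] p by (simp add: powr_powr)
    qed
    have "H z \<le> (\<integral>\<^sup>+w. ennreal ((c * t) powr (1 / p)) * indicator (nbhd C z) w \<partial>mobius_measure)"
      unfolding H_def using Gb by (intro nn_integral_mono) (auto simp: indicator_def intro!: ennreal_leI)
    also have "\<dots> = ennreal ((c * t) powr (1 / p)) * emeasure mobius_measure (nbhd C z)"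
      by (rule nn_integral_cmult_indicator) (simp add: sets_mobius_measure)
    also have "\<dots> \<le> ennreal ((c * t) powr (1 / p)) * ennreal (nbhd_upper C)"
      by (intro mult_left_mono emeasure_mobius_nbhd_le z C) auto
    also have "\<dots> = ennreal (nbhd_upper C * (c * t) powr (1 / p))" using up by (simp add: ennreal_mult mult.commute)
    finally have "enn2real (H z) \<le> nbhd_upper C * (c * t) powr (1 / p)"
      using up by (simp add: enn2real_leI)
    then have "enn2real (H z) powr p \<le> (nbhd_upper C * (c * t) powr (1 / p)) powr p"
      using p by (intro powr_mono2) auto
    also have "\<dots> = nbhd_upper C powr p * (c * t)"
      using up c t p by (simp add: powr_mult powr_powr)
    finally have "ennreal (enn2real (H z) powr p) \<le> ennreal ((nbhd_upper C powr p * c) * t)"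
      by (intro ennreal_leI) (simp add: mult.assoc)
    then show ?thesis using c t by (simp add: ennreal_mult)
  qed
  have Tm: "T \<in> borel_measurable mobius_measure"
  proof -
    interpret sigma_finite_measure mobius_measure by (rule sigma_finite_mobius)
    show ?thesis unfolding T_def
      by (rule borel_measurable_nn_integral) (unfold case_prod_beta', measurable)
  qed
  have "(\<integral>\<^sup>+z. ennreal (enn2real (H z) powr p) \<partial>mobius_measure) \<le>
     (\<integral>\<^sup>+z. ennreal (nbhd_upper C powr p * c) * T z \<partial>mobius_measure)"
    by (intro nn_integral_mono HT) simp
  also have "\<dots> = ennreal (nbhd_upper C powr p * c) * (\<integral>\<^sup>+z. T z \<partial>mobius_measure)"
    by (rule nn_integral_cmult[OF Tm])
  also have "\<dots> \<le> ennreal (nbhd_upper C powr p * c) * (ennreal (nbhd_upper C') * I)"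
    unfolding T_def I_def by (intro mult_left_mono nn_integral_nbhd_swap_le C') auto
  also have "\<dots> < \<infinity>" using fin by (auto simp: I_def ennreal_mult_less_top)
  finally show ?thesis unfolding H_def .
qed

section \<open>The Forelli-Rudin estimate\<close>

text \<open>The Maclaurin expansion of order 4 gives 1 - cos x >= x^2/2 - x^4/24. On the interval
  x^2 <= pi^2 <= 10, and 1/2 - 10/24 = 1/12.\<close>

lemma one_minus_cos_ge:
  assumes "\<bar>x\<bar> \<le> pi" shows "x\<^sup>2 / 12 \<le> 1 - cos x"
proof -
  obtain t where t: "cos x = (\<Sum>m<4. cos_coeff m * x ^ m) + cos (t + 1/2 * real 4 * pi) / fact 4 * x ^ 4"
    using Maclaurin_cos_expansion[of x 4] by blast
  have f: "fact 4 = (24::real)" by (simp add: fact_numeral)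
  have "cos x = 1 - x\<^sup>2 / 2 + cos (t + 1/2 * real 4 * pi) / 24 * x ^ 4"
  proof -
    have "{..<4} = {0, 1, 2, 3 :: nat}" by auto
    then show ?thesis unfolding t f by (simp add: cos_coeff_def fact_numeral)
  qed
  also have "cos (t + 1/2 * real 4 * pi) / 24 * x ^ 4 \<le> 1 / 24 * x ^ 4"
    by (intro mult_right_mono) auto
  also have "x ^ 4 = x\<^sup>2 * x\<^sup>2" by (simp add: power_numeral_reduce)
  finally have 1: "cos x \<le> 1 - x\<^sup>2 / 2 + x\<^sup>2 * x\<^sup>2 / 24" by simp
  have "x\<^sup>2 \<le> pi\<^sup>2" using assms by (metis abs_le_square_iff abs_of_pos pi_gt_zero)
  also have "\<dots> \<le> 3.15\<^sup>2" using pi_approx by (intro power_mono) auto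
  also have "\<dots> \<le> 10" by (simp add: power2_eq_square)
  finally have "x\<^sup>2 * x\<^sup>2 \<le> 10 * x\<^sup>2" by (intro mult_right_mono) auto
  then show ?thesis using 1 by simp
qed

text \<open>The distance is at least 1 - \<rho>, and moving \<rho> \<open>cis x\<close> radially to
  the unit circle changes it by 1 - \<rho> at most. So it is at least half the chord |1 - cis x|,
  which is at least |x|/3.\<close>

lemma norm_one_minus_rcis_ge:
  assumes "0 \<le> \<rho>" "\<rho> < 1" "\<bar>x\<bar> \<le> pi"
  shows "max (1 - \<rho>) \<bar>x\<bar> / 6 \<le> cmod (1 - of_real \<rho> * cis x)"
proof -
  have 1: "1 - \<rho> \<le> cmod (1 - of_real \<rho> * cis x)"
    using norm_triangle_ineq2[of 1 "of_real \<rho> * cis x"] assms by (simp add: norm_mult)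
  have "cmod (1 - cis x) \<le> cmod (1 - of_real \<rho> * cis x) + cmod (of_real (\<rho> - 1) * cis x)"
    using norm_triangle_ineq[of "1 - of_real \<rho> * cis x" "of_real (\<rho> - 1) * cis x"]
    by (simp add: algebra_simps)
  also have "cmod (of_real (\<rho> - 1) * cis x) = 1 - \<rho>" using assms by (simp add: norm_mult del: of_real_diff)
  finally have 2: "cmod (1 - cis x) \<le> 2 * cmod (1 - of_real \<rho> * cis x)" using 1 by simp
  have "(cmod (1 - cis x))\<^sup>2 = (1 - cos x)\<^sup>2 + (sin x)\<^sup>2" by (simp add: cmod_power2)
  also have "\<dots> = 1 - 2 * cos x + ((sin x)\<^sup>2 + (cos x)\<^sup>2)" by (simp add: power2_eq_square algebra_simps)
  finally have e: "(cmod (1 - cis x))\<^sup>2 = 2 * (1 - cos x)" by simp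
  have "x\<^sup>2 / 9 \<le> 2 * (x\<^sup>2 / 12)" by simp
  also have "\<dots> \<le> 2 * (1 - cos x)" by (intro mult_left_mono one_minus_cos_ge assms) simp
  finally have "(\<bar>x\<bar> / 3)\<^sup>2 \<le> (cmod (1 - cis x))\<^sup>2" by (simp add: power_divide e)
  then have "\<bar>x\<bar> / 3 \<le> cmod (1 - cis x)" by (rule power2_le_imp_le) simp
  then show ?thesis using 1 2 by (auto simp: max_def)
qed

text \<open>The interval |x| <= \<delta> contributes 2 \<delta>^(1-q), and each tail \<delta>^(1-q)
  / (q - 1), finite because q > 1.\<close>

lemma nn_integral_max_powr:
  assumes \<delta>: "0 < \<delta>" and q: "1 < q"
  shows "(\<integral>\<^sup>+x. ennreal (max \<delta> \<bar>x\<bar> powr (- q)) \<partial>lborel) \<le> ennreal ((2 + 2 / (q - 1)) * \<delta> powr (1 - q))"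
proof -
  define T where "T x = indicator {\<delta>..} x * ennreal (x powr (- q))" for x :: real
  have [measurable]: "T \<in> borel_measurable borel" unfolding T_def by measurable
  have iT: "(\<integral>\<^sup>+x. T x \<partial>lborel) = ennreal (\<delta> powr (1 - q) / (q - 1))"
  proof -
    have "((\<lambda>x. x powr (- q)) has_integral - (\<delta> powr (- q + 1)) / (- q + 1)) {\<delta>..}"
      using q \<delta> by (intro has_integral_powr_to_inf) auto
    also have "- (\<delta> powr (- q + 1)) / (- q + 1) = \<delta> powr (1 - q) / (q - 1)"
      using q by (simp add: field_simps)
    finally have "integral\<^sup>N lborel (\<lambda>x. indicator {\<delta>..} x * (x powr (- q))) = ennreal (\<delta> powr (1 - q) / (q - 1))"
      by (intro nn_integral_has_integral_lebesgue) auto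
    also have "(\<lambda>x. ennreal (indicator {\<delta>..} x * (x powr (- q)))) = T"
      by (auto simp: T_def indicator_def fun_eq_iff)
    finally show ?thesis .
  qed
  have iT': "(\<integral>\<^sup>+x. T (- x) \<partial>lborel) = (\<integral>\<^sup>+x. T x \<partial>lborel)"
    using nn_integral_real_affine[of T "-1" 0] by simp
  have "(\<integral>\<^sup>+x. ennreal (max \<delta> \<bar>x\<bar> powr (- q)) \<partial>lborel) \<le>
      (\<integral>\<^sup>+x. (ennreal (\<delta> powr (- q)) * indicator {-\<delta>..\<delta>} x + T x) + T (- x) \<partial>lborel)"
  proof (rule nn_integral_mono)
    fix x :: real
    consider "\<bar>x\<bar> \<le> \<delta>" | "\<delta> \<le> x" | "\<delta> \<le> - x" by linarith
    then show "ennreal (max \<delta> \<bar>x\<bar> powr (- q)) \<le> (ennreal (\<delta> powr (- q)) * indicator {-\<delta>..\<delta>} x + T x) + T (- x)"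
    proof cases
      case 1
      then have "ennreal (max \<delta> \<bar>x\<bar> powr (- q)) = ennreal (\<delta> powr (- q)) * indicator {-\<delta>..\<delta>} x"
        by (auto simp: max.absorb1 abs_le_iff)
      then show ?thesis by (simp add: add.assoc)
    next
      case 2
      then have "ennreal (max \<delta> \<bar>x\<bar> powr (- q)) = T x" using \<delta> by (auto simp: max_def T_def)
      then show ?thesis by (simp add: add_ac)
    next
      case 3
      then have "ennreal (max \<delta> \<bar>x\<bar> powr (- q)) = T (- x)" using \<delta> by (auto simp: max_def T_def)
      then show ?thesis by (simp add: add_ac)
    qed
  qed
  also have "\<dots> = (\<integral>\<^sup>+x. ennreal (\<delta> powr (- q)) * indicator {-\<delta>..\<delta>} x \<partial>lborel) + (\<integral>\<^sup>+x. T x \<partial>lborel) + (\<integral>\<^sup>+x. T (- x) \<partial>lborel)"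
    by (subst nn_integral_add, measurable, subst nn_integral_add, measurable)
  also have "(\<integral>\<^sup>+x. ennreal (\<delta> powr (- q)) * indicator {-\<delta>..\<delta>} x \<partial>lborel) = ennreal (\<delta> powr (- q)) * ennreal (2 * \<delta>)"
    using \<delta> by (subst nn_integral_cmult_indicator) auto
  also have "ennreal (\<delta> powr (- q)) * ennreal (2 * \<delta>) = ennreal (2 * \<delta> powr (1 - q))"
  proof -
    have "\<delta> powr (1 - q) = \<delta> * \<delta> powr (- q)" using \<delta> powr_add[of \<delta> 1 "- q"] by simp
    then show ?thesis using \<delta> by (subst ennreal_mult[symmetric]) (auto simp: mult_ac)
  qed
  also have "ennreal (2 * \<delta> powr (1 - q)) + (\<integral>\<^sup>+x. T x \<partial>lborel) + (\<integral>\<^sup>+x. T (- x) \<partial>lborel)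
     = ennreal (2 * \<delta> powr (1 - q) + \<delta> powr (1 - q) / (q - 1) + \<delta> powr (1 - q) / (q - 1))"
    unfolding iT' iT using q by (simp add: ennreal_plus[symmetric] del: ennreal_plus)
  also have "2 * \<delta> powr (1 - q) + \<delta> powr (1 - q) / (q - 1) + \<delta> powr (1 - q) / (q - 1) = (2 + 2 / (q - 1)) * \<delta> powr (1 - q)"
    by (simp add: algebra_simps)
  finally show ?thesis .
qed

text \<open>With \<alpha> = Arg a, either \<alpha> + 2 pi \<theta> or the same angle minus 2 pi lies
  in [-pi, pi]. Adding the majorants for both avoids a case split under the integral; each is then
  integrated over the whole line, which yields the factor 2.\<close>

lemma circle_average_powr_le:
  assumes a: "cmod a < 1" and q: "1 < q"
  shows "(\<integral>\<^sup>+\<theta>. ennreal (cmod (1 - cis (2 * pi * \<theta>) * a) powr (- q)) \<partial>unit_interval) \<le>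
    ennreal (2 * 6 powr q * (2 + 2 / (q - 1)) * (1 - cmod a) powr (1 - q))"
proof -
  define \<delta> where "\<delta> = 1 - cmod a"
  have \<delta>: "0 < \<delta>" using a by (simp add: \<delta>_def)
  define \<alpha> where "\<alpha> = Arg a"
  have \<alpha>: "- pi < \<alpha>" "\<alpha> \<le> pi" unfolding \<alpha>_def by (auto simp: mpi_less_Arg Arg_le_pi)
  have ap: "a = of_real (cmod a) * cis \<alpha>" unfolding \<alpha>_def by (metis rcis_cmod_Arg rcis_def)
  define m where "m x = max \<delta> \<bar>x\<bar> powr (- q)" for x
  have [measurable]: "m \<in> borel_measurable borel" unfolding m_def by measurable
  have im: "(\<integral>\<^sup>+x. ennreal (m (b + 2 * pi * x)) \<partial>lborel) \<le> ennreal ((2 + 2 / (q - 1)) * \<delta> powr (1 - q))" for b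
  proof -
    have "(\<integral>\<^sup>+x. ennreal (m x) \<partial>lborel) = ennreal (2 * pi) * (\<integral>\<^sup>+x. ennreal (m (b + 2 * pi * x)) \<partial>lborel)"
      using nn_integral_real_affine[of "\<lambda>x. ennreal (m x)" "2 * pi" b] by simp
    moreover have "1 * (\<integral>\<^sup>+x. ennreal (m (b + 2 * pi * x)) \<partial>lborel) \<le> ennreal (2 * pi) * (\<integral>\<^sup>+x. ennreal (m (b + 2 * pi * x)) \<partial>lborel)"
      using pi_gt3 by (intro mult_right_mono) auto
    ultimately show ?thesis using nn_integral_max_powr[OF \<delta> q] by (simp add: m_def)
  qed
  have key: "cmod (1 - cis (2 * pi * \<theta>) * a) powr (- q) \<le> 6 powr q * (m (\<alpha> + 2 * pi * \<theta>) + m ((\<alpha> - 2 * pi) + 2 * pi * \<theta>))"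
    if \<theta>: "\<theta> \<in> {0..1}" for \<theta>
  proof -
    have e: "cis (2 * pi * \<theta>) * a = of_real (cmod a) * cis (\<alpha> + 2 * pi * \<theta>)"
      by (subst ap) (simp add: cis_mult[symmetric] mult_ac)
    have e': "cis (\<alpha> + 2 * pi * \<theta>) = cis ((\<alpha> - 2 * pi) + 2 * pi * \<theta>)"
      by (simp add: cis_mult[symmetric] cis_divide[symmetric])
    have bd: "cmod (1 - of_real (cmod a) * cis x) powr (- q) \<le> 6 powr q * m x" if "\<bar>x\<bar> \<le> pi" for x
    proof -
      have "max \<delta> \<bar>x\<bar> / 6 \<le> cmod (1 - of_real (cmod a) * cis x)"
        unfolding \<delta>_def using a that by (intro norm_one_minus_rcis_ge) auto
      then have "cmod (1 - of_real (cmod a) * cis x) powr (- q) \<le> (max \<delta> \<bar>x\<bar> / 6) powr (- q)"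
        using \<delta> q by (intro powr_mono2') auto
      also have "\<dots> = 6 powr q * m x"
        using \<delta> by (simp add: powr_divide m_def powr_minus field_simps)
      finally show ?thesis .
    qed
    have m0: "0 \<le> m x" for x by (simp add: m_def)
    have t: "0 \<le> 2 * pi * \<theta>" "2 * pi * \<theta> \<le> 2 * pi" using \<theta> by auto
    consider "\<bar>\<alpha> + 2 * pi * \<theta>\<bar> \<le> pi" | "\<bar>(\<alpha> - 2 * pi) + 2 * pi * \<theta>\<bar> \<le> pi" using \<alpha> t by linarith
    then show ?thesis
    proof cases
      case 1
      then show ?thesis using bd[OF 1] m0[of "(\<alpha> - 2 * pi) + 2 * pi * \<theta>"] unfolding e
        by (simp add: distrib_left add_increasing2)
    next
      case 2
      then show ?thesis using bd[OF 2] m0[of "\<alpha> + 2 * pi * \<theta>"] unfolding e e'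
        by (simp add: distrib_left add_increasing)
    qed
  qed
  have "(\<integral>\<^sup>+\<theta>. ennreal (cmod (1 - cis (2 * pi * \<theta>) * a) powr (- q)) \<partial>unit_interval) \<le>
     (\<integral>\<^sup>+\<theta>. ennreal (6 powr q) * (ennreal (m (\<alpha> + 2 * pi * \<theta>)) + ennreal (m ((\<alpha> - 2 * pi) + 2 * pi * \<theta>))) \<partial>unit_interval)"
  proof (rule nn_integral_mono)
    fix \<theta> assume "\<theta> \<in> space unit_interval"
    then have "\<theta> \<in> {0..1}" by simp
    from ennreal_leI[OF key[OF this]]
    show "ennreal (cmod (1 - cis (2 * pi * \<theta>) * a) powr (- q)) \<le>
      ennreal (6 powr q) * (ennreal (m (\<alpha> + 2 * pi * \<theta>)) + ennreal (m ((\<alpha> - 2 * pi) + 2 * pi * \<theta>)))"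
      by (simp add: ennreal_mult m_def)
  qed
  also have "\<dots> \<le> (\<integral>\<^sup>+\<theta>. ennreal (6 powr q) * (ennreal (m (\<alpha> + 2 * pi * \<theta>)) + ennreal (m ((\<alpha> - 2 * pi) + 2 * pi * \<theta>))) \<partial>lborel)"
    by (subst nn_integral_restrict_space) (auto intro!: nn_integral_mono simp: indicator_def)
  also have "\<dots> = ennreal (6 powr q) * ((\<integral>\<^sup>+\<theta>. ennreal (m (\<alpha> + 2 * pi * \<theta>)) \<partial>lborel) + (\<integral>\<^sup>+\<theta>. ennreal (m ((\<alpha> - 2 * pi) + 2 * pi * \<theta>)) \<partial>lborel))"
    by (subst nn_integral_cmult, measurable, subst nn_integral_add, measurable)
  also have "\<dots> \<le> ennreal (6 powr q) * (ennreal ((2 + 2 / (q - 1)) * \<delta> powr (1 - q)) + ennreal ((2 + 2 / (q - 1)) * \<delta> powr (1 - q)))"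
    by (intro mult_left_mono add_mono im) auto
  also have "\<dots> = ennreal (2 * 6 powr q * (2 + 2 / (q - 1)) * (1 - cmod a) powr (1 - q))"
  proof -
    define X where "X = (2 + 2 / (q - 1)) * \<delta> powr (1 - q)"
    have X: "0 \<le> X" using q by (simp add: X_def)
    have "ennreal (6 powr q) * (ennreal X + ennreal X) = ennreal (6 powr q * (X + X))"
      using X by (simp only: ennreal_plus ennreal_mult add_nonneg_nonneg powr_ge_zero)
    also have "6 powr q * (X + X) = 2 * 6 powr q * (2 + 2 / (q - 1)) * (1 - cmod a) powr (1 - q)"
      by (simp add: X_def \<delta>_def)
    finally show ?thesis unfolding X_def .
  qed
  finally show ?thesis .
qed

text \<open>Split at 1 - t = \<delta>. Below, the maximum is constant and s > -1 gives \<delta>^(-p)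
  / (s + 1); above, the two powers combine to -1 - p and give \<delta>^(-p) / p.\<close>

lemma radial_integral_le:
  assumes s: "-1 < s" and p: "0 < p" and \<delta>: "0 < \<delta>"
  shows "(\<integral>\<^sup>+t. ennreal ((1 - t) powr s * max \<delta> (1 - t) powr (- (s + 1 + p))) \<partial>unit_interval) \<le>
    ennreal ((1 / (s + 1) + 1 / p) * \<delta> powr (- p))"
proof -
  define F where "F u = indicator {0..1} u * ennreal (u powr s * max \<delta> u powr (- (s + 1 + p)))" for u :: real
  have [measurable]: "F \<in> borel_measurable borel" unfolding F_def by measurable
  have i1: "(\<integral>\<^sup>+u. ennreal (indicator {0..\<delta>} u * u powr s) \<partial>lborel) = ennreal (\<delta> powr (s + 1) / (s + 1))"
    using s \<delta> by (intro nn_integral_has_integral_lebesgue has_integral_powr_from_0) auto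
  have i2: "(\<integral>\<^sup>+u. ennreal (indicator {\<delta>..} u * u powr (- 1 - p)) \<partial>lborel) = ennreal (\<delta> powr (- p) / p)"
  proof -
    have "((\<lambda>x. x powr (- 1 - p)) has_integral - (\<delta> powr (- 1 - p + 1)) / (- 1 - p + 1)) {\<delta>..}"
      using p \<delta> by (intro has_integral_powr_to_inf) auto
    then show ?thesis by (intro nn_integral_has_integral_lebesgue) auto
  qed
  have "(\<integral>\<^sup>+t. ennreal ((1 - t) powr s * max \<delta> (1 - t) powr (- (s + 1 + p))) \<partial>unit_interval)
      = (\<integral>\<^sup>+t. F (1 - t) \<partial>lborel)"
    by (subst nn_integral_restrict_space) (auto intro!: nn_integral_cong simp: F_def indicator_def)
  also have "\<dots> = (\<integral>\<^sup>+u. F u \<partial>lborel)"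
    using nn_integral_real_affine[of F "-1" 1] by simp
  also have "\<dots> \<le> (\<integral>\<^sup>+u. ennreal (\<delta> powr (- (s + 1 + p))) * ennreal (indicator {0..\<delta>} u * u powr s)
      + ennreal (indicator {\<delta>..} u * u powr (- 1 - p)) \<partial>lborel)"
  proof (rule nn_integral_mono)
    fix u :: real
    show "F u \<le> ennreal (\<delta> powr (- (s + 1 + p))) * ennreal (indicator {0..\<delta>} u * u powr s)
      + ennreal (indicator {\<delta>..} u * u powr (- 1 - p))"
    proof (cases "0 \<le> u \<and> u \<le> \<delta>")
      case True
      then have "F u \<le> ennreal (\<delta> powr (- (s + 1 + p))) * ennreal (indicator {0..\<delta>} u * u powr s)"
        by (auto simp: F_def indicator_def max_def ennreal_mult mult.commute)
      then show ?thesis by (rule add_increasing2[rotated]) simp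
    next
      case False
      then have "F u = 0 \<or> F u \<le> ennreal (indicator {\<delta>..} u * u powr (- 1 - p))"
        using \<delta> by (auto simp: F_def indicator_def max_def powr_add[symmetric])
      then show ?thesis by (auto intro: add_increasing)
    qed
  qed
  also have "\<dots> = ennreal (\<delta> powr (- (s + 1 + p))) * ennreal (\<delta> powr (s + 1) / (s + 1)) + ennreal (\<delta> powr (- p) / p)"
    by (subst nn_integral_add, measurable, subst nn_integral_cmult, measurable) (simp only: i1 i2)
  also have "ennreal (\<delta> powr (- (s + 1 + p))) * ennreal (\<delta> powr (s + 1) / (s + 1)) = ennreal (\<delta> powr (- p) / (s + 1))"
    using s \<delta> by (subst ennreal_mult[symmetric]) (auto simp: powr_add[symmetric])
  also have "ennreal (\<delta> powr (- p) / (s + 1)) + ennreal (\<delta> powr (- p) / p) = ennreal ((1 / (s + 1) + 1 / p) * \<delta> powr (- p))"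
    using s p by (subst ennreal_plus[symmetric]) (auto simp: algebra_simps)
  finally show ?thesis .
qed

definition besov_kernel :: "nat \<Rightarrow> complex \<Rightarrow> complex \<Rightarrow> real" where
  "besov_kernel k z w = (1 - (cmod z)\<^sup>2) ^ k * (1 - (cmod w)\<^sup>2) / cmod (1 - z * cnj w) ^ (k + 1)"

lemma besov_kernel_nonneg: "z \<in> unit_disk \<Longrightarrow> w \<in> unit_disk \<Longrightarrow> 0 \<le> besov_kernel k z w"
  using one_minus_norm_square_pos[of z] one_minus_norm_square_pos[of w] by (simp add: besov_kernel_def)

text \<open>Against d\<lambda>, the p-th power of the kernel becomes (1 - |z|^2)^s (1 - |w|^2)^p /
  |1 - z cnj w|^q with s = p k - 2 and q = s + 2 + p; the hypothesis p k > 1 says s > -1. The circle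
  mean lowers q by one, the radial integral leaves (1 - |w|)^(-p), and the factor (1 - |w|^2)^p
  compensates for it, so the bound is uniform in \<open>w\<close>.\<close>

lemma forelli_rudin:
  assumes p: "0 < p" and k: "p * real k > 1"
  shows "\<exists>c\<ge>0. \<forall>w\<in>unit_disk. (\<integral>\<^sup>+z. ennreal (besov_kernel k z w powr p) \<partial>mobius_measure) \<le> ennreal c"
proof (intro exI conjI ballI)
  define s where "s = p * real k - 2"
  define q where "q = s + 2 + p"
  have s: "-1 < s" and q: "1 < q" using k p by (auto simp: s_def q_def)
  have qk: "q = p * real (k + 1)" by (simp add: q_def s_def algebra_simps)
  define A where "A = 2 * 6 powr q * (2 + 2 / (q - 1))"
  have A: "0 \<le> A" using q by (simp add: A_def)
  define c where "c = 2 powr p * A * 2 powr (q - 1) * (1 / (s + 1) + 1 / p)"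
  show "0 \<le> c" using A s p by (simp add: c_def)
  fix w assume w: "w \<in> unit_disk"
  define \<delta> where "\<delta> = 1 - cmod w"
  have \<delta>: "0 < \<delta>" using w by (simp add: \<delta>_def)
  define W where "W = (1 - (cmod w)\<^sup>2) powr p"
  have W: "0 \<le> W" "W \<le> 2 powr p * \<delta> powr p"
  proof -
    have "W \<le> (2 * \<delta>) powr p" unfolding W_def \<delta>_def
      using one_minus_norm_square_bounds(2)[OF w] one_minus_norm_square_pos[OF w] p by (intro powr_mono2) auto
    then show "W \<le> 2 powr p * \<delta> powr p" using \<delta> by (simp add: powr_mult)
  qed (simp add: W_def)
  define F where "F z = ennreal ((1 - (cmod z)\<^sup>2) powr s * W) * ennreal (cmod (1 - z * cnj w) powr (- q))" for z
  have Fm: "F \<in> borel_measurable disk_borel"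
    unfolding F_def by measurable
  have Km: "(\<lambda>z. ennreal (besov_kernel k z w powr p)) \<in> borel_measurable disk_borel"
    unfolding besov_kernel_def by measurable
  have KF: "ennreal (1 / (1 - (cmod z)\<^sup>2)\<^sup>2) * ennreal (besov_kernel k z w powr p) = F z" if z: "z \<in> unit_disk" for z
  proof -
    define x where "x = 1 - (cmod z)\<^sup>2"
    have x: "0 < x" using one_minus_norm_square_pos[OF z] by (simp add: x_def)
    define y where "y = cmod (1 - z * cnj w)"
    have y: "0 < y" using norm_one_minus_mult_cnj_pos[OF z w] by (simp add: y_def)
    have v: "0 < 1 - (cmod w)\<^sup>2" by (rule one_minus_norm_square_pos[OF w])
    have "besov_kernel k z w = x powr real k * (1 - (cmod w)\<^sup>2) * y powr (- real (k + 1))"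
      using x y by (simp add: besov_kernel_def x_def y_def powr_realpow powr_minus divide_inverse del: of_nat_Suc of_nat_add)
    then have "besov_kernel k z w powr p = x powr (real k * p) * W * y powr (- real (k + 1) * p)"
      using x y v by (simp add: powr_mult powr_powr W_def)
    also have "- real (k + 1) * p = - q" unfolding qk by (simp only: mult_minus_left mult.commute)
    also have "x powr (real k * p) = x powr s * x\<^sup>2"
    proof -
      have "x powr s * x\<^sup>2 = x powr s * x powr 2" using x by simp
      also have "\<dots> = x powr (s + 2)" by (rule powr_add[symmetric])
      finally show ?thesis by (simp add: s_def mult.commute)
    qed
    finally have "1 / x\<^sup>2 * besov_kernel k z w powr p = x powr s * W * y powr (- q)"
      using x by simp
    then show ?thesis unfolding F_def x_def[symmetric] y_def[symmetric]
      using W by (simp add: ennreal_mult[symmetric])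
  qed
  have "(\<integral>\<^sup>+z. ennreal (besov_kernel k z w powr p) \<partial>mobius_measure) = (\<integral>\<^sup>+z. F z \<partial>disk_area)"
    by (subst nn_integral_mobius[OF Km]) (intro nn_integral_cong, simp add: KF)
  also have "\<dots> = (\<integral>\<^sup>+z. (\<integral>\<^sup>+\<theta>. F (cis (2 * pi * \<theta>) * z) \<partial>unit_interval) \<partial>disk_area)"
    by (rule nn_integral_disk_area_average[OF Fm])
  also have "\<dots> \<le> (\<integral>\<^sup>+z. ennreal (W * A * 2 powr (q - 1)) *
       ennreal ((1 - (cmod z)\<^sup>2) powr s * max \<delta> (1 - (cmod z)\<^sup>2) powr (- (s + 1 + p))) \<partial>disk_area)"
  proof (rule nn_integral_mono)
    fix z assume "z \<in> space disk_area"
    then have z: "z \<in> unit_disk" by simp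
    have zw: "cmod (z * cnj w) < 1"
      using z w mult_left_le[of "cmod w" "cmod z"] by (simp add: norm_mult)
    \<comment> \<open>Both 1 - |w| and 1 - |z| are at most 1 - |z w|. Keeping their maximum yields
      exactly the radial integrand of \<open>radial_integral_le\<close>.\<close>
    have R: "max \<delta> (1 - (cmod z)\<^sup>2) / 2 \<le> 1 - cmod (z * cnj w)"
    proof -
      have "cmod z * cmod w \<le> cmod z" "cmod z * cmod w \<le> cmod w"
        using z w by (simp_all add: mult_left_le mult_left_le_one_le)
      then have "\<delta> \<le> 1 - cmod (z * cnj w)" "1 - cmod z \<le> 1 - cmod (z * cnj w)" by (auto simp: \<delta>_def norm_mult)
      then show ?thesis using one_minus_norm_square_bounds(2)[OF z] \<delta> by (auto simp: max_def)
    qed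
    have "(\<integral>\<^sup>+\<theta>. F (cis (2 * pi * \<theta>) * z) \<partial>unit_interval) =
       (\<integral>\<^sup>+\<theta>. ennreal ((1 - (cmod z)\<^sup>2) powr s * W) * ennreal (cmod (1 - cis (2 * pi * \<theta>) * (z * cnj w)) powr (- q)) \<partial>unit_interval)"
      by (simp add: F_def norm_mult mult.assoc)
    also have "\<dots> = ennreal ((1 - (cmod z)\<^sup>2) powr s * W) * (\<integral>\<^sup>+\<theta>. ennreal (cmod (1 - cis (2 * pi * \<theta>) * (z * cnj w)) powr (- q)) \<partial>unit_interval)"
    proof (rule nn_integral_cmult)
      have c: "(\<lambda>t::real. cis (2 * pi * t)) \<in> borel_measurable borel"
        by (intro borel_measurable_continuous_onI continuous_intros)
      show "(\<lambda>\<theta>. ennreal (cmod (1 - cis (2 * pi * \<theta>) * (z * cnj w)) powr (- q))) \<in> borel_measurable unit_interval"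
        by (rule measurable_restrict_space1) (use c in measurable)
    qed
    also have "\<dots> \<le> ennreal ((1 - (cmod z)\<^sup>2) powr s * W) * ennreal (A * (1 - cmod (z * cnj w)) powr (1 - q))"
      unfolding A_def by (intro mult_left_mono circle_average_powr_le zw q) auto
    also have "\<dots> \<le> ennreal ((1 - (cmod z)\<^sup>2) powr s * W) * ennreal (A * (2 powr (q - 1) * max \<delta> (1 - (cmod z)\<^sup>2) powr (1 - q)))"
    proof (intro mult_left_mono ennreal_leI)
      have "(1 - cmod (z * cnj w)) powr (1 - q) \<le> (max \<delta> (1 - (cmod z)\<^sup>2) / 2) powr (1 - q)"
        using R \<delta> q by (intro powr_mono2') auto
      also have "\<dots> = 2 powr (q - 1) * max \<delta> (1 - (cmod z)\<^sup>2) powr (1 - q)"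
        using \<delta> powr_minus[of 2 "1 - q"] by (simp add: powr_divide field_simps)
      finally show "(1 - cmod (z * cnj w)) powr (1 - q) \<le> 2 powr (q - 1) * max \<delta> (1 - (cmod z)\<^sup>2) powr (1 - q)" .
    qed (use A in auto)
    also have "\<dots> = ennreal (((1 - (cmod z)\<^sup>2) powr s * W) * (A * (2 powr (q - 1) * max \<delta> (1 - (cmod z)\<^sup>2) powr (1 - q))))"
      using A W by (intro ennreal_mult[symmetric]) auto
    also have "((1 - (cmod z)\<^sup>2) powr s * W) * (A * (2 powr (q - 1) * max \<delta> (1 - (cmod z)\<^sup>2) powr (1 - q))) =
       (W * A * 2 powr (q - 1)) * ((1 - (cmod z)\<^sup>2) powr s * max \<delta> (1 - (cmod z)\<^sup>2) powr (- (s + 1 + p)))"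
    proof -
      have "1 - q = - (s + 1 + p)" by (simp add: q_def)
      then show ?thesis by (simp only: mult_ac)
    qed
    also have "ennreal \<dots> = ennreal (W * A * 2 powr (q - 1)) *
       ennreal ((1 - (cmod z)\<^sup>2) powr s * max \<delta> (1 - (cmod z)\<^sup>2) powr (- (s + 1 + p)))"
      using A W by (intro ennreal_mult) auto
    finally show "(\<integral>\<^sup>+\<theta>. F (cis (2 * pi * \<theta>) * z) \<partial>unit_interval) \<le> \<dots>" .
  qed
  also have "\<dots> = (\<integral>\<^sup>+t. ennreal (W * A * 2 powr (q - 1)) *
       ennreal ((1 - t) powr s * max \<delta> (1 - t) powr (- (s + 1 + p))) \<partial>unit_interval)"
    by (rule nn_integral_disk_area_radial) measurable
  also have "\<dots> = ennreal (W * A * 2 powr (q - 1)) *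
       (\<integral>\<^sup>+t. ennreal ((1 - t) powr s * max \<delta> (1 - t) powr (- (s + 1 + p))) \<partial>unit_interval)"
    by (rule nn_integral_cmult, rule measurable_restrict_space1) measurable
  also have "\<dots> \<le> ennreal (W * A * 2 powr (q - 1)) * ennreal ((1 / (s + 1) + 1 / p) * \<delta> powr (- p))"
    by (intro mult_left_mono radial_integral_le s p \<delta>) auto
  also have "\<dots> = ennreal (W * A * 2 powr (q - 1) * ((1 / (s + 1) + 1 / p) * \<delta> powr (- p)))"
    using A W s p by (intro ennreal_mult[symmetric]) auto
  also have "\<dots> \<le> ennreal c"
  proof (rule ennreal_leI)
    have "W * (A * 2 powr (q - 1) * ((1 / (s + 1) + 1 / p) * \<delta> powr (- p)))
       \<le> (2 powr p * \<delta> powr p) * (A * 2 powr (q - 1) * ((1 / (s + 1) + 1 / p) * \<delta> powr (- p)))"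
      using W A s p by (intro mult_right_mono) auto
    also have "\<dots> = c * (\<delta> powr p * \<delta> powr (- p))" by (simp add: c_def mult_ac)
    also have "\<delta> powr p * \<delta> powr (- p) = 1" using \<delta> by (simp add: powr_add[symmetric])
    finally show "W * A * 2 powr (q - 1) * ((1 / (s + 1) + 1 / p) * \<delta> powr (- p)) \<le> c" by (simp add: mult.assoc)
  qed
  finally show "(\<integral>\<^sup>+z. ennreal (besov_kernel k z w powr p) \<partial>mobius_measure) \<le> ennreal c" .
qed

section \<open>From a representing measure to the Besov space\<close>

lemma measurable_cnj [measurable (raw)]:
  "f \<in> borel_measurable M \<Longrightarrow> (\<lambda>x. cnj (f x)) \<in> borel_measurable M"
  by (rule measurable_compose) (auto intro!: borel_measurable_continuous_onI continuous_intros)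

lemma measurable_disk_pair [measurable]:
  "snd \<in> borel_measurable (disk_borel \<Otimes>\<^sub>M disk_borel)"
  "fst \<in> borel_measurable (disk_borel \<Otimes>\<^sub>M disk_borel)"
  by (rule measurable_compose[OF measurable_snd measurable_ident_disk]
        measurable_compose[OF measurable_fst measurable_ident_disk])+

text \<open>Moving \<open>w\<close> by at most 1 - |w| changes 1 - z cnj w by at most its own
  modulus, so the denominator at most doubles. This costs 2^(k+1), and the factor 1 - |w|^2 costs
  4.\<close>

lemma besov_kernel_comparable:
  assumes z: "z \<in> unit_disk" and w: "w \<in> unit_disk" and u: "u \<in> nbhd C w" and C: "0 \<le> C" "C \<le> 1"
  shows "besov_kernel k z w \<le> 2 ^ (k + 3) * besov_kernel k z u"
proof -
  have ud: "u \<in> unit_disk" using u by (simp add: nbhd_def)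
  define x y where "x = cmod (1 - z * cnj w)" and "y = cmod (1 - z * cnj u)"
  have xy: "0 < x" "0 < y"
    unfolding x_def y_def using norm_one_minus_mult_cnj_pos(2) z w ud by auto
  have "1 - cmod w \<le> cmod (1 - w * cnj z)" by (rule norm_one_minus_mult_cnj_pos[OF w z])
  also have "1 - w * cnj z = cnj (1 - z * cnj w)" by simp
  finally have xw: "1 - cmod w \<le> x" unfolding x_def complex_mod_cnj .
  have "1 - z * cnj u = (1 - z * cnj w) + z * cnj (w - u)" by (simp add: algebra_simps)
  then have "y \<le> x + cmod (z * cnj (w - u))" unfolding x_def y_def by (metis norm_triangle_ineq)
  also have "cmod (z * cnj (w - u)) \<le> dist w u"
    using z by (simp add: norm_mult dist_norm mult_left_le_one_le del: complex_cnj_diff)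
  also have "dist w u \<le> C * (1 - cmod w)" using u by (auto simp: nbhd_def)
  also have "\<dots> \<le> 1 * (1 - cmod w)" using C w by (intro mult_right_mono) auto
  finally have yx: "y \<le> 2 * x" using xw by simp
  have "1 - (cmod w)\<^sup>2 \<le> 2 * (1 - cmod w)" by (rule one_minus_norm_square_bounds(2)[OF w])
  also have "1 - cmod w \<le> (1 + C) * (1 - cmod u)" by (rule nbhd_comparable(2)[OF u])
  also have "(1 + C) * (1 - cmod u) \<le> 2 * (1 - (cmod u)\<^sup>2)"
    using C ud one_minus_norm_square_bounds(1)[OF ud] by (intro mult_mono) auto
  finally have num: "1 - (cmod w)\<^sup>2 \<le> 4 * (1 - (cmod u)\<^sup>2)" by simp
  have "y ^ (k + 1) \<le> (2 * x) ^ (k + 1)" using yx xy by (intro power_mono) auto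
  then have "1 / x ^ (k + 1) \<le> 2 ^ (k + 1) / y ^ (k + 1)"
    using xy unfolding power_mult_distrib by (simp add: divide_simps)
  then have "(1 - (cmod w)\<^sup>2) * (1 / x ^ (k + 1)) \<le> (4 * (1 - (cmod u)\<^sup>2)) * (2 ^ (k + 1) / y ^ (k + 1))"
    using num xy one_minus_norm_square_pos[OF ud] by (intro mult_mono) auto
  then have "(1 - (cmod z)\<^sup>2) ^ k * ((1 - (cmod w)\<^sup>2) * (1 / x ^ (k + 1))) \<le>
      (1 - (cmod z)\<^sup>2) ^ k * ((4 * (1 - (cmod u)\<^sup>2)) * (2 ^ (k + 1) / y ^ (k + 1)))"
    using one_minus_norm_square_pos[OF z] by (intro mult_left_mono) auto
  also have "\<dots> = 2 ^ (k + 3) * ((1 - (cmod z)\<^sup>2) ^ k * (1 - (cmod u)\<^sup>2) / y ^ (k + 1))"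
    by (simp add: power_add)
  finally show ?thesis by (simp add: besov_kernel_def x_def y_def)
qed

lemma measurable_besov_kernel_pair [measurable]:
  "(\<lambda>x. besov_kernel k (fst x) (snd x)) \<in> borel_measurable (disk_borel \<Otimes>\<^sub>M disk_borel)"
  unfolding besov_kernel_def by measurable

lemma measurable_besov_kernel [measurable]:
  "besov_kernel k z \<in> borel_measurable disk_borel"
  unfolding besov_kernel_def by measurable

text \<open>The positive measure is smeared at scale \<epsilon>: the integral of the kernel against
  J becomes one of \<Phi>(u) = K(z,u) J(nbhd \<epsilon> u) against \<lambda>. Since \<Phi>^p is
  dominated by local averages of K(z,v)^p \<Psi>(v)^p, the inequality for p <= 1 bounds the p-th
  power of the integral by a constant times \<open>T z\<close>; only then is \<open>z\<close>
  integrated.\<close>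

lemma kernel_integral_bound:
  assumes J: "finite_measure J" and sJ [measurable_cong]: "sets J = sets disk_borel"
    and p: "0 < p" "p \<le> 1" and k: "p * real k > 1" and r: "0 < r" "r < 1"
    and \<Psi>m [measurable]: "\<Psi> \<in> borel_measurable disk_borel"
    and \<Psi>0: "\<And>z. z \<in> unit_disk \<Longrightarrow> 0 \<le> \<Psi> z"
    and J\<Psi>: "\<And>z. z \<in> unit_disk \<Longrightarrow> emeasure J (pseudohyperbolic_disk z r) \<le> ennreal (\<Psi> z)"
    and fin: "(\<integral>\<^sup>+z. ennreal (\<Psi> z powr p) \<partial>mobius_measure) < \<infinity>"
  shows "(\<integral>\<^sup>+z. ennreal ((\<integral>w. besov_kernel k z w \<partial>J) powr p) \<partial>mobius_measure) < \<infinity>"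
proof -
  interpret J: finite_measure J by (rule J)
  interpret L: sigma_finite_measure mobius_measure by (rule sigma_finite_mobius)
  interpret JL: pair_sigma_finite J mobius_measure ..
  interpret LL: pair_sigma_finite mobius_measure mobius_measure ..
  have spJ [simp]: "space J = unit_disk" using sets_eq_imp_space_eq[OF sJ] by simp
  have mJ: "measurable J N = measurable disk_borel N" for N :: "'x measure"
    by (rule measurable_cong_sets) (auto simp: sJ)
  \<comment> \<open>Two steps of size \<epsilon> must stay within size r: \<epsilon> + \<epsilon> +
    \<epsilon>^2 <= 3 \<epsilon> <= r.\<close>
  define \<epsilon> where "\<epsilon> = r / 4"
  have \<epsilon>: "0 < \<epsilon>" "\<epsilon> \<le> 1" "\<epsilon> + \<epsilon> + \<epsilon> * \<epsilon> \<le> r" "\<epsilon> \<le> r"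
  proof -
    show e: "0 < \<epsilon>" "\<epsilon> \<le> 1" "\<epsilon> \<le> r" using r by (auto simp: \<epsilon>_def)
    have "\<epsilon> * \<epsilon> \<le> \<epsilon> * 1" using e by (intro mult_left_mono) auto
    moreover have "3 * \<epsilon> \<le> r" using r by (simp add: \<epsilon>_def)
    ultimately show "\<epsilon> + \<epsilon> + \<epsilon> * \<epsilon> \<le> r" by linarith
  qed
  define lo where "lo = nbhd_lower \<epsilon>"
  have lo: "0 < lo" unfolding lo_def by (rule nbhd_lower_pos[OF \<epsilon>(1)])
  define Q :: real where "Q = 2 ^ (k + 3)"
  have Q: "0 < Q" by (simp add: Q_def)
  have Kc: "besov_kernel k z w \<le> Q * besov_kernel k z u" if "z \<in> unit_disk" "w \<in> unit_disk" "u \<in> nbhd \<epsilon> w" for z w u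
    unfolding Q_def using that \<epsilon> by (intro besov_kernel_comparable[where C=\<epsilon>]) auto
  have nsub: "nbhd \<epsilon> u \<subseteq> pseudohyperbolic_disk v r" if v: "v \<in> nbhd \<epsilon> u" and u: "u \<in> unit_disk" for u v
  proof
    fix w assume w: "w \<in> nbhd \<epsilon> u"
    have vd: "v \<in> unit_disk" using v by (simp add: nbhd_def)
    have "u \<in> nbhd \<epsilon> v" using v nbhd_sym[OF u vd] by simp
    then have "w \<in> nbhd r v" by (rule nbhd_trans[OF _ w]) (use \<epsilon> in auto)
    then show "w \<in> pseudohyperbolic_disk v r"
      using vd r by (intro in_pseudohyperbolic_diskI) (auto simp: nbhd_def)
  qed
  \<comment> \<open>A bound valid at every point of a neighbourhood is exchanged for a bound by an
    integral over it, because the neighbourhood has measure at least \<open>lo\<close>.\<close>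
  have lower: "ennreal lo * ennreal a \<le> (\<integral>\<^sup>+v. F v * indicator (nbhd \<epsilon> u) v \<partial>mobius_measure)"
    if u: "u \<in> unit_disk" and F: "\<And>v. v \<in> nbhd \<epsilon> u \<Longrightarrow> ennreal a \<le> F v" for u a F
  proof -
    have "ennreal lo * ennreal a \<le> ennreal a * emeasure mobius_measure (nbhd \<epsilon> u)"
      unfolding lo_def using emeasure_mobius_nbhd_ge[OF u \<epsilon>(1)] by (subst mult.commute) (intro mult_left_mono; simp)
    also have "\<dots> = (\<integral>\<^sup>+v. ennreal a * indicator (nbhd \<epsilon> u) v \<partial>mobius_measure)"
      by (rule nn_integral_cmult_indicator[symmetric]) (simp add: sets_mobius_measure)
    also have "\<dots> \<le> (\<integral>\<^sup>+v. F v * indicator (nbhd \<epsilon> u) v \<partial>mobius_measure)"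
      by (intro nn_integral_mono) (auto simp: indicator_def F)
    finally show ?thesis .
  qed
  define c1 where "c1 = Q / lo"
  define c2 where "c2 = Q powr p / lo"
  have c12: "0 < c1" "0 < c2" using Q lo by (auto simp: c1_def c2_def)
  define T where "T z = (\<integral>\<^sup>+v. ennreal (besov_kernel k z v powr p * \<Psi> v powr p) \<partial>mobius_measure)" for z
  define U where "U = nbhd_upper \<epsilon>"
  have U: "0 < U" using \<epsilon> by (simp add: U_def nbhd_upper_def)
  define c3 where "c3 = (c1 * U) powr p * c2"
  have c3: "0 < c3" using c12 U by (simp add: c3_def)
  have main: "ennreal ((\<integral>w. besov_kernel k z w \<partial>J) powr p) \<le> ennreal c3 * T z" if z: "z \<in> unit_disk" for z
  proof (cases "T z")
    case top
    then show ?thesis using c3 by (simp add: ennreal_mult_top)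
  next
    case (real t)
    define \<Phi> where "\<Phi> u = besov_kernel k z u * measure J (nbhd \<epsilon> u)" for u
    have \<Phi>0: "0 \<le> \<Phi> u" if "u \<in> unit_disk" for u
      unfolding \<Phi>_def using besov_kernel_nonneg[OF z that] by simp
    \<comment> \<open>For each v close to u the disk D(v,r) contains all of
      \<open>nbhd \<epsilon> u\<close>, so J(nbhd \<epsilon> u) <= \<Psi>(v). Holding for every such
      v, the estimate may be averaged over v.\<close>
    have loc: "ennreal (\<Phi> u powr p) \<le> ennreal c2 *
        (\<integral>\<^sup>+v. ennreal (besov_kernel k z v powr p * \<Psi> v powr p) * indicator (nbhd \<epsilon> u) v \<partial>mobius_measure)"
      if u: "u \<in> unit_disk" for u
    proof -
      have "ennreal lo * ennreal (\<Phi> u powr p / Q powr p) \<le>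
        (\<integral>\<^sup>+v. ennreal (besov_kernel k z v powr p * \<Psi> v powr p) * indicator (nbhd \<epsilon> u) v \<partial>mobius_measure)"
      proof (rule lower[OF u], rule ennreal_leI)
        fix v assume v: "v \<in> nbhd \<epsilon> u"
        have vd: "v \<in> unit_disk" using v by (simp add: nbhd_def)
        have "emeasure J (nbhd \<epsilon> u) \<le> emeasure J (pseudohyperbolic_disk v r)"
          using nsub[OF v u] sets_pseudohyperbolic_disk[OF vd] by (intro emeasure_mono) (auto simp: sJ)
        also have "\<dots> \<le> ennreal (\<Psi> v)" by (rule J\<Psi>[OF vd])
        finally have "measure J (nbhd \<epsilon> u) \<le> \<Psi> v"
          using \<Psi>0[OF vd] by (simp add: J.emeasure_eq_measure)
        then have "\<Phi> u \<le> (Q * besov_kernel k z v) * \<Psi> v"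
          unfolding \<Phi>_def using Kc[OF z u v] Q besov_kernel_nonneg[OF z vd] by (intro mult_mono) auto
        then have "\<Phi> u powr p \<le> ((Q * besov_kernel k z v) * \<Psi> v) powr p"
          using \<Phi>0[OF u] p by (intro powr_mono2) auto
        also have "\<dots> = Q powr p * (besov_kernel k z v powr p * \<Psi> v powr p)"
          using Q besov_kernel_nonneg[OF z vd] \<Psi>0[OF vd] by (simp add: powr_mult)
        finally show "\<Phi> u powr p / Q powr p \<le> besov_kernel k z v powr p * \<Psi> v powr p"
          using Q by (simp add: divide_simps mult.commute)
      qed
      then have "ennreal c2 * (ennreal lo * ennreal (\<Phi> u powr p / Q powr p)) \<le> ennreal c2 *
        (\<integral>\<^sup>+v. ennreal (besov_kernel k z v powr p * \<Psi> v powr p) * indicator (nbhd \<epsilon> u) v \<partial>mobius_measure)"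
        by (rule mult_left_mono) simp
      also have "ennreal c2 * (ennreal lo * ennreal (\<Phi> u powr p / Q powr p)) = ennreal (c2 * (lo * (\<Phi> u powr p / Q powr p)))"
        using c12 lo by (simp only: ennreal_mult less_imp_le powr_ge_zero mult_nonneg_nonneg divide_nonneg_nonneg)
      also have "c2 * (lo * (\<Phi> u powr p / Q powr p)) = \<Phi> u powr p"
        using lo Q by (simp add: c2_def)
      finally show ?thesis .
    qed
    have \<Phi>int: "(\<integral>\<^sup>+u. ennreal (\<Phi> u) \<partial>mobius_measure) \<le> ennreal (U * (c2 * t) powr (1 / p))"
      unfolding U_def
      by (rule nn_integral_le_powr_of_local[where \<theta> = "\<lambda>v. ennreal (besov_kernel k z v powr p * \<Psi> v powr p)"])
         (use \<epsilon> p c12 real \<Phi>0 loc in \<open>auto simp: T_def[symmetric]\<close>)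
    \<comment> \<open>This is the smearing: K(z,w) is at most c1 times the integral of K(z,u) over u
      near w. Fubini and symmetry then collect the mass J(nbhd \<epsilon> u).\<close>
    have "(\<integral>\<^sup>+w. ennreal (besov_kernel k z w) \<partial>J) \<le>
       (\<integral>\<^sup>+w. ennreal c1 * (\<integral>\<^sup>+u. ennreal (besov_kernel k z u) * indicator (nbhd \<epsilon> w) u \<partial>mobius_measure) \<partial>J)"
    proof (rule nn_integral_mono)
      fix w assume "w \<in> space J"
      then have w: "w \<in> unit_disk" by simp
      have "ennreal lo * ennreal (besov_kernel k z w / Q) \<le>
         (\<integral>\<^sup>+u. ennreal (besov_kernel k z u) * indicator (nbhd \<epsilon> w) u \<partial>mobius_measure)"
        using Kc[OF z w] Q by (intro lower[OF w] ennreal_leI) (simp add: divide_simps mult.commute)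
      then have "ennreal c1 * (ennreal lo * ennreal (besov_kernel k z w / Q)) \<le>
         ennreal c1 * (\<integral>\<^sup>+u. ennreal (besov_kernel k z u) * indicator (nbhd \<epsilon> w) u \<partial>mobius_measure)"
        by (rule mult_left_mono) simp
      also have "ennreal c1 * (ennreal lo * ennreal (besov_kernel k z w / Q)) = ennreal (c1 * (lo * (besov_kernel k z w / Q)))"
        using c12 lo Q besov_kernel_nonneg[OF z w]
        by (simp only: ennreal_mult less_imp_le powr_ge_zero mult_nonneg_nonneg divide_nonneg_nonneg)
      also have "c1 * (lo * (besov_kernel k z w / Q)) = besov_kernel k z w"
        using lo Q by (simp add: c1_def)
      finally show "ennreal (besov_kernel k z w) \<le>
         ennreal c1 * (\<integral>\<^sup>+u. ennreal (besov_kernel k z u) * indicator (nbhd \<epsilon> w) u \<partial>mobius_measure)" .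
    qed
    also have "\<dots> = ennreal c1 * (\<integral>\<^sup>+w. (\<integral>\<^sup>+u. ennreal (besov_kernel k z u) * indicator (nbhd \<epsilon> w) u \<partial>mobius_measure) \<partial>J)"
      by (rule nn_integral_cmult, rule L.borel_measurable_nn_integral) (unfold case_prod_beta', measurable)
    also have "(\<integral>\<^sup>+w. (\<integral>\<^sup>+u. ennreal (besov_kernel k z u) * indicator (nbhd \<epsilon> w) u \<partial>mobius_measure) \<partial>J) =
       (\<integral>\<^sup>+u. (\<integral>\<^sup>+w. ennreal (besov_kernel k z u) * indicator (nbhd \<epsilon> w) u \<partial>J) \<partial>mobius_measure)"
      by (rule JL.Fubini'[symmetric]) (unfold case_prod_beta', measurable)
    also have "\<dots> = (\<integral>\<^sup>+u. (\<integral>\<^sup>+w. ennreal (besov_kernel k z u) * indicator (nbhd \<epsilon> u) w \<partial>J) \<partial>mobius_measure)"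
      by (intro nn_integral_cong) (auto simp: indicator_def nbhd_sym)
    also have "\<dots> = (\<integral>\<^sup>+u. ennreal (\<Phi> u) \<partial>mobius_measure)"
    proof (rule nn_integral_cong)
      fix u assume "u \<in> space mobius_measure"
      then have u: "u \<in> unit_disk" by simp
      have "(\<integral>\<^sup>+w. ennreal (besov_kernel k z u) * indicator (nbhd \<epsilon> u) w \<partial>J) = ennreal (besov_kernel k z u) * emeasure J (nbhd \<epsilon> u)"
        by (rule nn_integral_cmult_indicator) (simp add: sJ)
      then show "(\<integral>\<^sup>+w. ennreal (besov_kernel k z u) * indicator (nbhd \<epsilon> u) w \<partial>J) = ennreal (\<Phi> u)"
        using besov_kernel_nonneg[OF z u] by (simp add: \<Phi>_def ennreal_mult J.emeasure_eq_measure)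
    qed
    finally have "(\<integral>\<^sup>+w. ennreal (besov_kernel k z w) \<partial>J) \<le> ennreal c1 * (\<integral>\<^sup>+u. ennreal (\<Phi> u) \<partial>mobius_measure)" .
    also have "\<dots> \<le> ennreal c1 * ennreal (U * (c2 * t) powr (1 / p))" by (intro mult_left_mono \<Phi>int) simp
    also have "\<dots> = ennreal (c1 * (U * (c2 * t) powr (1 / p)))" using c12 U by (simp add: ennreal_mult)
    finally have nn: "(\<integral>\<^sup>+w. ennreal (besov_kernel k z w) \<partial>J) \<le> ennreal (c1 * (U * (c2 * t) powr (1 / p)))" .
    have "(\<integral>w. besov_kernel k z w \<partial>J) = enn2real (\<integral>\<^sup>+w. ennreal (besov_kernel k z w) \<partial>J)"
      by (rule integral_eq_nn_integral) (auto simp: mJ besov_kernel_nonneg[OF z])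
    then have "(\<integral>w. besov_kernel k z w \<partial>J) \<le> c1 * (U * (c2 * t) powr (1 / p))"
      using nn c12 U by (simp add: enn2real_leI)
    moreover have "0 \<le> (\<integral>w. besov_kernel k z w \<partial>J)"
      by (rule Bochner_Integration.integral_nonneg) (simp add: besov_kernel_nonneg[OF z])
    ultimately have "(\<integral>w. besov_kernel k z w \<partial>J) powr p \<le> (c1 * (U * (c2 * t) powr (1 / p))) powr p"
      using p by (intro powr_mono2) auto
    also have "\<dots> = c3 * t"
      using c12 U real p by (simp add: powr_mult powr_powr c3_def)
    finally have "ennreal ((\<integral>w. besov_kernel k z w \<partial>J) powr p) \<le> ennreal (c3 * t)" by (rule ennreal_leI)
    then show ?thesis using real c3 by (simp add: ennreal_mult)
  qed
  obtain c where c: "0 \<le> c" "\<And>w. w \<in> unit_disk \<Longrightarrow> (\<integral>\<^sup>+z. ennreal (besov_kernel k z w powr p) \<partial>mobius_measure) \<le> ennreal c"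
    using forelli_rudin[OF p(1) k] by blast
  have Tm: "T \<in> borel_measurable mobius_measure"
    unfolding T_def by (rule L.borel_measurable_nn_integral) (unfold case_prod_beta', measurable)
  have K2: "(\<lambda>z. besov_kernel k z v) \<in> borel_measurable disk_borel" for v
    unfolding besov_kernel_def by measurable
  have "(\<integral>\<^sup>+z. T z \<partial>mobius_measure) =
      (\<integral>\<^sup>+v. (\<integral>\<^sup>+z. ennreal (besov_kernel k z v powr p * \<Psi> v powr p) \<partial>mobius_measure) \<partial>mobius_measure)"
    unfolding T_def by (rule LL.Fubini'[symmetric]) (unfold case_prod_beta', measurable)
  also have "\<dots> \<le> (\<integral>\<^sup>+v. ennreal c * ennreal (\<Psi> v powr p) \<partial>mobius_measure)"
  proof (rule nn_integral_mono)
    fix v assume "v \<in> space mobius_measure"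
    then have v: "v \<in> unit_disk" by simp
    have "(\<integral>\<^sup>+z. ennreal (besov_kernel k z v powr p * \<Psi> v powr p) \<partial>mobius_measure) =
       (\<integral>\<^sup>+z. ennreal (besov_kernel k z v powr p) * ennreal (\<Psi> v powr p) \<partial>mobius_measure)"
      by (simp add: ennreal_mult)
    also have "\<dots> = (\<integral>\<^sup>+z. ennreal (besov_kernel k z v powr p) \<partial>mobius_measure) * ennreal (\<Psi> v powr p)"
      by (rule nn_integral_multc) (use K2 in \<open>simp add: measurable_mobius_eq\<close>)
    also have "\<dots> \<le> ennreal c * ennreal (\<Psi> v powr p)" by (intro mult_right_mono c(2) v) simp
    finally show "(\<integral>\<^sup>+z. ennreal (besov_kernel k z v powr p * \<Psi> v powr p) \<partial>mobius_measure) \<le> ennreal c * ennreal (\<Psi> v powr p)" .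
  qed
  also have "\<dots> = ennreal c * (\<integral>\<^sup>+v. ennreal (\<Psi> v powr p) \<partial>mobius_measure)"
    by (rule nn_integral_cmult) (simp add: measurable_mobius_eq)
  finally have TT: "(\<integral>\<^sup>+z. T z \<partial>mobius_measure) < \<infinity>"
    using fin by (auto simp: ennreal_mult_less_top intro: le_less_trans)
  have "(\<integral>\<^sup>+z. ennreal ((\<integral>w. besov_kernel k z w \<partial>J) powr p) \<partial>mobius_measure) \<le> (\<integral>\<^sup>+z. ennreal c3 * T z \<partial>mobius_measure)"
    by (intro nn_integral_mono main) simp
  also have "\<dots> = ennreal c3 * (\<integral>\<^sup>+z. T z \<partial>mobius_measure)" by (rule nn_integral_cmult[OF Tm])
  also have "\<dots> < \<infinity>" using TT by (auto simp: ennreal_mult_less_top)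
  finally show ?thesis .
qed

text \<open>The mean value inequality on the convex ball bounds all difference quotients by B, a
  constant that is integrable because M is finite; dominated convergence along sequences does the
  rest.\<close>

lemma has_field_derivative_integral:
  fixes \<phi> \<phi>' :: "complex \<Rightarrow> 'a \<Rightarrow> complex"
  assumes "finite_measure M" and d: "0 < d"
    and int: "\<And>y. y \<in> ball z d \<Longrightarrow> integrable M (\<phi> y)"
    and meas: "\<phi>' z \<in> borel_measurable M"
    and der: "\<And>y x. y \<in> ball z d \<Longrightarrow> x \<in> space M \<Longrightarrow> ((\<lambda>y. \<phi> y x) has_field_derivative \<phi>' y x) (at y)"
    and bound: "\<And>y x. y \<in> ball z d \<Longrightarrow> x \<in> space M \<Longrightarrow> cmod (\<phi>' y x) \<le> B"
  shows "((\<lambda>y. \<integral>x. \<phi> y x \<partial>M) has_field_derivative (\<integral>x. \<phi>' z x \<partial>M)) (at z)"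
proof -
  interpret finite_measure M by fact
  have "((\<lambda>y. ((\<integral>x. \<phi> y x \<partial>M) - (\<integral>x. \<phi> z x \<partial>M)) / (y - z)) \<longlongrightarrow> (\<integral>x. \<phi>' z x \<partial>M)) (at z)"
    unfolding tendsto_at_iff_sequentially
  proof (intro allI impI)
    fix X :: "nat \<Rightarrow> complex"
    assume X: "\<forall>i. X i \<in> UNIV - {z}" "X \<longlonglongrightarrow> z"
    obtain N where N: "\<And>n. n \<ge> N \<Longrightarrow> X n \<in> ball z d"
      using X(2) d unfolding tendsto_iff eventually_sequentially by (auto simp: dist_commute)
    define Y where "Y n = X (n + N)" for n
    have Y: "Y n \<in> ball z d" "Y n \<noteq> z" for n using N X(1) by (auto simp: Y_def)
    have Yl: "Y \<longlonglongrightarrow> z" unfolding Y_def using X(2) by (rule LIMSEQ_ignore_initial_segment)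
    have zd: "z \<in> ball z d" using d by simp
    have lim: "(\<lambda>n. \<integral>x. (\<phi> (Y n) x - \<phi> z x) / (Y n - z) \<partial>M) \<longlonglongrightarrow> (\<integral>x. \<phi>' z x \<partial>M)"
    proof (rule integral_dominated_convergence[where w="\<lambda>_. B"])
      show "\<phi>' z \<in> borel_measurable M" by (rule meas)
      show "(\<lambda>x. (\<phi> (Y n) x - \<phi> z x) / (Y n - z)) \<in> borel_measurable M" for n
        using int[OF Y(1)] int[OF zd] by (intro borel_measurable_divide borel_measurable_diff) auto
      show "integrable M (\<lambda>_. B)" by simp
      show "AE x in M. (\<lambda>n. (\<phi> (Y n) x - \<phi> z x) / (Y n - z)) \<longlonglongrightarrow> \<phi>' z x"
      proof (rule AE_I2)
        fix x assume x: "x \<in> space M"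
        have "((\<lambda>y. (\<phi> y x - \<phi> z x) / (y - z)) \<longlongrightarrow> \<phi>' z x) (at z)"
          using der[OF zd x] by (simp add: has_field_derivative_iff)
        then show "(\<lambda>n. (\<phi> (Y n) x - \<phi> z x) / (Y n - z)) \<longlonglongrightarrow> \<phi>' z x"
          unfolding tendsto_at_iff_sequentially comp_def using Y(2) Yl by auto
      qed
      show "AE x in M. norm ((\<phi> (Y n) x - \<phi> z x) / (Y n - z)) \<le> B" for n
      proof (rule AE_I2)
        fix x assume x: "x \<in> space M"
        have "norm (\<phi> (Y n) x - \<phi> z x) \<le> B * norm (Y n - z)"
          by (rule field_differentiable_bound[of "ball z d" _ "\<lambda>y. \<phi>' y x"])
             (use Y zd bound x in \<open>auto intro: has_field_derivative_at_within[OF der]\<close>)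
        then show "norm ((\<phi> (Y n) x - \<phi> z x) / (Y n - z)) \<le> B"
          using Y(2)[of n] by (simp add: norm_divide divide_le_eq)
      qed
    qed
    have eq: "(\<integral>x. (\<phi> (Y n) x - \<phi> z x) / (Y n - z) \<partial>M) = ((\<integral>x. \<phi> (Y n) x \<partial>M) - (\<integral>x. \<phi> z x \<partial>M)) / (Y n - z)" for n
      using int[OF Y(1)] int[OF zd] by simp
    from lim have "(\<lambda>n. ((\<integral>x. \<phi> (X (n + N)) x \<partial>M) - (\<integral>x. \<phi> z x \<partial>M)) / (X (n + N) - z)) \<longlonglongrightarrow> (\<integral>x. \<phi>' z x \<partial>M)"
      unfolding eq unfolding Y_def .
    then show "((\<lambda>y. ((\<integral>x. \<phi> y x \<partial>M) - (\<integral>x. \<phi> z x \<partial>M)) / (y - z)) \<circ> X) \<longlonglongrightarrow> (\<integral>x. \<phi>' z x \<partial>M)"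
      unfolding comp_def by (rule LIMSEQ_offset)
  qed
  then show ?thesis by (simp add: has_field_derivative_iff)
qed

text \<open>The m-th derivative in z of the kernel in closed form. One differentiation turns the
  numerator z - w into 1 - |w|^2, and each further one brings down a factor \<open>cnj w\<close>;
  hence order 0 stands apart.\<close>

fun kernel_deriv :: "nat \<Rightarrow> complex \<Rightarrow> complex \<Rightarrow> complex" where
  "kernel_deriv 0 z w = (z - w) / (1 - z * cnj w)"
| "kernel_deriv (Suc m) z w =
    fact (Suc m) * cnj w ^ m * of_real (1 - (cmod w)\<^sup>2) / (1 - z * cnj w) ^ (m + 2)"

lemma measurable_kernel_deriv [measurable]:
  "kernel_deriv m z \<in> borel_measurable disk_borel"
proof (cases m)
  case 0
  have "(\<lambda>w. (z - w) / (1 - z * cnj w)) \<in> borel_measurable disk_borel" by measurable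
  also have "(\<lambda>w. (z - w) / (1 - z * cnj w)) = kernel_deriv m z" by (simp add: 0 fun_eq_iff)
  finally show ?thesis .
next
  case (Suc n)
  have "(\<lambda>w. fact (Suc n) * cnj w ^ n * of_real (1 - (cmod w)\<^sup>2) / (1 - z * cnj w) ^ (n + 2)) \<in> borel_measurable disk_borel"
    by measurable
  also have "(\<lambda>w. fact (Suc n) * cnj w ^ n * of_real (1 - (cmod w)\<^sup>2) / (1 - z * cnj w) ^ (n + 2)) = kernel_deriv m z"
    by (simp only: Suc fun_eq_iff kernel_deriv.simps) simp
  finally show ?thesis .
qed

lemma kernel_deriv_has_derivative:
  assumes z: "z \<in> unit_disk" and w: "w \<in> unit_disk"
  shows "((\<lambda>z. kernel_deriv m z w) has_field_derivative kernel_deriv (Suc m) z w) (at z)"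
proof -
  have ne: "1 - z * cnj w \<noteq> 0" using norm_one_minus_mult_cnj_pos(2)[OF z w] by auto
  have d: "((\<lambda>z. 1 - z * cnj w) has_field_derivative (- cnj w)) (at z)"
    by (auto intro!: derivative_eq_intros)
  show ?thesis
  proof (cases m)
    case 0
    have e: "of_real (1 - (cmod w)\<^sup>2) = 1 - w * cnj w"
      by (simp only: of_real_diff complex_norm_square of_real_1)
    have "((\<lambda>z. (z - w) / (1 - z * cnj w)) has_field_derivative
        (1 * (1 - z * cnj w) - (z - w) * (- cnj w)) / ((1 - z * cnj w) * (1 - z * cnj w))) (at z)"
      by (rule DERIV_divide[OF _ d ne]) (auto intro!: derivative_eq_intros)
    moreover have "(1 * (1 - z * cnj w) - (z - w) * (- cnj w)) / ((1 - z * cnj w) * (1 - z * cnj w))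
      = kernel_deriv (Suc 0) z w"
      unfolding kernel_deriv.simps e by (simp add: power2_eq_square algebra_simps)
    ultimately show ?thesis by (simp only: 0 kernel_deriv.simps(1))
  next
    case (Suc n)
    define c where "c = fact (Suc n) * cnj w ^ n * of_real (1 - (cmod w)\<^sup>2)"
    have "((\<lambda>z. c / (1 - z * cnj w) ^ (n + 2)) has_field_derivative
        (0 * (1 - z * cnj w) ^ (n + 2) - c * (of_nat (n + 2) * (- cnj w * (1 - z * cnj w) ^ (n + 2 - Suc 0))))
          / ((1 - z * cnj w) ^ (n + 2) * (1 - z * cnj w) ^ (n + 2))) (at z)"
      using ne by (intro DERIV_divide DERIV_power d DERIV_const) auto
    moreover have "(0 * (1 - z * cnj w) ^ (n + 2) - c * (of_nat (n + 2) * (- cnj w * (1 - z * cnj w) ^ (n + 2 - Suc 0))))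
          / ((1 - z * cnj w) ^ (n + 2) * (1 - z * cnj w) ^ (n + 2)) = kernel_deriv (Suc m) z w"
    proof -
      define X where "X = 1 - z * cnj w"
      have X: "X \<noteq> 0" using ne by (simp add: X_def)
      have "(0 * X ^ (n + 2) - c * (of_nat (n + 2) * (- cnj w * X ^ (n + 2 - Suc 0)))) / (X ^ (n + 2) * X ^ (n + 2))
         = of_nat (n + 2) * c * cnj w * X ^ (n + 1) / (X ^ (n + 1) * (X * X ^ (n + 2)))"
        by (simp add: mult_ac)
      also have "\<dots> = of_nat (n + 2) * c * cnj w / (X * X ^ (n + 2))" using X by simp
      also have "\<dots> = kernel_deriv (Suc m) z w"
        by (simp add: Suc c_def X_def algebra_simps)
      finally show ?thesis unfolding X_def .
    qed
    moreover have "(\<lambda>z. kernel_deriv m z w) = (\<lambda>z. c / (1 - z * cnj w) ^ (n + 2))"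
      by (simp only: Suc c_def kernel_deriv.simps)
    ultimately show ?thesis by simp
  qed
qed

text \<open>A crude bound, uniform in \<open>w\<close>, used for domination and integrability only.
  The factor 2 is for order 0, where the numerator is z - w.\<close>

lemma norm_kernel_deriv_le:
  assumes z: "z \<in> unit_disk" and w: "w \<in> unit_disk" and \<rho>: "cmod z \<le> \<rho>" "\<rho> < 1"
  shows "cmod (kernel_deriv m z w) \<le> 2 * fact m / (1 - \<rho>) ^ (m + 1)"
proof -
  have x: "1 - \<rho> \<le> cmod (1 - z * cnj w)"
    using norm_one_minus_mult_cnj_pos(1)[OF z w] \<rho> by simp
  show ?thesis
  proof (cases m)
    case 0
    have "cmod (z - w) \<le> 2" using z w norm_triangle_ineq4[of z w] by simp
    then show ?thesis using x \<rho> by (auto simp: 0 norm_divide intro!: frac_le)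
  next
    case (Suc n)
    have "cmod (kernel_deriv m z w) = fact m * (cmod w ^ n * (1 - (cmod w)\<^sup>2)) / cmod (1 - z * cnj w) ^ (m + 1)"
    proof -
      have "cmod (of_real (1 - (cmod w)\<^sup>2)) = 1 - (cmod w)\<^sup>2"
        using one_minus_norm_square_pos[OF w] by (simp only: norm_of_real abs_of_pos)
      moreover have "cmod (fact m) = fact m" by (metis norm_of_nat of_nat_fact)
      ultimately show ?thesis
        by (simp add: Suc norm_divide norm_mult norm_power del: of_real_diff fact_Suc)
    qed
    also have "\<dots> \<le> (2 * fact m) / (1 - \<rho>) ^ (m + 1)"
    proof (rule frac_le)
      have "cmod w ^ n \<le> 1" using w by (simp add: power_le_one)
      then have "cmod w ^ n * (1 - (cmod w)\<^sup>2) \<le> 1 * 1"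
        using one_minus_norm_square_pos[OF w] by (intro mult_mono) auto
      then have "fact m * (cmod w ^ n * (1 - (cmod w)\<^sup>2)) \<le> fact m * (1 * 1)"
        by (intro mult_left_mono) auto
      then show "fact m * (cmod w ^ n * (1 - (cmod w)\<^sup>2)) \<le> 2 * fact m" by simp
      show "(1 - \<rho>) ^ (m + 1) \<le> cmod (1 - z * cnj w) ^ (m + 1)" using x \<rho> by (intro power_mono) auto
    qed (use \<rho> in auto)
    finally show ?thesis by simp
  qed
qed

lemma kernel_deriv_le_besov_kernel:
  assumes z: "z \<in> unit_disk" and w: "w \<in> unit_disk" and k: "0 < k"
  shows "(1 - (cmod z)\<^sup>2) ^ k * cmod (kernel_deriv k z w) \<le> fact k * besov_kernel k z w"
proof -
  obtain n where Suc: "k = Suc n" using k by (cases k) auto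
  have "cmod (of_real (1 - (cmod w)\<^sup>2)) = 1 - (cmod w)\<^sup>2"
    using one_minus_norm_square_pos[OF w] by (simp only: norm_of_real abs_of_pos)
  moreover have "cmod (fact k) = fact k" by (metis norm_of_nat of_nat_fact)
  ultimately have "cmod (kernel_deriv k z w) = cmod w ^ n * (fact k * (1 - (cmod w)\<^sup>2) / cmod (1 - z * cnj w) ^ (k + 1))"
    by (simp add: Suc norm_divide norm_mult norm_power del: of_real_diff fact_Suc)
  also have "\<dots> \<le> 1 * (fact k * (1 - (cmod w)\<^sup>2) / cmod (1 - z * cnj w) ^ (k + 1))"
    using w one_minus_norm_square_pos[OF w] by (intro mult_right_mono) (auto simp: power_le_one)
  finally have "(1 - (cmod z)\<^sup>2) ^ k * cmod (kernel_deriv k z w) \<le>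
      (1 - (cmod z)\<^sup>2) ^ k * (1 * (fact k * (1 - (cmod w)\<^sup>2) / cmod (1 - z * cnj w) ^ (k + 1)))"
    using one_minus_norm_square_pos[OF z] by (intro mult_left_mono) auto
  then show ?thesis by (simp add: besov_kernel_def mult_ac)
qed

lemma kernel_deriv_integrable:
  assumes "finite_measure J" and sJ [measurable_cong]: "sets J = sets disk_borel" and z: "z \<in> unit_disk"
  shows "integrable J (kernel_deriv m z)"
proof -
  interpret finite_measure J by fact
  have sp: "space J = unit_disk" using sets_eq_imp_space_eq[OF sJ] by simp
  show ?thesis
    by (rule integrable_const_bound[where B="2 * fact m / (1 - cmod z) ^ (m + 1)"])
       (use z norm_kernel_deriv_le[OF z _ order_refl] sp in \<open>auto intro!: AE_I2 simp: measurable_cong_sets[OF sJ refl]\<close>)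
qed

lemma kernel_integral_has_derivative:
  assumes J: "finite_measure J" and sJ: "sets J = sets disk_borel" and z: "z \<in> unit_disk"
  shows "((\<lambda>z. \<integral>w. kernel_deriv m z w \<partial>J) has_field_derivative (\<integral>w. kernel_deriv (Suc m) z w \<partial>J)) (at z)"
proof (rule has_field_derivative_integral[OF J])
  \<comment> \<open>Half the distance to the unit circle: on this ball |y| <= 1 - d, which makes the
    derivative bound uniform in y.\<close>
  define d where "d = (1 - cmod z) / 2"
  have sp: "space J = unit_disk" using sets_eq_imp_space_eq[OF sJ] by simp
  show "0 < d" using z by (simp add: d_def)
  have y: "y \<in> unit_disk" "cmod y \<le> 1 - d" if "y \<in> ball z d" for y
  proof -
    have "cmod y \<le> cmod z + dist z y" by (rule norm_diff_le_dist)
    then show "cmod y \<le> 1 - d" using that by (simp add: d_def field_simps)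
    then show "y \<in> unit_disk" using \<open>0 < d\<close> by simp
  qed
  show "integrable J (kernel_deriv m y)" if "y \<in> ball z d" for y
    by (rule kernel_deriv_integrable[OF J sJ y(1)[OF that]])
  show "kernel_deriv (Suc m) z \<in> borel_measurable J"
    using kernel_deriv_integrable[OF J sJ z] by auto
  show "((\<lambda>y. kernel_deriv m y x) has_field_derivative kernel_deriv (Suc m) y x) (at y)"
    if "y \<in> ball z d" "x \<in> space J" for y x
    using that(2) sp y(1)[OF that(1)] by (intro kernel_deriv_has_derivative) auto
  show "cmod (kernel_deriv (Suc m) y x) \<le> 2 * fact (Suc m) / (1 - (1 - d)) ^ (Suc m + 1)"
    if "y \<in> ball z d" "x \<in> space J" for y x
    using that(2) sp y[OF that(1)] \<open>0 < d\<close> by (intro norm_kernel_deriv_le) auto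
qed

section \<open>Higher derivatives of the represented function\<close>

lemma higher_deriv_eqI:
  fixes f :: "complex \<Rightarrow> complex"
  assumes S: "open S" and f: "\<And>z. z \<in> S \<Longrightarrow> f z = L 0 z"
    and L: "\<And>m z. z \<in> S \<Longrightarrow> (L m has_field_derivative L (Suc m) z) (at z)"
    and z: "z \<in> S"
  shows "(deriv ^^ m) f z = L m z"
  using z
proof (induction m arbitrary: z)
  case 0
  then show ?case using f by simp
next
  case (Suc m)
  have "((deriv ^^ m) f has_field_derivative L (Suc m) z) (at z)"
    by (rule has_field_derivative_transform_within_open[OF L[OF Suc.prems] S Suc.prems]) (simp add: Suc.IH)
  then show ?case by (simp add: DERIV_imp_deriv)
qed

lemma powr_add_le_two_powr:
  fixes a b :: real
  assumes "0 \<le> a" "0 \<le> b" "0 \<le> p"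
  shows "(a + b) powr p \<le> 2 powr p * (a powr p + b powr p)"
proof -
  have "(a + b) powr p \<le> (2 * max a b) powr p" using assms by (intro powr_mono2) auto
  also have "\<dots> = 2 powr p * max a b powr p" using assms by (simp add: powr_mult)
  also have "max a b powr p \<le> a powr p + b powr p" by (auto simp: max_def)
  finally show ?thesis by simp
qed

lemma nn_integral_powr_add_finite:
  assumes a: "a \<in> borel_measurable M" "\<And>x. x \<in> space M \<Longrightarrow> 0 \<le> a x"
    and b: "b \<in> borel_measurable M" "\<And>x. x \<in> space M \<Longrightarrow> 0 \<le> b x" and p: "0 \<le> (p::real)"
    and fa: "(\<integral>\<^sup>+x. ennreal (a x powr p) \<partial>M) < \<infinity>" and fb: "(\<integral>\<^sup>+x. ennreal (b x powr p) \<partial>M) < \<infinity>"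
  shows "(\<integral>\<^sup>+x. ennreal ((a x + b x) powr p) \<partial>M) < \<infinity>"
proof -
  note [measurable] = a(1) b(1)
  have "(\<integral>\<^sup>+x. ennreal ((a x + b x) powr p) \<partial>M) \<le>
     (\<integral>\<^sup>+x. ennreal (2 powr p) * (ennreal (a x powr p) + ennreal (b x powr p)) \<partial>M)"
  proof (rule nn_integral_mono)
    fix x assume "x \<in> space M"
    then have "ennreal ((a x + b x) powr p) \<le> ennreal (2 powr p * (a x powr p + b x powr p))"
      using a b p by (intro ennreal_leI powr_add_le_two_powr) auto
    then show "ennreal ((a x + b x) powr p) \<le> ennreal (2 powr p) * (ennreal (a x powr p) + ennreal (b x powr p))"
      by (simp add: ennreal_mult)
  qed
  also have "\<dots> = ennreal (2 powr p) * ((\<integral>\<^sup>+x. ennreal (a x powr p) \<partial>M) + (\<integral>\<^sup>+x. ennreal (b x powr p) \<partial>M))"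
    by (subst nn_integral_cmult, measurable, subst nn_integral_add, measurable)
  also have "\<dots> < \<infinity>" using fa fb by (auto simp: ennreal_mult_less_top)
  finally show ?thesis .
qed

lemma Lp_space_nn_integral_finite:
  assumes "g \<in> Lp_space p M"
  shows "(\<integral>\<^sup>+x. ennreal (norm (g x) powr p) \<partial>M) < \<infinity>"
  using assms by (auto simp: Lp_space_def integrable_iff_bounded)

lemma Lp_spaceI:
  assumes "g \<in> borel_measurable M" "(\<integral>\<^sup>+x. ennreal (norm (g x) powr p) \<partial>M) < \<infinity>"
  shows "g \<in> Lp_space p M"
proof -
  note [measurable] = assms(1)
  have "(\<lambda>x. norm (g x) powr p) \<in> borel_measurable M" by measurable
  then show ?thesis using assms by (auto simp: Lp_space_def intro!: integrableI_bounded)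
qed

lemma continuous_on_weighted_higher_deriv:
  fixes f :: "complex \<Rightarrow> complex"
  assumes "f holomorphic_on unit_disk"
  shows "continuous_on unit_disk (\<lambda>z. (1 - (cmod z)\<^sup>2) ^ k *\<^sub>R (deriv ^^ k) f z)"
  using assms
  by (intro continuous_intros holomorphic_on_imp_continuous_on holomorphic_higher_deriv) auto

text \<open>By its definition the integral against \<mu> combines four integrals against positive
  measures, each dominated by the total variation. Each is differentiated k times under the integral
  sign and estimated by \<open>kernel_integral_bound\<close>.\<close>

lemma besov_space_if_representation:
  assumes p: "0 < p" "p \<le> 1" and r: "0 < r" "r < 1" and k: "0 < k" "p * real k > 1"
    and f: "f analytic_on unit_disk" and \<mu>: "complex_measure disk_borel \<mu>"
    and TV: "(\<lambda>z. enn2real (total_variation disk_borel \<mu> (pseudohyperbolic_disk z r))) \<in> Lp_space p mobius_measure"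
    and rep: "\<And>z. z \<in> unit_disk \<Longrightarrow>
      f z = complex_measure_integral disk_borel \<mu> (\<lambda>w. (z - w) / (1 - z * cnj w))"
  shows "f \<in> besov_space k p"
proof -
  define \<Psi> where "\<Psi> z = enn2real (total_variation disk_borel \<mu> (pseudohyperbolic_disk z r))" for z
  have \<Psi>m: "\<Psi> \<in> borel_measurable disk_borel"
    using TV by (simp add: Lp_space_def \<Psi>_def[abs_def] measurable_mobius_eq)
  have \<Psi>fin: "(\<integral>\<^sup>+z. ennreal (\<Psi> z powr p) \<partial>mobius_measure) < \<infinity>"
    using Lp_space_nn_integral_finite[OF TV] by (simp add: \<Psi>_def)
  note parts = complex_measure_parts[OF \<mu>]
  \<comment> \<open>The indices 0 to 3 stand for the positive and negative Jordan parts of Re \<mu>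
    and then of Im \<mu>, so the four can be treated uniformly.\<close>
  define \<nu> where "\<nu> i = (if i = (0::nat) then (\<lambda>E. Re (\<mu> E)) else if i = 1 then (\<lambda>E. - Re (\<mu> E))
     else if i = 2 then (\<lambda>E. Im (\<mu> E)) else (\<lambda>E. - Im (\<mu> E)))" for i
  define J where "J i = jordan_pos disk_borel (\<nu> i)" for i
  have \<nu>: "signed_additive disk_borel (\<nu> i)" for i
    using parts by (auto simp: \<nu>_def intro: signed_additive_uminus)
  have \<nu>le: "\<nu> i E \<le> cmod (\<mu> E)" for i E
    using abs_Re_le_cmod[of "\<mu> E"] abs_Im_le_cmod[of "\<mu> E"] by (auto simp: \<nu>_def)
  have J: "finite_measure (J i)" "sets (J i) = sets disk_borel" for i
    unfolding J_def using \<nu> by (auto intro: finite_measure_jordan_pos)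
  have J\<Psi>: "emeasure (J i) (pseudohyperbolic_disk z r) \<le> ennreal (\<Psi> z)" if z: "z \<in> unit_disk" for i z
  proof -
    have D: "pseudohyperbolic_disk z r \<in> sets disk_borel" by (rule sets_pseudohyperbolic_disk[OF z])
    have "emeasure (J i) (pseudohyperbolic_disk z r) \<le> total_variation disk_borel \<mu> (pseudohyperbolic_disk z r)"
      unfolding J_def by (rule emeasure_jordan_pos_le_total_variation[OF \<mu> \<nu> \<nu>le D])
    also have "\<dots> = ennreal (\<Psi> z)"
      using total_variation_finite[OF \<mu> D] by (simp add: \<Psi>_def ennreal_enn2real less_top)
    finally show ?thesis .
  qed
  define \<kappa> where "\<kappa> i z = (\<integral>w. besov_kernel k z w \<partial>J i)" for i z
  have \<kappa>fin: "(\<integral>\<^sup>+z. ennreal (\<kappa> i z powr p) \<partial>mobius_measure) < \<infinity>" for i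
    unfolding \<kappa>_def
    by (rule kernel_integral_bound[OF J p k(2) r \<Psi>m _ J\<Psi> \<Psi>fin]) (auto simp: \<Psi>_def)
  have \<kappa>m: "\<kappa> i \<in> borel_measurable mobius_measure" for i
  proof -
    interpret finite_measure "J i" by (rule J)
    note J(2)[of i, measurable_cong]
    show ?thesis unfolding \<kappa>_def
      by (rule borel_measurable_lebesgue_integral) (unfold case_prod_beta', measurable)
  qed
  have spJ: "space (J i) = unit_disk" for i using sets_eq_imp_space_eq[OF J(2)[of i]] by simp
  have \<kappa>0: "0 \<le> \<kappa> i z" if "z \<in> unit_disk" for i z
    unfolding \<kappa>_def using that spJ by (intro Bochner_Integration.integral_nonneg besov_kernel_nonneg) auto
  define A where "A i m z = (\<integral>w. kernel_deriv m z w \<partial>J i)" for i m z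
  define L where "L m z = (A 0 m z - A 1 m z) + \<i> * (A 2 m z - A 3 m z)" for m z
  have fL: "f z = L 0 z" if z: "z \<in> unit_disk" for z
    unfolding rep[OF z] complex_measure_integral_def signed_integral_def L_def A_def J_def \<nu>_def
    by (simp add: ext[of "kernel_deriv 0 z" "\<lambda>w. (z - w) / (1 - z * cnj w)"])
  have Lder: "(L m has_field_derivative L (Suc m) z) (at z)" if z: "z \<in> unit_disk" for m z
  proof -
    have "(A i m has_field_derivative A i (Suc m) z) (at z)" for i
      unfolding A_def by (rule kernel_integral_has_derivative[OF J z])
    then show ?thesis unfolding L_def
      by (intro DERIV_add DERIV_diff DERIV_cmult) auto
  qed
  have fk: "(deriv ^^ k) f z = L k z" if "z \<in> unit_disk" for z
    by (rule higher_deriv_eqI[OF open_ball fL Lder that])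
  have Abd: "(1 - (cmod z)\<^sup>2) ^ k * cmod (A i k z) \<le> fact k * \<kappa> i z" if z: "z \<in> unit_disk" for i z
  proof -
    have int: "integrable (J i) (kernel_deriv k z)" by (rule kernel_deriv_integrable[OF J z])
    interpret finite_measure "J i" by (rule J)
    have m: "0 \<le> (1 - (cmod z)\<^sup>2) ^ k" using one_minus_norm_square_pos[OF z] by simp
    have Kint: "integrable (J i) (besov_kernel k z)"
    proof (rule integrable_const_bound[where B="(1 - (cmod z)\<^sup>2) ^ k / (1 - cmod z) ^ (k + 1)"])
      show "besov_kernel k z \<in> borel_measurable (J i)"
        using measurable_besov_kernel by (simp add: measurable_cong_sets[OF J(2) refl])
      show "AE w in J i. norm (besov_kernel k z w) \<le> (1 - (cmod z)\<^sup>2) ^ k / (1 - cmod z) ^ (k + 1)"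
      proof (rule AE_I2)
        fix w assume "w \<in> space (J i)"
        then have w: "w \<in> unit_disk" by (simp add: spJ)
        have "(1 - (cmod z)\<^sup>2) ^ k * (1 - (cmod w)\<^sup>2) \<le> (1 - (cmod z)\<^sup>2) ^ k * 1"
          using m by (intro mult_left_mono) auto
        moreover have "(1 - cmod z) ^ (k + 1) \<le> cmod (1 - z * cnj w) ^ (k + 1)"
          using norm_one_minus_mult_cnj_pos[OF z w] z by (intro power_mono) auto
        ultimately have "besov_kernel k z w \<le> (1 - (cmod z)\<^sup>2) ^ k / (1 - cmod z) ^ (k + 1)"
          unfolding besov_kernel_def using z m by (intro frac_le) auto
        then show "norm (besov_kernel k z w) \<le> (1 - (cmod z)\<^sup>2) ^ k / (1 - cmod z) ^ (k + 1)"
          using besov_kernel_nonneg[OF z w] by simp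
      qed
    qed
    have "(1 - (cmod z)\<^sup>2) ^ k * cmod (A i k z) \<le> (1 - (cmod z)\<^sup>2) ^ k * (\<integral>w. cmod (kernel_deriv k z w) \<partial>J i)"
      unfolding A_def by (intro mult_left_mono m integral_norm_bound)
    also have "\<dots> = (\<integral>w. (1 - (cmod z)\<^sup>2) ^ k * cmod (kernel_deriv k z w) \<partial>J i)" by simp
    also have "\<dots> \<le> (\<integral>w. fact k * besov_kernel k z w \<partial>J i)"
      using int Kint kernel_deriv_le_besov_kernel[OF z _ k(1)] by (intro integral_mono) (auto simp: spJ)
    also have "\<dots> = fact k * \<kappa> i z" by (simp add: \<kappa>_def)
    finally show ?thesis .
  qed
  define g where "g z = (1 - (cmod z)\<^sup>2) ^ k *\<^sub>R (deriv ^^ k) f z" for z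
  have gbd: "norm (g z) \<le> fact k * ((\<kappa> 0 z + \<kappa> 1 z) + (\<kappa> 2 z + \<kappa> 3 z))" if z: "z \<in> unit_disk" for z
  proof -
    have m: "0 \<le> (1 - (cmod z)\<^sup>2) ^ k" using one_minus_norm_square_pos[OF z] by simp
    have "cmod (L k z) \<le> cmod (A 0 k z - A 1 k z) + cmod (\<i> * (A 2 k z - A 3 k z))"
      unfolding L_def by (rule norm_triangle_ineq)
    also have "\<dots> \<le> (cmod (A 0 k z) + cmod (A 1 k z)) + (cmod (A 2 k z) + cmod (A 3 k z))"
      unfolding norm_mult by (intro add_mono) (auto intro: norm_triangle_ineq4)
    finally have "norm (g z) \<le> (1 - (cmod z)\<^sup>2) ^ k * ((cmod (A 0 k z) + cmod (A 1 k z)) + (cmod (A 2 k z) + cmod (A 3 k z)))"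
      using m by (simp add: g_def fk[OF z] mult_left_mono)
    also have "\<dots> \<le> fact k * ((\<kappa> 0 z + \<kappa> 1 z) + (\<kappa> 2 z + \<kappa> 3 z))"
      using Abd[OF z, of 0] Abd[OF z, of 1] Abd[OF z, of 2] Abd[OF z, of 3] by (simp add: distrib_left)
    finally show ?thesis .
  qed
  have fin4: "(\<integral>\<^sup>+z. ennreal (((\<kappa> 0 z + \<kappa> 1 z) + (\<kappa> 2 z + \<kappa> 3 z)) powr p) \<partial>mobius_measure) < \<infinity>"
    using \<kappa>0 p by (intro nn_integral_powr_add_finite borel_measurable_add \<kappa>m \<kappa>fin) auto
  have "g \<in> Lp_space p mobius_measure"
  proof (rule Lp_spaceI)
    have hf: "f holomorphic_on unit_disk" using f by (rule analytic_imp_holomorphic)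
    show "g \<in> borel_measurable mobius_measure"
      unfolding g_def measurable_mobius_eq
      by (rule measurable_disk_continuous[OF continuous_on_weighted_higher_deriv[OF hf]])
    have "(\<integral>\<^sup>+z. ennreal (norm (g z) powr p) \<partial>mobius_measure) \<le>
      (\<integral>\<^sup>+z. ennreal (fact k powr p) * ennreal (((\<kappa> 0 z + \<kappa> 1 z) + (\<kappa> 2 z + \<kappa> 3 z)) powr p) \<partial>mobius_measure)"
    proof (rule nn_integral_mono)
      fix z assume "z \<in> space mobius_measure"
      then have z: "z \<in> unit_disk" by simp
      have "norm (g z) powr p \<le> (fact k * ((\<kappa> 0 z + \<kappa> 1 z) + (\<kappa> 2 z + \<kappa> 3 z))) powr p"
        using gbd[OF z] p by (intro powr_mono2) auto
      also have "\<dots> = fact k powr p * ((\<kappa> 0 z + \<kappa> 1 z) + (\<kappa> 2 z + \<kappa> 3 z)) powr p"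
        by (rule powr_mult)
      finally show "ennreal (norm (g z) powr p) \<le> ennreal (fact k powr p) * ennreal (((\<kappa> 0 z + \<kappa> 1 z) + (\<kappa> 2 z + \<kappa> 3 z)) powr p)"
        by (subst ennreal_mult[symmetric]) (auto intro: ennreal_leI)
    qed
    also have "\<dots> = ennreal (fact k powr p) * (\<integral>\<^sup>+z. ennreal (((\<kappa> 0 z + \<kappa> 1 z) + (\<kappa> 2 z + \<kappa> 3 z)) powr p) \<partial>mobius_measure)"
      by (rule nn_integral_cmult) (use \<kappa>m in measurable)
    also have "\<dots> < \<infinity>" using fin4 by (auto simp: ennreal_mult_less_top)
    finally show "(\<integral>\<^sup>+z. ennreal (norm (g z) powr p) \<partial>mobius_measure) < \<infinity>" .
  qed
  then show ?thesis using f by (simp add: besov_space_def g_def[abs_def])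
qed

section \<open>From the Besov space to a representing measure\<close>

text \<open>Moving the centre s z of a Taylor polynomial produces a telescoping derivative: what
  differentiating the power yields in one term cancels the derivative of f in the previous one. Only
  the integrand of the remainder survives. Here s is complex, so that complex differentiation rules
  apply; it is restricted to a real segment later.\<close>

lemma taylor_segment_derivative:
  fixes f :: "complex \<Rightarrow> complex"
  assumes f: "f holomorphic_on S" and S: "open S" and sz: "s * z \<in> S"
  shows "((\<lambda>s. \<Sum>j<Suc n. (deriv ^^ j) f (s * z) * ((1 - s) * z) ^ j / fact j) has_field_derivative
    z ^ Suc n * (1 - s) ^ n / fact n * (deriv ^^ Suc n) f (s * z)) (at s)"
proof (induction n)
  have fd: "((\<lambda>s. (deriv ^^ j) f (s * z)) has_field_derivative (deriv ^^ Suc j) f (s * z) * z) (at s)" for j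
  proof -
    have "(deriv ^^ j) f holomorphic_on S" by (rule holomorphic_higher_deriv[OF f S])
    then have "((deriv ^^ j) f has_field_derivative deriv ((deriv ^^ j) f) (s * z)) (at (s * z))"
      using S sz by (rule holomorphic_derivI)
    moreover have "((\<lambda>s. s * z) has_field_derivative z) (at s)"
      by (auto intro!: derivative_eq_intros)
    ultimately show ?thesis using DERIV_chain2 by fastforce
  qed
  case 0
  show ?case using fd[of 0] by (simp add: mult.commute)
  case (Suc n)
  have e1: "((\<lambda>s. (1 - s) * z) has_field_derivative (- z)) (at s)"
    by (auto intro!: derivative_eq_intros)
  have "((\<lambda>s. ((1 - s) * z) ^ Suc n) has_field_derivative of_nat (Suc n) * ((- z) * ((1 - s) * z) ^ n)) (at s)"
    using DERIV_power[OF e1, of "Suc n"] by simp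
  from DERIV_mult[OF fd[of "Suc n"] this]
  have "((\<lambda>s. (deriv ^^ Suc n) f (s * z) * ((1 - s) * z) ^ Suc n) has_field_derivative
     ((deriv ^^ Suc (Suc n)) f (s * z) * z) * ((1 - s) * z) ^ Suc n
     + of_nat (Suc n) * ((- z) * ((1 - s) * z) ^ n) * (deriv ^^ Suc n) f (s * z)) (at s)" .
  from DERIV_add[OF Suc.IH DERIV_cdivide[OF this, of "fact (Suc n)"]]
  have "((\<lambda>s. \<Sum>j<Suc (Suc n). (deriv ^^ j) f (s * z) * ((1 - s) * z) ^ j / fact j) has_field_derivative
     z ^ Suc n * (1 - s) ^ n / fact n * (deriv ^^ Suc n) f (s * z) +
     (((deriv ^^ Suc (Suc n)) f (s * z) * z) * ((1 - s) * z) ^ Suc n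
     + of_nat (Suc n) * ((- z) * ((1 - s) * z) ^ n) * (deriv ^^ Suc n) f (s * z)) / fact (Suc n)) (at s)"
    by (simp only: sum.lessThan_Suc[of _ "Suc n"])
  moreover have "z ^ Suc n * (1 - s) ^ n / fact n * D + (D' * z * ((1 - s) * z) ^ Suc n
     + of_nat (Suc n) * ((- z) * ((1 - s) * z) ^ n) * D) / fact (Suc n)
     = z ^ Suc (Suc n) * (1 - s) ^ Suc n / fact (Suc n) * D'" for D D' :: complex
  proof -
    have "of_nat (Suc n) * ((- z) * ((1 - s) * z) ^ n) * D / fact (Suc n) = - (z ^ Suc n * (1 - s) ^ n / fact n * D)"
      by (simp add: power_mult_distrib divide_simps del: of_nat_Suc)
    moreover have "D' * z * ((1 - s) * z) ^ Suc n / fact (Suc n) = z ^ Suc (Suc n) * (1 - s) ^ Suc n / fact (Suc n) * D'"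
      by (simp add: power_mult_distrib mult_ac)
    ultimately show ?thesis by (simp only: add_divide_distrib) simp
  qed
  ultimately show ?case by simp
qed

text \<open>Not a polynomial in u: the centre u/2 moves along with the point of evaluation.\<close>

definition half_taylor :: "nat \<Rightarrow> (complex \<Rightarrow> complex) \<Rightarrow> complex \<Rightarrow> complex" where
  "half_taylor k f u = (\<Sum>j<k. (deriv ^^ j) f (u / 2) * (u / 2) ^ j / fact j)"

lemma half_taylor_holomorphic:
  assumes f: "f holomorphic_on unit_disk"
  shows "half_taylor k f holomorphic_on ball 0 2"
proof -
  have "(\<lambda>u. (deriv ^^ j) f (u / 2)) holomorphic_on ball 0 2" for j
    by (rule holomorphic_on_compose_gen[of "\<lambda>u. u / 2" _ _ unit_disk, unfolded o_def])
       (auto intro!: holomorphic_intros holomorphic_higher_deriv f simp: norm_divide)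
  then show ?thesis unfolding half_taylor_def[abs_def] by (intro holomorphic_intros) auto
qed

lemma half_taylor_remainder:
  assumes f: "f holomorphic_on unit_disk" and k: "0 < k" and z: "z \<in> unit_disk"
  shows "((\<lambda>t. z ^ k * of_real (1 - t) ^ (k - 1) / fact (k - 1) * (deriv ^^ k) f (of_real t * z))
    has_integral (f z - half_taylor k f z)) {1/2..1::real}"
proof -
  obtain n where Suc: "k = Suc n" using k by (cases k) auto
  define \<Theta> where "\<Theta> s = (\<Sum>j<Suc n. (deriv ^^ j) f (s * z) * ((1 - s) * z) ^ j / fact j)" for s
  have "((\<lambda>t::real. z ^ Suc n * (1 - of_real t) ^ n / fact n * (deriv ^^ Suc n) f (of_real t * z))
     has_integral \<Theta> (of_real 1) - \<Theta> (of_real (1/2))) {1/2..1}"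
  proof (rule fundamental_theorem_of_calculus)
    fix t :: real assume t: "t \<in> {1/2..1}"
    have "cmod (of_real t * z) \<le> cmod z" using t by (simp add: norm_mult mult_left_le_one_le)
    then have "of_real t * z \<in> unit_disk" using z by simp
    from taylor_segment_derivative[OF f open_ball this, of n]
    show "((\<lambda>t. \<Theta> (of_real t)) has_vector_derivative
       z ^ Suc n * (1 - of_real t) ^ n / fact n * (deriv ^^ Suc n) f (of_real t * z)) (at t within {1/2..1})"
      unfolding \<Theta>_def by (rule has_vector_derivative_real_field)
  qed simp
  \<comment> \<open>At s = 1 every term with j > 0 carries a vanishing power.\<close>
  moreover have "\<Theta> (of_real 1) = f z"
    unfolding \<Theta>_def by (subst sum.lessThan_Suc_shift) simp
  moreover have "\<Theta> (of_real (1/2)) = half_taylor k f z"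
    unfolding \<Theta>_def half_taylor_def Suc by simp
  ultimately show ?thesis by (simp add: Suc)
qed

section \<open>Means of the kernel over circles\<close>

lemma integral_disk_area_of_circle_average:
  fixes F :: "complex \<Rightarrow> complex" and g :: "real \<Rightarrow> complex"
  assumes F: "integrable disk_area F" and ab: "0 \<le> a" "b \<le> 1"
    and cont: "continuous_on {a..b} g"
    and avg: "\<And>w. w \<in> unit_disk \<Longrightarrow>
      (\<integral>\<theta>. F (cis (2 * pi * \<theta>) * w) \<partial>unit_interval) = indicat_real {a..b} ((cmod w)\<^sup>2) *\<^sub>R g ((cmod w)\<^sup>2)"
  shows "(\<integral>w. F w \<partial>disk_area) = integral {a..b} g"
proof -
  have gm: "(\<lambda>t. indicat_real {a..b} t *\<^sub>R g t) \<in> borel_measurable borel"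
    using cont by (intro borel_measurable_continuous_on_indicator) auto
  have "(\<integral>w. F w \<partial>disk_area) = (\<integral>w. indicat_real {a..b} ((cmod w)\<^sup>2) *\<^sub>R g ((cmod w)\<^sup>2) \<partial>disk_area)"
    unfolding integral_disk_area_average[OF F] by (intro Bochner_Integration.integral_cong avg) auto
  also have "\<dots> = (\<integral>t. indicat_real {a..b} t *\<^sub>R g t \<partial>unit_interval)"
    by (rule integral_disk_area_radial[OF gm])
  also have "\<dots> = (\<integral>t. indicat_real {0..1} t *\<^sub>R (indicat_real {a..b} t *\<^sub>R g t) \<partial>lborel)"
    by (rule integral_restrict_space) auto
  also have "\<dots> = (LINT t:{a..b}|lborel. g t)"
    unfolding set_lebesgue_integral_def using ab
    by (intro Bochner_Integration.integral_cong) (auto simp: indicator_def)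
  also have "\<dots> = integral {a..b} g"
    by (rule set_borel_integral_eq_integral(2)[OF borel_integrable_atLeastAtMost'[OF cont]])
  finally show ?thesis .
qed

lemma circle_kernel_identity:
  assumes \<zeta>: "\<zeta> \<noteq> 0" and t: "of_real t = \<zeta> * cnj \<zeta>"
  shows "cnj \<zeta> = of_real t / \<zeta>" "(z - \<zeta>) / (1 - z * cnj \<zeta>) = (z - \<zeta>) * \<zeta> / (\<zeta> - of_real t * z)"
proof -
  show c: "cnj \<zeta> = of_real t / \<zeta>" using \<zeta> t by simp
  have "1 - z * (of_real t / \<zeta>) = (\<zeta> - of_real t * z) / \<zeta>" using \<zeta> by (simp add: field_simps)
  then show "(z - \<zeta>) / (1 - z * cnj \<zeta>) = (z - \<zeta>) * \<zeta> / (\<zeta> - of_real t * z)" unfolding c by simp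
qed

text \<open>On the circle \<open>|\<zeta>|\<^sup>2 = t\<close> one has \<open>cnj \<zeta> = t / \<zeta>\<close>, which turns the averages below into Cauchy integrals
  with pole at \<open>t z\<close>.\<close>

lemma circle_average_main:
  assumes f: "f holomorphic_on unit_disk" and k: "2 \<le> k" and z: "z \<in> unit_disk"
    and w: "w \<in> unit_disk" "w \<noteq> 0"
  defines "t \<equiv> (cmod w)\<^sup>2"
  defines "F \<equiv> \<lambda>w. of_real (1 - (cmod w)\<^sup>2) ^ (k - 2) * (deriv ^^ k) f w / (fact (k - 1) * cnj w ^ (k - 1))
      * ((z - w) / (1 - z * cnj w))"
  shows "(\<integral>\<theta>. F (cis (2 * pi * \<theta>) * w) \<partial>unit_interval) =
    z ^ k * of_real (1 - t) ^ (k - 1) / fact (k - 1) * (deriv ^^ k) f (of_real t * z)"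
proof -
  have t0: "0 < t" using w by (simp add: t_def)
  obtain n where n: "k = Suc (Suc n)" using k by (metis add_2_eq_Suc le_Suc_ex)
  \<comment> \<open>With n = k - 2, the factor 1 / \<open>cnj \<zeta> ^ (k - 1)\<close> equals
    \<zeta>^(n+1) / t^(n+1) on the circle, so \<open>c\<close> gathers everything that depends on t
    alone. At the pole t z the powers of t cancel and z - t z contributes the last factor (1 - t)
    z.\<close>
  define c :: complex where "c = of_real (1 - t) ^ n / (fact (Suc n) * of_real t ^ Suc n)"
  define G where "G u = c * ((deriv ^^ k) f u * u ^ Suc n * (z - u))" for u
  have G: "G holomorphic_on ball 0 1"
    unfolding G_def by (intro holomorphic_intros holomorphic_higher_deriv f) auto
  have v: "cmod (of_real t * z) < cmod w"
  proof -
    have "cmod (of_real t * z) = cmod w * (cmod w * cmod z)" by (simp add: norm_mult t_def power2_eq_square)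
    also have "\<dots> < cmod w * 1"
    proof (rule mult_strict_left_mono)
      have "cmod w * cmod z \<le> cmod z" using w by (simp add: mult_left_le_one_le)
      then show "cmod w * cmod z < 1" using z by simp
    qed (use w in simp)
    finally show ?thesis by simp
  qed
  have FG: "F \<zeta> = G \<zeta> * \<zeta> / (\<zeta> - of_real t * z)" if \<zeta>: "\<zeta> = cis (2 * pi * \<theta>) * w" for \<zeta> \<theta>
  proof -
    have n\<zeta>: "(cmod \<zeta>)\<^sup>2 = t" by (simp add: \<zeta> norm_mult t_def)
    have \<zeta>0: "\<zeta> \<noteq> 0" using w by (simp add: \<zeta>)
    have tt: "of_real t = \<zeta> * cnj \<zeta>" by (simp only: n\<zeta>[symmetric] complex_norm_square)
    note id = circle_kernel_identity[OF \<zeta>0 tt]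
    have "F \<zeta> = of_real (1 - t) ^ n * (deriv ^^ k) f \<zeta> / (fact (Suc n) * (of_real t / \<zeta>) ^ Suc n)
      * ((z - \<zeta>) * \<zeta> / (\<zeta> - of_real t * z))"
      unfolding F_def n\<zeta> id(2) by (subst id(1)) (simp add: n)
    also have "\<dots> = G \<zeta> * \<zeta> / (\<zeta> - of_real t * z)"
      using \<zeta>0 by (simp add: G_def c_def power_divide mult_ac)
    finally show ?thesis .
  qed
  have "(\<integral>\<theta>. F (cis (2 * pi * \<theta>) * w) \<partial>unit_interval) = G (of_real t * z)"
    unfolding FG[OF refl] using w by (intro circle_average_cauchy(2)[OF G _ v]) simp
  also have "\<dots> = z ^ k * of_real (1 - t) ^ (k - 1) / fact (k - 1) * (deriv ^^ k) f (of_real t * z)"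
  proof -
    have 1: "z - of_real t * z = of_real (1 - t) * z" by (simp add: algebra_simps)
    show ?thesis
      using t0 unfolding G_def c_def 1 power_mult_distrib by (simp add: n mult_ac del: of_real_diff fact_Suc)
  qed
  finally show ?thesis .
qed

text \<open>The pole of the kernel sits at t z, so e is evaluated at 1 / cnj \<zeta> = \<zeta> / t,
  which takes the value z there. Dividing e - e(0) by its argument makes Cauchy's formula return
  e(z) - e(0). The constant e(0) is supplied by the second term, whose product with the kernel is
  antiholomorphic in \<zeta>, so its circle mean is its value at 0.\<close>

lemma circle_average_correction:
  assumes e: "e holomorphic_on ball 0 2" and z: "z \<in> unit_disk" and w: "w \<in> unit_disk" "1/2 \<le> (cmod w)\<^sup>2"
  defines "F \<equiv> \<lambda>w. ((e (1 / cnj w) - e 0) * cnj w / of_real (1 - (cmod w)\<^sup>2) - e 0 * cnj w / of_real ((cmod w)\<^sup>2))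
      * ((z - w) / (1 - z * cnj w))"
  shows "(\<integral>\<theta>. F (cis (2 * pi * \<theta>) * w) \<partial>unit_interval) = e z"
proof -
  define t where "t = (cmod w)\<^sup>2"
  have t: "1/2 \<le> t" "t < 1" using w one_minus_norm_square_pos[OF w(1)] by (auto simp: t_def)
  have w0: "w \<noteq> 0" using t by (auto simp: t_def)
  define E where "E u = (if u = 0 then deriv (\<lambda>u. e u - e 0) 0 else (e u - e 0) / (u - 0))" for u
  have E: "E holomorphic_on ball 0 2"
    by (rule pole_theorem_open_0[where g="\<lambda>u. e u - e 0" and a=0])
      (auto intro!: holomorphic_intros e simp: E_def)
  \<comment> \<open>\<open>G\<close> is holomorphic up to radius 2 t, and the circle lies inside it
    because |w| > 1/2, that is |w| < 2 |w|^2.\<close>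
  define G where "G u = E (u / of_real t) * (z - u) / of_real (1 - t)" for u
  have tne: "complex_of_real (1 - t) \<noteq> 0" using t by (simp del: of_real_diff)
  have G: "G holomorphic_on ball 0 (2 * t)"
    unfolding G_def using t tne
    by (intro holomorphic_intros holomorphic_on_compose_gen[of "\<lambda>u. u / of_real t", OF _ E, unfolded o_def])
       (auto simp: norm_divide field_simps)
  have wt: "cmod w < 2 * t"
  proof -
    have "cmod w * (1/2) < cmod w * cmod w"
    proof (rule mult_strict_left_mono)
      have "(1/2)\<^sup>2 < (cmod w)\<^sup>2" using w by (simp add: power2_eq_square)
      then show "1/2 < cmod w" by (rule power2_less_imp_less) simp
    qed (use w0 in simp)
    then show ?thesis by (simp add: t_def power2_eq_square)
  qed
  have v: "cmod (of_real t * z) < cmod w"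
  proof -
    have "cmod (of_real t * z) = cmod w * (cmod w * cmod z)" by (simp add: norm_mult t_def power2_eq_square)
    also have "\<dots> < cmod w * 1"
    proof (rule mult_strict_left_mono)
      have "cmod w * cmod z \<le> cmod z" using w by (simp add: mult_left_le_one_le)
      then show "cmod w * cmod z < 1" using z by simp
    qed (use w0 in simp)
    finally show ?thesis by simp
  qed
  \<comment> \<open>The conjugate of \<open>H\<close> is the second term times the kernel: on the
    circle cnj \<zeta> (z - \<zeta>) = z cnj \<zeta> - t. Conjugation gives a holomorphic function
    to which the mean value property applies, with cnj (H 0) = e 0.\<close>
  define H where "H u = cnj (- e 0 / of_real t) * (cnj z * u - of_real t) / (1 - cnj z * u)" for u
  have H: "H holomorphic_on ball 0 1"
  proof -
    have "1 - cnj z * u \<noteq> 0" if "u \<in> ball 0 1" for u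
      using norm_one_minus_mult_cnj_pos(2)[of u z] that z by (auto simp: mult.commute)
    then show ?thesis unfolding H_def by (intro holomorphic_intros) auto
  qed
  have FG: "F \<zeta> = G \<zeta> * \<zeta> / (\<zeta> - of_real t * z) + cnj (H \<zeta> * \<zeta> / (\<zeta> - 0))" if \<zeta>: "\<zeta> = cis (2 * pi * \<theta>) * w" for \<zeta> \<theta>
  proof -
    have n\<zeta>: "(cmod \<zeta>)\<^sup>2 = t" by (simp add: \<zeta> norm_mult t_def)
    have \<zeta>0: "\<zeta> \<noteq> 0" using w0 by (simp add: \<zeta>)
    have tt: "of_real t = \<zeta> * cnj \<zeta>" by (simp only: n\<zeta>[symmetric] complex_norm_square)
    have t0: "complex_of_real t \<noteq> 0" using t by simp
    note id = circle_kernel_identity[OF \<zeta>0 tt]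
    have ic: "1 / cnj \<zeta> = \<zeta> / of_real t" unfolding id(1) by simp
    have "(e (1 / cnj \<zeta>) - e 0) * cnj \<zeta> = E (\<zeta> / of_real t)"
      unfolding ic id(1) using \<zeta>0 t0 by (simp add: E_def)
    then have 1: "(e (1 / cnj \<zeta>) - e 0) * cnj \<zeta> / of_real (1 - t) * ((z - \<zeta>) / (1 - z * cnj \<zeta>)) = G \<zeta> * \<zeta> / (\<zeta> - of_real t * z)"
      unfolding id(2) G_def by simp
    have 2: "- (e 0 * cnj \<zeta> / of_real t) * ((z - \<zeta>) / (1 - z * cnj \<zeta>)) = cnj (H \<zeta>)"
    proof -
      have "cnj (H \<zeta>) = (- e 0 / of_real t) * (z * cnj \<zeta> - \<zeta> * cnj \<zeta>) / (1 - z * cnj \<zeta>)"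
        unfolding H_def by (simp add: tt[symmetric])
      also have "\<dots> = - (e 0 * cnj \<zeta> / of_real t) * ((z - \<zeta>) / (1 - z * cnj \<zeta>))"
      proof -
        have "z * cnj \<zeta> - \<zeta> * cnj \<zeta> = cnj \<zeta> * (z - \<zeta>)" by (simp add: algebra_simps)
        then show ?thesis by (simp only:) (simp add: mult_ac)
      qed
      finally show ?thesis ..
    qed
    have "F \<zeta> = (e (1 / cnj \<zeta>) - e 0) * cnj \<zeta> / of_real (1 - t) * ((z - \<zeta>) / (1 - z * cnj \<zeta>))
       + - (e 0 * cnj \<zeta> / of_real t) * ((z - \<zeta>) / (1 - z * cnj \<zeta>))"
      unfolding F_def n\<zeta> by (simp only: diff_conv_add_uminus distrib_right)
    then show ?thesis unfolding 1 2 using \<zeta>0 by simp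
  qed
  have i1: "integrable unit_interval (\<lambda>\<theta>. G (cis (2 * pi * \<theta>) * w) * (cis (2 * pi * \<theta>) * w) / (cis (2 * pi * \<theta>) * w - of_real t * z))"
    and a1: "(\<integral>\<theta>. G (cis (2 * pi * \<theta>) * w) * (cis (2 * pi * \<theta>) * w) / (cis (2 * pi * \<theta>) * w - of_real t * z) \<partial>unit_interval) = G (of_real t * z)"
    by (rule circle_average_cauchy[OF G wt v])+
  have w1: "cmod w < 1" "cmod 0 < cmod w" using w w0 by auto
  have i2: "integrable unit_interval (\<lambda>\<theta>. H (cis (2 * pi * \<theta>) * w) * (cis (2 * pi * \<theta>) * w) / (cis (2 * pi * \<theta>) * w - 0))"
    and a2: "(\<integral>\<theta>. H (cis (2 * pi * \<theta>) * w) * (cis (2 * pi * \<theta>) * w) / (cis (2 * pi * \<theta>) * w - 0) \<partial>unit_interval) = H 0"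
    by (rule circle_average_cauchy[OF H w1])+
  have "(\<integral>\<theta>. F (cis (2 * pi * \<theta>) * w) \<partial>unit_interval) = G (of_real t * z) + cnj (H 0)"
  proof -
    define P where "P \<theta> = G (cis (2 * pi * \<theta>) * w) * (cis (2 * pi * \<theta>) * w) / (cis (2 * pi * \<theta>) * w - of_real t * z)" for \<theta> :: real
    define Q where "Q \<theta> = H (cis (2 * pi * \<theta>) * w) * (cis (2 * pi * \<theta>) * w) / (cis (2 * pi * \<theta>) * w - 0)" for \<theta> :: real
    have "(\<integral>\<theta>. P \<theta> + cnj (Q \<theta>) \<partial>unit_interval) = (\<integral>\<theta>. P \<theta> \<partial>unit_interval) + (\<integral>\<theta>. cnj (Q \<theta>) \<partial>unit_interval)"
      using i1 i2 by (intro Bochner_Integration.integral_add) (auto simp: P_def[abs_def] Q_def[abs_def])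
    also have "(\<integral>\<theta>. cnj (Q \<theta>) \<partial>unit_interval) = cnj (\<integral>\<theta>. Q \<theta> \<partial>unit_interval)" by simp
    also have "(\<integral>\<theta>. Q \<theta> \<partial>unit_interval) = H 0" unfolding Q_def by (rule a2)
    also have "(\<integral>\<theta>. P \<theta> \<partial>unit_interval) = G (of_real t * z)" unfolding P_def by (rule a1)
    finally show ?thesis unfolding FG[OF refl] P_def Q_def .
  qed
  also have "G (of_real t * z) = E z * z"
  proof -
    have "z - of_real t * z = of_real (1 - t) * z" by (simp add: algebra_simps)
    then show ?thesis using t tne by (simp add: G_def del: of_real_diff)
  qed
  also have "E z * z = e z - e 0" by (simp add: E_def)
  also have "cnj (H 0) = e 0" using t by (simp add: H_def)
  finally show ?thesis by simp
qed

text \<open>The first conclusion makes a density of size G define a finite measure, the second puts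
  its localization in L^p. Both are applied with g the k-th derivative of f and with g = 1.\<close>

lemma weighted_holomorphic_integrals:
  fixes g :: "complex \<Rightarrow> complex" and k :: nat
  assumes g: "g holomorphic_on unit_disk" and p: "0 < p" "p \<le> 1" and C: "0 < C"
  defines "G \<equiv> \<lambda>w. (1 - (cmod w)\<^sup>2) ^ k * cmod (g w)"
  assumes fin: "(\<integral>\<^sup>+w. ennreal (G w powr p) \<partial>mobius_measure) < \<infinity>"
  shows "(\<integral>\<^sup>+w. ennreal (G w) \<partial>mobius_measure) < \<infinity>"
    and "(\<integral>\<^sup>+z. ennreal (enn2real (\<integral>\<^sup>+w. ennreal (G w) * indicator (nbhd C z) w \<partial>mobius_measure) powr p)
      \<partial>mobius_measure) < \<infinity>"
proof -
  have Gm: "G \<in> borel_measurable disk_borel"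
    unfolding G_def using holomorphic_on_imp_continuous_on[OF g]
    by (intro measurable_disk_continuous continuous_intros)
  have Gpm: "(\<lambda>w. ennreal (G w powr p)) \<in> borel_measurable disk_borel" using Gm by measurable
  have G0: "0 \<le> G w" if "w \<in> unit_disk" for w
    using one_minus_norm_square_pos[OF that] by (simp add: G_def)
  obtain c where c: "0 \<le> c" "\<And>w. w \<in> unit_disk \<Longrightarrow> ennreal (G w powr p) \<le>
      ennreal c * (\<integral>\<^sup>+v. ennreal (G v powr p) * indicator (nbhd (1/2) w) v \<partial>mobius_measure)"
    using weighted_holomorphic_local[OF g p, of k] unfolding G_def by blast
  obtain t where t: "(\<integral>\<^sup>+w. ennreal (G w powr p) \<partial>mobius_measure) = ennreal t" "0 \<le> t"
    using fin by (cases "\<integral>\<^sup>+w. ennreal (G w powr p) \<partial>mobius_measure") auto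
  have "(\<integral>\<^sup>+w. ennreal (G w) \<partial>mobius_measure) \<le> ennreal (nbhd_upper (1/2) * (c * t) powr (1 / p))"
    by (rule nn_integral_le_powr_of_local[OF Gpm]) (use p c t G0 in auto)
  then show "(\<integral>\<^sup>+w. ennreal (G w) \<partial>mobius_measure) < \<infinity>"
    by (rule le_less_trans) simp
  show "(\<integral>\<^sup>+z. ennreal (enn2real (\<integral>\<^sup>+w. ennreal (G w) * indicator (nbhd C z) w \<partial>mobius_measure) powr p)
      \<partial>mobius_measure) < \<infinity>"
    by (rule nn_integral_nbhd_powr_le[OF Gm p G0 c fin C])
qed

lemma nn_integral_mobius_weight_finite:
  assumes p: "0 < p" and k: "p * real k > 1"
  shows "(\<integral>\<^sup>+z. ennreal (((1 - (cmod z)\<^sup>2) ^ k) powr p) \<partial>mobius_measure) < \<infinity>"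
proof -
  define s where "s = p * real k - 2"
  have s: "-1 < s" using k by (simp add: s_def)
  have "(\<integral>\<^sup>+z. ennreal (((1 - (cmod z)\<^sup>2) ^ k) powr p) \<partial>mobius_measure) =
      (\<integral>\<^sup>+z. ennreal (1 / (1 - (cmod z)\<^sup>2)\<^sup>2) * ennreal (((1 - (cmod z)\<^sup>2) ^ k) powr p) \<partial>disk_area)"
    by (rule nn_integral_mobius) measurable
  \<comment> \<open>The maximum equals 1; the factor is inserted to reach the form of
    \<open>radial_integral_le\<close> with \<delta> = 1 and exponent 1.\<close>
  also have "\<dots> = (\<integral>\<^sup>+z. ennreal ((1 - (cmod z)\<^sup>2) powr s * max 1 (1 - (cmod z)\<^sup>2) powr (- (s + 1 + 1))) \<partial>disk_area)"
  proof (rule nn_integral_cong)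
    fix z assume "z \<in> space disk_area"
    then have z: "z \<in> unit_disk" by simp
    define x where "x = 1 - (cmod z)\<^sup>2"
    have x: "0 < x" "x \<le> 1" using one_minus_norm_square_pos[OF z] by (auto simp: x_def)
    have "(x ^ k) powr p = x powr (real k * p)" using x by (simp add: powr_powr powr_realpow[symmetric])
    also have "real k * p = s + 2" by (simp add: s_def)
    also have "x powr (s + 2) = x powr s * x\<^sup>2" using x by (simp add: powr_add)
    finally have "1 / x\<^sup>2 * (x ^ k) powr p = x powr s * max 1 x powr (- (s + 1 + 1))"
      using x by (simp add: max.absorb1)
    then show "ennreal (1 / (1 - (cmod z)\<^sup>2)\<^sup>2) * ennreal (((1 - (cmod z)\<^sup>2) ^ k) powr p) =
       ennreal ((1 - (cmod z)\<^sup>2) powr s * max 1 (1 - (cmod z)\<^sup>2) powr (- (s + 1 + 1)))"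
      unfolding x_def[symmetric] by (simp add: ennreal_mult[symmetric])
  qed
  also have "\<dots> = (\<integral>\<^sup>+t. ennreal ((1 - t) powr s * max 1 (1 - t) powr (- (s + 1 + 1))) \<partial>unit_interval)"
    by (rule nn_integral_disk_area_radial) measurable
  also have "\<dots> \<le> ennreal ((1 / (s + 1) + 1 / 1) * 1 powr (- 1))"
    by (rule radial_integral_le[OF s]) auto
  also have "\<dots> < \<infinity>" by simp
  finally show ?thesis .
qed

lemma mobius_integral_density:
  fixes h :: "complex \<Rightarrow> complex"
  assumes "integrable mobius_measure h"
  shows "integrable disk_area (\<lambda>w. (1 / (1 - (cmod w)\<^sup>2)\<^sup>2) *\<^sub>R h w)"
    and "(\<integral>w. h w \<partial>mobius_measure) = (\<integral>w. (1 / (1 - (cmod w)\<^sup>2)\<^sup>2) *\<^sub>R h w \<partial>disk_area)"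
proof -
  have d: "(\<lambda>w. 1 / (1 - (cmod w)\<^sup>2)\<^sup>2) \<in> borel_measurable disk_area"
    unfolding measurable_mobius_eq by (rule measurable_restrict_space1) measurable
  have m: "h \<in> borel_measurable disk_area"
    using assms by (auto simp: measurable_mobius_eq dest: borel_measurable_integrable)
  show "integrable disk_area (\<lambda>w. (1 / (1 - (cmod w)\<^sup>2)\<^sup>2) *\<^sub>R h w)"
    using assms m d unfolding mobius_measure_def by (subst (asm) integrable_density) auto
  show "(\<integral>w. h w \<partial>mobius_measure) = (\<integral>w. (1 / (1 - (cmod w)\<^sup>2)\<^sup>2) *\<^sub>R h w \<partial>disk_area)"
    unfolding mobius_measure_def by (rule integral_density[OF m d]) simp
qed

text \<open>A density with respect to \<lambda>: relative to area the exponent would be k - 2, and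
  the two extra powers of 1 - |w|^2 undo the density of \<lambda>.\<close>

definition outer_density :: "nat \<Rightarrow> (complex \<Rightarrow> complex) \<Rightarrow> complex \<Rightarrow> complex" where
  "outer_density k f w =
    of_real (1 - (cmod w)\<^sup>2) ^ k * (deriv ^^ k) f w / (fact (k - 1) * cnj w ^ (k - 1))"

text \<open>The function of \<open>circle_average_correction\<close>, spread over 1/2 <= |w|^2 <=
  3/4. The 4 is the reciprocal length of this interval, and the final square again passes from area
  to \<lambda>.\<close>

definition annulus_density :: "(complex \<Rightarrow> complex) \<Rightarrow> complex \<Rightarrow> complex" where
  "annulus_density e w =
    4 * ((e (1 / cnj w) - e 0) * cnj w / of_real (1 - (cmod w)\<^sup>2) - e 0 * cnj w / of_real ((cmod w)\<^sup>2))
      * of_real (1 - (cmod w)\<^sup>2) ^ 2"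

text \<open>The measure is h times \<lambda>, where h1 reproduces f minus its moving Taylor
  polynomial and h2 that polynomial. All size questions reduce to |h| <= M (G1 + G2), all identities
  to circle means.\<close>

lemma representation_if_besov_space:
  assumes p: "0 < p" "p \<le> 1" and r: "0 < r" "r < 1" and pk: "p * real k > 1"
    and f: "f \<in> besov_space k p"
  shows "\<exists>\<mu>. complex_measure disk_borel \<mu> \<and>
      (\<lambda>z. enn2real (total_variation disk_borel \<mu> (pseudohyperbolic_disk z r))) \<in> Lp_space p mobius_measure \<and>
      (\<forall>z\<in>unit_disk. f z = complex_measure_integral disk_borel \<mu> (\<lambda>w. (z - w) / (1 - z * cnj w)))"
proof -
  \<comment> \<open>Since p <= 1, the condition p k > 1 forces k >= 2, which gives sense to the
    exponent k - 2 on the circles.\<close>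
  have "p * real k \<le> 1 * real k" using p by (intro mult_right_mono) auto
  then have k: "2 \<le> k" using pk by simp
  have hf: "f holomorphic_on unit_disk"
    using f by (auto simp: besov_space_def intro: analytic_imp_holomorphic)
  have hfk: "(deriv ^^ k) f holomorphic_on unit_disk" by (rule holomorphic_higher_deriv[OF hf open_ball])
  define e where "e = half_taylor k f"
  have he: "e holomorphic_on ball 0 2" unfolding e_def by (rule half_taylor_holomorphic[OF hf])
  define G1 where "G1 w = (1 - (cmod w)\<^sup>2) ^ k * cmod ((deriv ^^ k) f w)" for w
  \<comment> \<open>The bare weight, written with \<open>cmod 1\<close> so that it matches the
    pattern of the weighted lemma for g = 1.\<close>
  define G2 where "G2 w = (1 - (cmod w)\<^sup>2) ^ k * cmod 1" for w :: complex
  have G0: "0 \<le> G1 w" "0 \<le> G2 w" if "w \<in> unit_disk" for w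
    using one_minus_norm_square_pos[OF that] by (auto simp: G1_def G2_def)
  have Gm: "G1 \<in> borel_measurable disk_borel" "G2 \<in> borel_measurable disk_borel"
  proof -
    show "G1 \<in> borel_measurable disk_borel"
      unfolding G1_def using holomorphic_on_imp_continuous_on[OF hfk]
      by (intro measurable_disk_continuous continuous_intros)
    show "G2 \<in> borel_measurable disk_borel" unfolding G2_def by measurable
  qed
  have fin1: "(\<integral>\<^sup>+w. ennreal (G1 w powr p) \<partial>mobius_measure) < \<infinity>"
  proof -
    have "(\<lambda>z. (1 - (cmod z)\<^sup>2) ^ k *\<^sub>R (deriv ^^ k) f z) \<in> Lp_space p mobius_measure"
      using f by (simp add: besov_space_def)
    from Lp_space_nn_integral_finite[OF this]
    have "(\<integral>\<^sup>+w. ennreal (norm ((1 - (cmod w)\<^sup>2) ^ k *\<^sub>R (deriv ^^ k) f w) powr p) \<partial>mobius_measure) < \<infinity>" .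
    also have "(\<integral>\<^sup>+w. ennreal (norm ((1 - (cmod w)\<^sup>2) ^ k *\<^sub>R (deriv ^^ k) f w) powr p) \<partial>mobius_measure)
       = (\<integral>\<^sup>+w. ennreal (G1 w powr p) \<partial>mobius_measure)"
    proof (rule nn_integral_cong)
      fix w assume "w \<in> space mobius_measure"
      then have w: "w \<in> unit_disk" by simp
      then have "\<bar>(1 - (cmod w)\<^sup>2) ^ k\<bar> = (1 - (cmod w)\<^sup>2) ^ k"
        using one_minus_norm_square_pos[OF w] by (intro abs_of_nonneg) simp
      then show "ennreal (norm ((1 - (cmod w)\<^sup>2) ^ k *\<^sub>R (deriv ^^ k) f w) powr p) = ennreal (G1 w powr p)"
        by (simp only: norm_scaleR G1_def)
    qed
    finally show ?thesis .
  qed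
  have fin2: "(\<integral>\<^sup>+w. ennreal (G2 w powr p) \<partial>mobius_measure) < \<infinity>"
    using nn_integral_mobius_weight_finite[OF p(1) pk] by (simp add: G2_def)
  define C where "C = 2 * r / (1 - r)"
  have C: "0 < C" using r by (simp add: C_def)
  have one: "(\<lambda>_. 1) holomorphic_on unit_disk" by (rule holomorphic_on_const)
  note I1 = weighted_holomorphic_integrals[OF hfk p C, where k=k, folded G1_def, OF fin1]
  note I2 = weighted_holomorphic_integrals[OF one p C, where k=k, folded G2_def, OF fin2]

  define S1 where "S1 = {w \<in> unit_disk. 1/2 \<le> (cmod w)\<^sup>2}"
  \<comment> \<open>The lower bound keeps |1 / cnj w| below 2, where e is holomorphic; the upper one
    keeps 1 - |w|^2 at least 1/4, so a bounded density is dominated by \<open>G2\<close>.\<close>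
  define S2 where "S2 = {w :: complex. 1/2 \<le> (cmod w)\<^sup>2 \<and> (cmod w)\<^sup>2 \<le> 3/4}"
  have S2d: "w \<in> unit_disk" if "w \<in> S2" for w
    using that power2_less_imp_less[of "cmod w" 1] by (simp add: S2_def)
  have S2c: "compact S2"
  proof -
    have "closed S2" unfolding S2_def Collect_conj_eq
      by (intro closed_Int closed_Collect_le continuous_intros)
    moreover have "bounded S2"
      using S2d by (intro bounded_subset[OF bounded_ball[of 0 1]]) auto
    ultimately show ?thesis by (simp add: compact_eq_bounded_closed)
  qed
  have n0: "w \<noteq> 0" if "1/2 \<le> (cmod w)\<^sup>2" for w using that by auto
  have ge: "1/2 < cmod w" if "1/2 \<le> (cmod w)\<^sup>2" for w
  proof -
    have "(1/2)\<^sup>2 < (cmod w)\<^sup>2" using that by (simp add: power2_eq_square)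
    then show ?thesis by (rule power2_less_imp_less) simp
  qed
  define h1 where "h1 w = indicat_real S1 w *\<^sub>R outer_density k f w" for w
  define h2 where "h2 w = indicat_real S2 w *\<^sub>R annulus_density e w" for w
  have c1: "continuous_on S1 (outer_density k f)"
    unfolding outer_density_def
    by (intro continuous_intros continuous_on_subset[OF holomorphic_on_imp_continuous_on[OF hfk]])
       (auto simp: S1_def)
  have c2: "continuous_on S2 (annulus_density e)"
  proof -
    have ce: "continuous_on S2 (\<lambda>w. e (1 / cnj w))"
    proof (rule continuous_on_compose2[OF holomorphic_on_imp_continuous_on[OF he]])
      show "continuous_on S2 (\<lambda>w. 1 / cnj w)"
        by (intro continuous_intros) (auto simp: S2_def)
      show "(\<lambda>w. 1 / cnj w) ` S2 \<subseteq> ball 0 2"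
      proof (rule image_subsetI)
        fix w assume "w \<in> S2"
        then have "1/2 < cmod w" using ge by (simp add: S2_def)
        then have "1 / cmod w < 2" by (subst divide_less_eq) auto
        then show "1 / cnj w \<in> ball 0 2" by (simp add: norm_divide)
      qed
    qed
    have "complex_of_real (1 - (cmod w)\<^sup>2) \<noteq> 0" if "w \<in> S2" for w
      using one_minus_norm_square_pos[OF S2d[OF that]] by (simp only: of_real_eq_0_iff)
    moreover have "complex_of_real ((cmod w)\<^sup>2) \<noteq> 0" if "w \<in> S2" for w
      using that n0 by (simp add: S2_def)
    ultimately show ?thesis unfolding annulus_density_def[abs_def]
      by (intro continuous_intros ce) auto
  qed
  have hm: "h1 \<in> borel_measurable disk_borel" "h2 \<in> borel_measurable disk_borel"
  proof -
    have "S1 = unit_disk \<inter> {w. 1/2 \<le> (cmod w)\<^sup>2}" by (auto simp: S1_def)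
    moreover have "closed {w::complex. 1/2 \<le> (cmod w)\<^sup>2}" by (intro closed_Collect_le continuous_intros)
    ultimately have "S1 \<in> sets borel" by auto
    then show "h1 \<in> borel_measurable disk_borel" unfolding h1_def[abs_def]
      by (intro measurable_restrict_space1 borel_measurable_continuous_on_indicator c1)
    have "S2 \<in> sets borel" using S2c by (rule borel_compact)
    then show "h2 \<in> borel_measurable disk_borel" unfolding h2_def[abs_def]
      by (intro measurable_restrict_space1 borel_measurable_continuous_on_indicator c2)
  qed
  have h1bd: "cmod (h1 w) \<le> 2 ^ (k - 1) * G1 w" if w: "w \<in> unit_disk" for w
  proof (cases "w \<in> S1")
    case True
    then have w2: "1/2 < cmod w" using ge by (simp add: S1_def)
    then have w3: "0 < cmod w ^ (k - 1)" by (intro zero_less_power) linarith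
    have "cmod (of_real (1 - (cmod w)\<^sup>2)) = 1 - (cmod w)\<^sup>2"
      using one_minus_norm_square_pos[OF w] by (simp only: norm_of_real abs_of_pos)
    moreover have "cmod (fact (k - 1)) = fact (k - 1)" by (metis norm_of_nat of_nat_fact)
    ultimately have "cmod (h1 w) = G1 w / (fact (k - 1) * cmod w ^ (k - 1))"
      using True by (simp add: h1_def outer_density_def norm_mult norm_divide norm_power G1_def del: of_real_diff)
    also have "\<dots> \<le> G1 w / (1 * (1/2) ^ (k - 1))"
      \<comment> \<open>The power of |w| in the denominator is harmless because |w| > 1/2 on the
        support; this is where the cutoff near the origin pays.\<close>
      using w2 w3 G0(1)[OF w]
      by (intro divide_left_mono mult_mono power_mono mult_pos_pos) (auto simp: fact_ge_1)
    also have "\<dots> = 2 ^ (k - 1) * G1 w" by (simp add: power_divide)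
    finally show ?thesis .
  next
    case False
    then show ?thesis using G0(1)[OF w] by (simp add: h1_def)
  qed
  obtain B where B: "0 \<le> B" "\<And>w. w \<in> S2 \<Longrightarrow> cmod (annulus_density e w) \<le> B"
  proof -
    have "bounded (annulus_density e ` S2)"
      by (intro compact_imp_bounded compact_continuous_image c2 S2c)
    then obtain b where "0 < b" "\<forall>x\<in>annulus_density e ` S2. norm x \<le> b" by (auto simp: bounded_pos)
    then show ?thesis by (intro that[of b]) auto
  qed
  have h2bd: "cmod (h2 w) \<le> B * 4 ^ k * G2 w" if w: "w \<in> unit_disk" for w
  proof (cases "w \<in> S2")
    case True
    \<comment> \<open>On the annulus 4^k \<open>G2\<close> is at least 1 and absorbs the bound
      B.\<close>
    have "(1/4) ^ k \<le> (1 - (cmod w)\<^sup>2) ^ k" using True by (intro power_mono) (auto simp: S2_def)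
    then have "4 ^ k * (1/4) ^ k \<le> 4 ^ k * G2 w" by (simp add: G2_def)
    then have "1 \<le> 4 ^ k * G2 w" by (simp add: power_mult_distrib[symmetric])
    then have "B * 1 \<le> B * (4 ^ k * G2 w)" using B by (intro mult_left_mono) auto
    then show ?thesis using B(2)[OF True] True by (simp add: h2_def mult.assoc)
  next
    case False
    then show ?thesis using G0(2)[OF w] B by (simp add: h2_def)
  qed
  define M where "M = 2 ^ (k - 1) + B * 4 ^ k"
  have M: "0 \<le> M" using B by (simp add: M_def)
  have bd12: "cmod (h1 w) \<le> M * (G1 w + G2 w)" "cmod (h2 w) \<le> M * (G1 w + G2 w)"
    and bd: "cmod (h1 w + h2 w) \<le> M * G1 w + M * G2 w" if w: "w \<in> unit_disk" for w
  proof -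
    have 1: "cmod (h1 w) \<le> M * G1 w"
      using B G0(1)[OF w] by (intro order_trans[OF h1bd[OF w]] mult_right_mono) (auto simp: M_def)
    have 2: "cmod (h2 w) \<le> M * G2 w"
      using B G0(2)[OF w] by (intro order_trans[OF h2bd[OF w]] mult_right_mono) (auto simp: M_def)
    have "0 \<le> M * G1 w" "0 \<le> M * G2 w" using M G0[OF w] by auto
    then show "cmod (h1 w) \<le> M * (G1 w + G2 w)" "cmod (h2 w) \<le> M * (G1 w + G2 w)"
      using 1 2 by (auto simp: distrib_left)
    show "cmod (h1 w + h2 w) \<le> M * G1 w + M * G2 w"
      using norm_triangle_ineq[of "h1 w" "h2 w"] 1 2 by linarith
  qed
  have Gint: "integrable mobius_measure (\<lambda>w. M * (G1 w + G2 w))"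
  proof -
    have "integrable mobius_measure G1" "integrable mobius_measure G2"
      using Gm I1(1) I2(1) G0
      by (auto intro!: integrableI_nonneg simp: measurable_mobius_eq)
    then show ?thesis by simp
  qed
  have hint: "integrable mobius_measure h1" "integrable mobius_measure h2"
    by (rule Bochner_Integration.integrable_bound[OF Gint];
        use hm bd12 in \<open>auto intro!: AE_I2 order_trans[OF _ abs_ge_self] simp: measurable_mobius_eq\<close>)+
  define h where "h w = h1 w + h2 w" for w
  have hi: "integrable mobius_measure h" unfolding h_def using hint by (rule Bochner_Integration.integrable_add)
  \<comment> \<open>\<mu> is built over \<open>mobius_measure\<close>, whose measurable sets are
    those of \<open>disk_borel\<close>. The notions in the claim depend on the measurable sets
    alone, so they carry over.\<close>
  define \<mu> where "\<mu> = integral_measure mobius_measure h"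
  have \<mu>c: "complex_measure disk_borel \<mu>"
    using complex_measure_integral_measure[OF hi] complex_measure_cong_sets[OF sets_mobius_measure]
    by (simp add: \<mu>_def)

  define H where "H G z = (\<integral>\<^sup>+w. ennreal (G w) * indicator (nbhd C z) w \<partial>mobius_measure)" for G z
  define V where "V z = enn2real (total_variation disk_borel \<mu> (pseudohyperbolic_disk z r))" for z
  have TV: "total_variation disk_borel \<mu> (pseudohyperbolic_disk z r)
      = (\<integral>\<^sup>+w. ennreal (cmod (h w)) * indicator (pseudohyperbolic_disk z r) w \<partial>mobius_measure)"
    if z: "z \<in> unit_disk" for z
    unfolding \<mu>_def total_variation_cong_sets[OF sets_mobius_measure, symmetric]
    using sets_pseudohyperbolic_disk[OF z]
    by (intro total_variation_integral_measure[OF hi]) (simp add: sets_mobius_measure)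
  interpret sigma_finite_measure mobius_measure by (rule sigma_finite_mobius)
  have Hm: "H G \<in> borel_measurable mobius_measure" if [measurable]: "G \<in> borel_measurable disk_borel" for G
    unfolding H_def by (rule borel_measurable_nn_integral) (unfold case_prod_beta', measurable)
  have Hfin: "H G1 z < \<infinity>" "H G2 z < \<infinity>" for z
    unfolding H_def
    by (rule le_less_trans[OF nn_integral_mono I1(1)], simp add: indicator_def,
        rule le_less_trans[OF nn_integral_mono I2(1)], simp add: indicator_def)
  have Vbd: "V z \<le> M * (enn2real (H G1 z) + enn2real (H G2 z))" if z: "z \<in> unit_disk" for z
  proof -
    note [measurable] = Gm
    have "total_variation disk_borel \<mu> (pseudohyperbolic_disk z r) \<le>
       (\<integral>\<^sup>+w. ennreal M * (ennreal (G1 w) * indicator (nbhd C z) w + ennreal (G2 w) * indicator (nbhd C z) w) \<partial>mobius_measure)"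
      unfolding TV[OF z]
    proof (rule nn_integral_mono)
      fix w assume "w \<in> space mobius_measure"
      then have w: "w \<in> unit_disk" by simp
      have sub: "w \<in> nbhd C z" if "w \<in> pseudohyperbolic_disk z r"
        using pseudohyperbolic_disk_subset_nbhd[OF z r] that by (auto simp: C_def)
      have "ennreal (cmod (h w)) \<le> ennreal (M * (G1 w + G2 w))"
        using bd[OF w] by (intro ennreal_leI) (simp add: h_def distrib_left)
      also have "\<dots> = ennreal M * (ennreal (G1 w) + ennreal (G2 w))"
        using M G0[OF w] by (simp add: ennreal_mult)
      finally show "ennreal (cmod (h w)) * indicator (pseudohyperbolic_disk z r) w \<le>
         ennreal M * (ennreal (G1 w) * indicator (nbhd C z) w + ennreal (G2 w) * indicator (nbhd C z) w)"
        using sub by (auto simp: indicator_def)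
    qed
    also have "\<dots> = ennreal M * (H G1 z + H G2 z)"
      unfolding H_def
      by (subst nn_integral_cmult, measurable, subst nn_integral_add, measurable)
    also have "\<dots> = ennreal M * (ennreal (enn2real (H G1 z)) + ennreal (enn2real (H G2 z)))"
      using Hfin[of z] by (simp add: less_top)
    also have "\<dots> = ennreal (M * (enn2real (H G1 z) + enn2real (H G2 z)))"
      using M by (simp add: ennreal_mult)
    finally show ?thesis unfolding V_def using M by (intro enn2real_leI) auto
  qed
  have VLp: "V \<in> Lp_space p mobius_measure"
  proof (rule Lp_spaceI)
    have hmeas [measurable]: "h \<in> borel_measurable disk_borel" using hi by (auto simp: measurable_mobius_eq dest: borel_measurable_integrable)
    note measurable_indicator_pseudohyperbolic_pair[measurable]
    have "(\<lambda>z. enn2real (\<integral>\<^sup>+w. ennreal (cmod (h w)) * indicator (pseudohyperbolic_disk z r) w \<partial>mobius_measure)) \<in> borel_measurable mobius_measure"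
      by (intro measurable_compose[OF _ borel_measurable_enn2real] borel_measurable_nn_integral)
         (unfold case_prod_beta', measurable)
    then show "V \<in> borel_measurable mobius_measure"
      by (rule measurable_cong[THEN iffD1, rotated]) (simp add: V_def TV)
    have VH: "(\<integral>\<^sup>+z. ennreal ((enn2real (H G1 z) + enn2real (H G2 z)) powr p) \<partial>mobius_measure) < \<infinity>"
      using I1(2) I2(2) p Hm[OF Gm(1)] Hm[OF Gm(2)] unfolding H_def[symmetric]
      by (intro nn_integral_powr_add_finite measurable_compose[OF _ borel_measurable_enn2real]) auto
    have "(\<integral>\<^sup>+z. ennreal (norm (V z) powr p) \<partial>mobius_measure) \<le>
       (\<integral>\<^sup>+z. ennreal (M powr p) * ennreal ((enn2real (H G1 z) + enn2real (H G2 z)) powr p) \<partial>mobius_measure)"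
    proof (rule nn_integral_mono)
      fix z assume "z \<in> space mobius_measure"
      then have "norm (V z) \<le> M * (enn2real (H G1 z) + enn2real (H G2 z))" using Vbd by (simp add: V_def)
      then have "norm (V z) powr p \<le> (M * (enn2real (H G1 z) + enn2real (H G2 z))) powr p"
        using p by (intro powr_mono2) auto
      also have "\<dots> = M powr p * (enn2real (H G1 z) + enn2real (H G2 z)) powr p" by (rule powr_mult)
      finally show "ennreal (norm (V z) powr p) \<le> ennreal (M powr p) * ennreal ((enn2real (H G1 z) + enn2real (H G2 z)) powr p)"
        by (subst ennreal_mult[symmetric]) (auto intro: ennreal_leI)
    qed
    also have "\<dots> = ennreal (M powr p) * (\<integral>\<^sup>+z. ennreal ((enn2real (H G1 z) + enn2real (H G2 z)) powr p) \<partial>mobius_measure)"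
      by (rule nn_integral_cmult) (use Hm[OF Gm(1)] Hm[OF Gm(2)] in measurable)
    also have "\<dots> < \<infinity>" using VH by (auto simp: ennreal_mult_less_top)
    finally show "(\<integral>\<^sup>+z. ennreal (norm (V z) powr p) \<partial>mobius_measure) < \<infinity>" .
  qed

  have rep: "f z = complex_measure_integral disk_borel \<mu> (\<lambda>w. (z - w) / (1 - z * cnj w))" if z: "z \<in> unit_disk" for z
  proof -
    define K where "K w = (z - w) / (1 - z * cnj w)" for w
    have Km: "K \<in> borel_measurable mobius_measure"
      unfolding K_def measurable_mobius_eq by measurable
    \<comment> \<open>The kernel is the case m = 0 of \<open>kernel_deriv\<close>, whose bound is
      uniform in \<open>w\<close>.\<close>
    have Kb: "cmod (K w) \<le> 2 / (1 - cmod z)" if "w \<in> unit_disk" for w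
      using norm_kernel_deriv_le[OF z that order_refl, of 0] z by (simp add: K_def)
    have hK: "integrable mobius_measure (\<lambda>w. u w * K w)" if u: "integrable mobius_measure u" for u
    proof (rule Bochner_Integration.integrable_bound)
      show "integrable mobius_measure (\<lambda>w. (2 / (1 - cmod z)) * norm (u w))" using u by simp
      show "(\<lambda>w. u w * K w) \<in> borel_measurable mobius_measure"
        using u Km by (intro borel_measurable_times) auto
      show "AE w in mobius_measure. norm (u w * K w) \<le> norm ((2 / (1 - cmod z)) * norm (u w))"
      proof (rule AE_I2)
        fix w assume "w \<in> space mobius_measure"
        then have "cmod (u w) * cmod (K w) \<le> cmod (u w) * (2 / (1 - cmod z))"
          using Kb by (intro mult_left_mono) auto
        then show "norm (u w * K w) \<le> norm ((2 / (1 - cmod z)) * norm (u w))"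
          using z by (simp add: norm_mult mult.commute)
      qed
    qed
    have "complex_measure_integral disk_borel \<mu> K = (\<integral>w. h w * K w \<partial>mobius_measure)"
      unfolding \<mu>_def complex_measure_integral_cong_sets[OF sets_mobius_measure, symmetric]
      by (rule complex_measure_integral_integral_measure[OF hi Km hK[OF hi]])
    also have "\<dots> = (\<integral>w. h1 w * K w + h2 w * K w \<partial>mobius_measure)" by (simp add: h_def distrib_right)
    also have "\<dots> = (\<integral>w. h1 w * K w \<partial>mobius_measure) + (\<integral>w. h2 w * K w \<partial>mobius_measure)"
      by (rule Bochner_Integration.integral_add[OF hK[OF hint(1)] hK[OF hint(2)]])
    also have "(\<integral>w. h1 w * K w \<partial>mobius_measure) = f z - e z"
    proof -
      define g where "g t = z ^ k * of_real (1 - t) ^ (k - 1) / fact (k - 1) * (deriv ^^ k) f (of_real t * z)" for t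
      have "(\<integral>w. h1 w * K w \<partial>mobius_measure) = (\<integral>w. (1 / (1 - (cmod w)\<^sup>2)\<^sup>2) *\<^sub>R (h1 w * K w) \<partial>disk_area)"
        by (rule mobius_integral_density(2)[OF hK[OF hint(1)]])
      also have "\<dots> = integral {1/2..1} g"
      proof (rule integral_disk_area_of_circle_average[OF mobius_integral_density(1)[OF hK[OF hint(1)]]])
        have "cmod (of_real t * z) < 1" if "t \<in> {1/2..1}" for t
          using that z mult_left_le_one_le[of "cmod z" t] by (simp add: norm_mult)
        then have "continuous_on {1/2..1} (\<lambda>t::real. (deriv ^^ k) f (of_real t * z))"
          by (intro continuous_on_compose2[OF holomorphic_on_imp_continuous_on[OF hfk]] continuous_intros) auto
        then show "continuous_on {1/2..1} g" unfolding g_def by (intro continuous_intros) auto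
        fix w :: complex assume w: "w \<in> unit_disk"
        have wc: "cmod (cis (2 * pi * \<theta>) * w) = cmod w" for \<theta> by (simp add: norm_mult)
        show "(\<integral>\<theta>. (1 / (1 - (cmod (cis (2 * pi * \<theta>) * w))\<^sup>2)\<^sup>2) *\<^sub>R (h1 (cis (2 * pi * \<theta>) * w) * K (cis (2 * pi * \<theta>) * w)) \<partial>unit_interval)
          = indicat_real {1/2..1} ((cmod w)\<^sup>2) *\<^sub>R g ((cmod w)\<^sup>2)"
        proof (cases "1/2 \<le> (cmod w)\<^sup>2")
          case True
          obtain n where n: "k = n + 2" using k by (metis add.commute le_Suc_ex)
          have x: "complex_of_real (1 - (cmod w)\<^sup>2) \<noteq> 0"
            using one_minus_norm_square_pos[OF w] by (simp only: of_real_eq_0_iff)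
          \<comment> \<open>The density of \<lambda> lowers the exponent from k to k - 2, giving the
            integrand of \<open>circle_average_main\<close>. The identity is needed on the whole
            circle through \<open>w\<close>, on which the cutoff is constant.\<close>
          have eq: "(1 / (1 - (cmod v)\<^sup>2)\<^sup>2) *\<^sub>R (h1 v * K v) =
            of_real (1 - (cmod v)\<^sup>2) ^ (k - 2) * (deriv ^^ k) f v / (fact (k - 1) * cnj v ^ (k - 1)) * ((z - v) / (1 - z * cnj v))"
            if v: "cmod v = cmod w" for v
          proof -
            have vS: "v \<in> S1" using v True w by (simp add: S1_def)
            define X where "X = complex_of_real (1 - (cmod v)\<^sup>2)"
            have X: "X \<noteq> 0" using x v by (simp add: X_def del: of_real_diff)
            have sc: "(1 / (1 - (cmod v)\<^sup>2)\<^sup>2) *\<^sub>R y = 1 / X\<^sup>2 * y" for y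
              by (simp add: scaleR_conv_of_real X_def)
            have h1v: "h1 v = X ^ n * X\<^sup>2 * (deriv ^^ k) f v / (fact (k - 1) * cnj v ^ (k - 1))"
            proof -
              have "X ^ n * X\<^sup>2 = X ^ k" by (simp only: n power_add)
              then show ?thesis using vS by (simp add: h1_def outer_density_def X_def)
            qed
            have "1 / X\<^sup>2 * (X ^ n * X\<^sup>2 * (deriv ^^ k) f v / (fact (k - 1) * cnj v ^ (k - 1)) * K v)
               = X ^ n * (deriv ^^ k) f v / (fact (k - 1) * cnj v ^ (k - 1)) * K v"
              using X by simp
            moreover have "k - 2 = n" using n by simp
            ultimately show ?thesis unfolding sc h1v by (simp only: X_def K_def)
          qed
          show ?thesis
            unfolding eq[OF wc] circle_average_main[OF hf k z w n0[OF True]]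
            using True w one_minus_norm_square_pos[OF w] by (simp add: g_def)
        next
          case False
          then have "h1 (cis (2 * pi * \<theta>) * w) = 0" for \<theta> by (simp add: h1_def S1_def wc)
          then show ?thesis using False by simp
        qed
      qed auto
      also have "\<dots> = f z - e z"
        unfolding g_def e_def using half_taylor_remainder[OF hf _ z, of k] k by (intro integral_unique) auto
      finally show ?thesis .
    qed
    also have "(\<integral>w. h2 w * K w \<partial>mobius_measure) = e z"
    proof -
      have "(\<integral>w. h2 w * K w \<partial>mobius_measure) = (\<integral>w. (1 / (1 - (cmod w)\<^sup>2)\<^sup>2) *\<^sub>R (h2 w * K w) \<partial>disk_area)"
        by (rule mobius_integral_density(2)[OF hK[OF hint(2)]])
      \<comment> \<open>Every circle contributes 4 e(z), and t runs over an interval of length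
        1/4.\<close>
      also have "\<dots> = integral {1/2..3/4} (\<lambda>t::real. 4 * e z)"
      proof (rule integral_disk_area_of_circle_average[OF mobius_integral_density(1)[OF hK[OF hint(2)]]])
        fix w :: complex assume w: "w \<in> unit_disk"
        have wc: "cmod (cis (2 * pi * \<theta>) * w) = cmod w" for \<theta> by (simp add: norm_mult)
        show "(\<integral>\<theta>. (1 / (1 - (cmod (cis (2 * pi * \<theta>) * w))\<^sup>2)\<^sup>2) *\<^sub>R (h2 (cis (2 * pi * \<theta>) * w) * K (cis (2 * pi * \<theta>) * w)) \<partial>unit_interval)
          = indicat_real {1/2..3/4} ((cmod w)\<^sup>2) *\<^sub>R (4 * e z)"
        proof (cases "w \<in> S2")
          case True
          have x: "complex_of_real (1 - (cmod w)\<^sup>2) \<noteq> 0"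
            using one_minus_norm_square_pos[OF w] by (simp only: of_real_eq_0_iff)
          have eq: "(1 / (1 - (cmod v)\<^sup>2)\<^sup>2) *\<^sub>R (h2 v * K v) =
            4 * (((e (1 / cnj v) - e 0) * cnj v / of_real (1 - (cmod v)\<^sup>2) - e 0 * cnj v / of_real ((cmod v)\<^sup>2))
              * ((z - v) / (1 - z * cnj v)))"
            if v: "cmod v = cmod w" for v
          proof -
            have vS: "v \<in> S2" using v True by (simp add: S2_def)
            define X where "X = complex_of_real (1 - (cmod v)\<^sup>2)"
            have X: "X \<noteq> 0" using x v by (simp add: X_def del: of_real_diff)
            have sc: "(1 / (1 - (cmod v)\<^sup>2)\<^sup>2) *\<^sub>R y = 1 / X\<^sup>2 * y" for y
              by (simp add: scaleR_conv_of_real X_def)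
            have h2v: "h2 v = 4 * ((e (1 / cnj v) - e 0) * cnj v / X - e 0 * cnj v / of_real ((cmod v)\<^sup>2)) * X\<^sup>2"
              using vS by (simp add: h2_def annulus_density_def X_def del: of_real_diff)
            have "1 / X\<^sup>2 * (4 * ((e (1 / cnj v) - e 0) * cnj v / X - e 0 * cnj v / of_real ((cmod v)\<^sup>2)) * X\<^sup>2 * K v)
               = 4 * (((e (1 / cnj v) - e 0) * cnj v / X - e 0 * cnj v / of_real ((cmod v)\<^sup>2)) * K v)"
              using X by (simp only: mult_ac) simp
            then show ?thesis unfolding sc h2v by (simp only: X_def K_def)
          qed
          have "1/2 \<le> (cmod w)\<^sup>2" using True by (simp add: S2_def)
          from circle_average_correction[OF he z w this]
          show ?thesis
            unfolding eq[OF wc] integral_mult_right_zero using True by (simp add: S2_def)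
        next
          case False
          then have "h2 (cis (2 * pi * \<theta>) * w) = 0" for \<theta> by (simp add: h2_def S2_def wc)
          then show ?thesis using False by (simp add: S2_def indicator_def)
        qed
      qed (auto intro: continuous_intros)
      also have "\<dots> = e z" by (simp add: scaleR_conv_of_real)
      finally show ?thesis .
    qed
    finally show ?thesis by (simp add: K_def[abs_def])
  qed
  show ?thesis using \<mu>c VLp rep unfolding V_def[abs_def] by blast
qed

theorem theoremA:
  fixes p r :: real and k :: nat and f :: "complex \<Rightarrow> complex"
  assumes "0 < p" and "p \<le> 1"
    and "0 < r" and "r < 1"
    and "0 < k" and "p * real k > 1"
    and "f analytic_on unit_disk"
  shows "f \<in> besov_space k p \<longleftrightarrow>
    (\<exists>\<mu>. complex_measure disk_borel \<mu> \<and>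
      (\<lambda>z. enn2real (total_variation disk_borel \<mu> (pseudohyperbolic_disk z r)))
        \<in> Lp_space p mobius_measure \<and>
      (\<forall>z\<in>unit_disk. f z =
        complex_measure_integral disk_borel \<mu> (\<lambda>w. (z - w) / (1 - z * cnj w))))"
  using representation_if_besov_space[OF assms(1-4,6)] besov_space_if_representation[OF assms] by blast

end
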